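(* Let $K$ be a field of characteristic different from $2$ and $3$, let $L$ be a Lie superalgebra over $K$, $A\subsetneq L$ a proper subalgebra, $d:A\to L$ a superderivation of degree $|d|\in\{0,1\}$, and let $H=\langle L,t\mid [t,a]=d(a),\ a\in A\rangle$ be the HNN extension. Let $X$ be a homogeneous linear basis of $L$ containing a basis $B$ of $A$, let $X_1=X\cap L_1$ be its set of odd elements, and let $<$ be a total order on $T=X\cup\{t\}$ such that $a<x<t$ for all $a\in B$, $x\in X\setminus B$. Put $$\overline S=\{xy\mid x,y\in X,\ x>y\}\cup\{xx\mid x\in X_1\}\cup\{ta\mid a\in B\}\subset T^*.$$ Then the images in $H$ of the super-Lyndon–Shirshov monomials $f$ of the free Lie superalgebra with free generating set $T$ such that the word $\overline f$ does not contain any subword belonging to $\overline S$ form a basis of $H$ as a linear space.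
   Context: A Lie superalgebra over $K$ is a $\mathbb Z_2$-graded vector space $L=L_0\oplus L_1$ with a bilinear graded bracket satisfying $[x,y]=-(-1)^{|x||y|}[y,x]$ and $[x,[y,z]]=[[x,y],z]+(-1)^{|x||y|}[y,[x,z]]$ for homogeneous elements. All subalgebras and ideals are $\mathbb Z_2$-homogeneous. A superderivation $d:A\to L$ of degree $|d|$ is a linear map with $|d(a)|=|a|+|d|$ and $d([a,b])=[d(a),b]+(-1)^{|d||a|}[a,d(b)]$ for homogeneous $a,b\in A$. The HNN extension $H=\langle L,t\mid [t,a]=d(a),\ a\in A\rangle$ is the Lie superalgebra generated by $L$ and an additional element $t$ of parity $|t|=|d|$, subject to all relations of $L$ and $[t,a]=d(a)$ for $a\in A$. Equivalently, $H$ is the quotient of the free Lie superalgebra on $T=X\cup\{t\}$ by the ideal generated by all $[x,y]-\sum_v\alpha_{xy}^v v$ ($x,y\in X$) and $[t,a]-\sum_v\beta_a^v v$ ($a\in B$), where $\alpha_{xy}^v,\beta_a^v\in K$ are the coordinates in the basis $X$ of the bracket of $x,y$ in $L$ and of $d(a)$. The free Lie superalgebra on $T$ is realized as the subalgebra generated by $T$ in the free associative algebra $A\langle T\rangle$ with $[x,y]=xy-(-1)^{|x||y|}yx$. $T^*$ is the monoid of associative words on $T$; a word is odd if it contains an odd number of odd letters, otherwise even. The order $<$ extends to $T^*$ lexicographically: $u<1$ for nonempty $u$, and $xv<yw$ ($x,y\in T$) if $x<y$, or $x=y$ and $v<w$. The length-lexicographic order is: $u\ll v$ if $u$ is shorter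 than $v$, or lengths are equal and $u<v$. For $0\neq p\in A\langle T\rangle$, $\overline p$ denotes the $\ll$-largest word occurring in $p$. A Lyndon–Shirshov monomial is a nonassociative word $u$ on $T$ such that either $u\in T$, or $u=u_1u_2$ with $u_1,u_2$ Lyndon–Shirshov monomials, $u_1>u_2$ (comparing the associative words obtained by forgetting brackets), and if $u_1=v_1v_2$ then $v_2\le u_2$. A super-Lyndon–Shirshov monomial is a Lyndon–Shirshov monomial or a nonassociative word $uu$ with $u$ an odd Lyndon–Shirshov monomial. Nonassociative words are evaluated using the superbracket. For a super-Lyndon–Shirshov monomial $f$, $\overline f$ is the underlying associative word of $f$. *)

theory Defs
  imports
    Complex_Main
    "HOL-Algebra.Module"
    "HOL-Library.Poly_Mapping"
    "HOL-Library.Sublist"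
    "HOL-Library.Z2"
begin

text \<open>Parities live in the field \<^typ>\<open>bit\<close> of two elements; the sign below is \<open>(-1)\<^bsup>ij\<^esup>\<close>.\<close>

definition ksign :: "bit \<Rightarrow> bit \<Rightarrow> 'a::ring_1"
  where "ksign i j = (if i * j = 1 then - 1 else 1)"

locale lie_superalgebra = vector_space scale
  for scale :: "'k::field \<Rightarrow> 'l::ab_group_add \<Rightarrow> 'l" +
  fixes L :: "bit \<Rightarrow> 'l set"
    and bracket :: "'l \<Rightarrow> 'l \<Rightarrow> 'l"
  assumes subspace_component: "subspace (L i)"
    and components_disjoint: "L 0 \<inter> L 1 = {0}"
    and components_span: "\<exists>y\<in>L 0. \<exists>z\<in>L 1. x = y + z"
    and bracket_linear_left: "Vector_Spaces.linear scale scale (\<lambda>x. bracket x y)"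
    and bracket_linear_right: "Vector_Spaces.linear scale scale (\<lambda>y. bracket x y)"
    and bracket_graded: "x \<in> L i \<Longrightarrow> y \<in> L j \<Longrightarrow> bracket x y \<in> L (i + j)"
    and bracket_skew:
      "x \<in> L i \<Longrightarrow> y \<in> L j \<Longrightarrow> bracket x y = - scale (ksign i j) (bracket y x)"
    and bracket_jacobi:
      "x \<in> L i \<Longrightarrow> y \<in> L j \<Longrightarrow> z \<in> L k \<Longrightarrow>
        bracket x (bracket y z)
          = bracket (bracket x y) z + scale (ksign i j) (bracket y (bracket x z))"

definition lie_subalgebra ::
    "('k::field \<Rightarrow> 'l::ab_group_add \<Rightarrow> 'l) \<Rightarrow> (bit \<Rightarrow> 'l set) \<Rightarrow> ('l \<Rightarrow> 'l \<Rightarrow> 'l) \<Rightarrow> 'l set \<Rightarrow> bool"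
  where "lie_subalgebra scale L bracket A \<longleftrightarrow>
    module.subspace scale A \<and>
    (\<forall>x\<in>A. \<forall>y\<in>A. bracket x y \<in> A) \<and>
    (\<forall>x\<in>A. \<exists>y\<in>A \<inter> L 0. \<exists>z\<in>A \<inter> L 1. x = y + z)"

text \<open>Only the values of \<open>d\<close> on \<open>A\<close> matter.\<close>

definition superderivation ::
    "('k::field \<Rightarrow> 'l::ab_group_add \<Rightarrow> 'l) \<Rightarrow> (bit \<Rightarrow> 'l set) \<Rightarrow> ('l \<Rightarrow> 'l \<Rightarrow> 'l) \<Rightarrow>
      'l set \<Rightarrow> bit \<Rightarrow> ('l \<Rightarrow> 'l) \<Rightarrow> bool"
  where "superderivation scale L bracket A \<delta> d \<longleftrightarrow>
    (\<forall>x\<in>A. \<forall>y\<in>A. d (x + y) = d x + d y) \<and>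
    (\<forall>c. \<forall>x\<in>A. d (scale c x) = scale c (d x)) \<and>
    (\<forall>i. \<forall>x\<in>A \<inter> L i. d x \<in> L (i + \<delta>)) \<and>
    (\<forall>i j. \<forall>x\<in>A \<inter> L i. \<forall>y\<in>A \<inter> L j.
      d (bracket x y) = bracket (d x) y + scale (ksign \<delta> i) (bracket x (d y)))"

definition linear_basis ::
    "('k::field \<Rightarrow> 'l::ab_group_add \<Rightarrow> 'l) \<Rightarrow> 'l set \<Rightarrow> 'l set \<Rightarrow> bool"
  where "linear_basis scale V X \<longleftrightarrow> \<not> module.dependent scale X \<and> module.span scale X = V"

text \<open>Words form a monoid under concatenation. With this instance, \<open>'g list \<Rightarrow>\<^sub>0 'k\<close> with the
  convolution product is the free associative algebra on the letters \<open>'g\<close>.\<close>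

instantiation list :: (type) monoid_add
begin

definition zero_list :: "'a list" where "zero_list = []"

definition plus_list :: "'a list \<Rightarrow> 'a list \<Rightarrow> 'a list" where "plus_list = (@)"

instance by standard (simp_all add: zero_list_def plus_list_def)

end

type_synonym ('g, 'k) free_assoc = "'g list \<Rightarrow>\<^sub>0 'k"

definition fa_letter :: "'g \<Rightarrow> ('g, 'k::field) free_assoc"
  where "fa_letter x = Poly_Mapping.single [x] 1"

definition fa_scale :: "'k::field \<Rightarrow> ('g, 'k) free_assoc \<Rightarrow> ('g, 'k) free_assoc"
  where "fa_scale c p = Poly_Mapping.map ((*) c) p"

definition word_parity :: "('g \<Rightarrow> bit) \<Rightarrow> 'g list \<Rightarrow> bit"
  where "word_parity par w = sum_list (map par w)"

definition fa_part :: "('g \<Rightarrow> bit) \<Rightarrow> bit \<Rightarrow> ('g, 'k::field) free_assoc \<Rightarrow> ('g, 'k) free_assoc"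
  where "fa_part par i p = Poly_Mapping.mapp (\<lambda>w c. if word_parity par w = i then c else 0) p"

text \<open>The superbracket: \<open>xy - (-1)\<^bsup>ij\<^esup> yx\<close> for \<open>x\<close>, \<open>y\<close> homogeneous of parities
  \<open>i\<close>, \<open>j\<close>, extended bilinearly.\<close>

definition superbracket ::
    "('g \<Rightarrow> bit) \<Rightarrow> ('g, 'k::field) free_assoc \<Rightarrow> ('g, 'k) free_assoc \<Rightarrow> ('g, 'k) free_assoc"
  where "superbracket par p q =
    (\<Sum>i\<in>{0, 1}. \<Sum>j\<in>{0, 1}.
      fa_part par i p * fa_part par j q - ksign i j * (fa_part par j q * fa_part par i p))"

inductive_set free_lie :: "('g \<Rightarrow> bit) \<Rightarrow> 'g set \<Rightarrow> ('g, 'k::field) free_assoc set"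
  for par :: "'g \<Rightarrow> bit" and T :: "'g set"
  where
    letter: "x \<in> T \<Longrightarrow> fa_letter x \<in> free_lie par T"
  | zero: "0 \<in> free_lie par T"
  | add: "p \<in> free_lie par T \<Longrightarrow> q \<in> free_lie par T \<Longrightarrow> p + q \<in> free_lie par T"
  | scale: "p \<in> free_lie par T \<Longrightarrow> fa_scale c p \<in> free_lie par T"
  | bracket: "p \<in> free_lie par T \<Longrightarrow> q \<in> free_lie par T \<Longrightarrow> superbracket par p q \<in> free_lie par T"

text \<open>The ideal of the free Lie superalgebra on \<open>T\<close> generated by \<open>R\<close>. Ideals are homogeneous,
  hence the rule \<open>part\<close>; it is redundant when the elements of \<open>R\<close> are homogeneous.\<close>

inductive_set free_lie_ideal ::
    "('g \<Rightarrow> bit) \<Rightarrow> 'g set \<Rightarrow> ('g, 'k::field) free_assoc set \<Rightarrow> ('g, 'k) free_assoc set"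
  for par :: "'g \<Rightarrow> bit" and T :: "'g set" and R :: "('g, 'k) free_assoc set"
  where
    gen: "r \<in> R \<Longrightarrow> r \<in> free_lie_ideal par T R"
  | zero: "0 \<in> free_lie_ideal par T R"
  | add: "p \<in> free_lie_ideal par T R \<Longrightarrow> q \<in> free_lie_ideal par T R \<Longrightarrow>
      p + q \<in> free_lie_ideal par T R"
  | scale: "p \<in> free_lie_ideal par T R \<Longrightarrow> fa_scale c p \<in> free_lie_ideal par T R"
  | part: "p \<in> free_lie_ideal par T R \<Longrightarrow> fa_part par i p \<in> free_lie_ideal par T R"
  | bracket_left: "p \<in> free_lie par T \<Longrightarrow> q \<in> free_lie_ideal par T R \<Longrightarrow>
      superbracket par p q \<in> free_lie_ideal par T R"
  | bracket_right: "p \<in> free_lie_ideal par T R \<Longrightarrow> q \<in> free_lie par T \<Longrightarrow>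
      superbracket par p q \<in> free_lie_ideal par T R"

definition fa_coset ::
    "('g, 'k::field) free_assoc set \<Rightarrow> ('g, 'k) free_assoc \<Rightarrow> ('g, 'k) free_assoc set"
  where "fa_coset I p = {p + q | q. q \<in> I}"

text \<open>The quotient of \<open>F\<close> by the ideal \<open>I\<close>, with the bracket as (non-associative)
  multiplication; there is no unit, so the field \<open>one\<close> of the record carries no meaning.\<close>

definition lie_quotient ::
    "('g \<Rightarrow> bit) \<Rightarrow> ('g, 'k::field) free_assoc set \<Rightarrow> ('g, 'k) free_assoc set \<Rightarrow>
      ('k, ('g, 'k) free_assoc set) module"
  where "lie_quotient par F I =
    \<lparr> carrier = fa_coset I ` F,
      mult = (\<lambda>P Q. {superbracket par p q + r | p q r. p \<in> P \<and> q \<in> Q \<and> r \<in> I}),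
      one = undefined,
      zero = I,
      add = (\<lambda>P Q. {p + q | p q. p \<in> P \<and> q \<in> Q}),
      smult = (\<lambda>c P. {fa_scale c p + r | p r. p \<in> P \<and> r \<in> I}) \<rparr>"

text \<open>The family \<open>(b i)\<^bsub>i \<in> J\<^esub>\<close> is a basis of \<open>M\<close> over the field \<open>'k\<close>: a linearly independent
  family (in particular without repetitions) that spans \<open>M\<close>.\<close>

definition basis_family :: "('k::field, 'm) module \<Rightarrow> ('i \<Rightarrow> 'm) \<Rightarrow> 'i set \<Rightarrow> bool"
  where "basis_family M b J \<longleftrightarrow>
    b ` J \<subseteq> carrier M \<and>
    (\<forall>S c. finite S \<and> S \<subseteq> J \<and> (\<Oplus>\<^bsub>M\<^esub>i\<in>S. c i \<odot>\<^bsub>M\<^esub> b i) = \<zero>\<^bsub>M\<^esub> \<longrightarrow> (\<forall>i\<in>S. c i = 0)) \<and>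
    (\<forall>x\<in>carrier M. \<exists>S c. finite S \<and> S \<subseteq> J \<and> x = (\<Oplus>\<^bsub>M\<^esub>i\<in>S. c i \<odot>\<^bsub>M\<^esub> b i))"

datatype 'g naword = Letter 'g | Prod "'g naword" "'g naword"

fun assoc_word :: "'g naword \<Rightarrow> 'g list"
  where
    "assoc_word (Letter x) = [x]"
  | "assoc_word (Prod u v) = assoc_word u @ assoc_word v"

fun evaluate :: "('g \<Rightarrow> bit) \<Rightarrow> 'g naword \<Rightarrow> ('g, 'k::field) free_assoc"
  where
    "evaluate par (Letter x) = fa_letter x"
  | "evaluate par (Prod u v) = superbracket par (evaluate par u) (evaluate par v)"

text \<open>Proper prefixes are larger: the empty word is the largest word.\<close>

fun word_less :: "('g \<Rightarrow> 'g \<Rightarrow> bool) \<Rightarrow> 'g list \<Rightarrow> 'g list \<Rightarrow> bool"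
  where
    "word_less lt u [] \<longleftrightarrow> u \<noteq> []"
  | "word_less lt [] (y # w) \<longleftrightarrow> False"
  | "word_less lt (x # v) (y # w) \<longleftrightarrow> lt x y \<or> x = y \<and> word_less lt v w"

inductive lyndon_shirshov :: "('g \<Rightarrow> 'g \<Rightarrow> bool) \<Rightarrow> 'g set \<Rightarrow> 'g naword \<Rightarrow> bool"
  for lt :: "'g \<Rightarrow> 'g \<Rightarrow> bool" and T :: "'g set"
  where
    letter: "x \<in> T \<Longrightarrow> lyndon_shirshov lt T (Letter x)"
  | product:
      "lyndon_shirshov lt T u1 \<Longrightarrow> lyndon_shirshov lt T u2 \<Longrightarrow>
       word_less lt (assoc_word u2) (assoc_word u1) \<Longrightarrow>
       (\<And>v1 v2. u1 = Prod v1 v2 \<Longrightarrow>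
          word_less lt (assoc_word v2) (assoc_word u2) \<or> assoc_word v2 = assoc_word u2) \<Longrightarrow>
       lyndon_shirshov lt T (Prod u1 u2)"

definition super_lyndon_shirshov ::
    "('g \<Rightarrow> bit) \<Rightarrow> ('g \<Rightarrow> 'g \<Rightarrow> bool) \<Rightarrow> 'g set \<Rightarrow> 'g naword \<Rightarrow> bool"
  where "super_lyndon_shirshov par lt T f \<longleftrightarrow>
    lyndon_shirshov lt T f \<or>
    (\<exists>u. f = Prod u u \<and> lyndon_shirshov lt T u \<and> word_parity par (assoc_word u) = 1)"

text \<open>\<open>Stable\<close> is the letter \<open>t\<close>; \<open>Base x\<close> is \<open>x\<close> regarded as a letter.\<close>

datatype 'l hnn_letter = Base 'l | Stable

definition hnn_letters :: "'l set \<Rightarrow> 'l hnn_letter set"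
  where "hnn_letters X = insert Stable (Base ` X)"

fun hnn_parity :: "(bit \<Rightarrow> 'l set) \<Rightarrow> bit \<Rightarrow> 'l hnn_letter \<Rightarrow> bit"
  where
    "hnn_parity L \<delta> (Base x) = (if x \<in> L 1 then 1 else 0)"
  | "hnn_parity L \<delta> Stable = \<delta>"

text \<open>The linear polynomial \<open>\<Sum>v. \<alpha>\<^sub>v v\<close>, where the \<open>\<alpha>\<^sub>v\<close> are the coordinates of \<open>z\<close> in the
  basis \<open>X\<close>.\<close>

definition hnn_linear ::
    "('k::field \<Rightarrow> 'l::ab_group_add \<Rightarrow> 'l) \<Rightarrow> 'l set \<Rightarrow> 'l \<Rightarrow> ('l hnn_letter, 'k) free_assoc"
  where "hnn_linear scale X z =
    (\<Sum>v | module.representation scale X z v \<noteq> 0.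
      fa_scale (module.representation scale X z v) (fa_letter (Base v)))"

definition hnn_relations ::
    "('k::field \<Rightarrow> 'l::ab_group_add \<Rightarrow> 'l) \<Rightarrow> (bit \<Rightarrow> 'l set) \<Rightarrow> ('l \<Rightarrow> 'l \<Rightarrow> 'l) \<Rightarrow>
      bit \<Rightarrow> ('l \<Rightarrow> 'l) \<Rightarrow> 'l set \<Rightarrow> 'l set \<Rightarrow> ('l hnn_letter, 'k) free_assoc set"
  where "hnn_relations scale L bracket \<delta> d X B =
    {superbracket (hnn_parity L \<delta>) (fa_letter (Base x)) (fa_letter (Base y))
       - hnn_linear scale X (bracket x y) | x y. x \<in> X \<and> y \<in> X} \<union>
    {superbracket (hnn_parity L \<delta>) (fa_letter Stable) (fa_letter (Base a))
       - hnn_linear scale X (d a) | a. a \<in> B}"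

definition hnn_ideal ::
    "('k::field \<Rightarrow> 'l::ab_group_add \<Rightarrow> 'l) \<Rightarrow> (bit \<Rightarrow> 'l set) \<Rightarrow> ('l \<Rightarrow> 'l \<Rightarrow> 'l) \<Rightarrow>
      bit \<Rightarrow> ('l \<Rightarrow> 'l) \<Rightarrow> 'l set \<Rightarrow> 'l set \<Rightarrow> ('l hnn_letter, 'k) free_assoc set"
  where "hnn_ideal scale L bracket \<delta> d X B =
    free_lie_ideal (hnn_parity L \<delta>) (hnn_letters X) (hnn_relations scale L bracket \<delta> d X B)"

definition hnn_extension ::
    "('k::field \<Rightarrow> 'l::ab_group_add \<Rightarrow> 'l) \<Rightarrow> (bit \<Rightarrow> 'l set) \<Rightarrow> ('l \<Rightarrow> 'l \<Rightarrow> 'l) \<Rightarrow>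
      bit \<Rightarrow> ('l \<Rightarrow> 'l) \<Rightarrow> 'l set \<Rightarrow> 'l set \<Rightarrow> ('k, ('l hnn_letter, 'k) free_assoc set) module"
  where "hnn_extension scale L bracket \<delta> d X B =
    lie_quotient (hnn_parity L \<delta>) (free_lie (hnn_parity L \<delta>) (hnn_letters X))
      (hnn_ideal scale L bracket \<delta> d X B)"

definition hnn_image ::
    "('k::field \<Rightarrow> 'l::ab_group_add \<Rightarrow> 'l) \<Rightarrow> (bit \<Rightarrow> 'l set) \<Rightarrow> ('l \<Rightarrow> 'l \<Rightarrow> 'l) \<Rightarrow>
      bit \<Rightarrow> ('l \<Rightarrow> 'l) \<Rightarrow> 'l set \<Rightarrow> 'l set \<Rightarrow> 'l hnn_letter naword \<Rightarrow>
      ('l hnn_letter, 'k) free_assoc set"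
  where "hnn_image scale L bracket \<delta> d X B f =
    fa_coset (hnn_ideal scale L bracket \<delta> d X B) (evaluate (hnn_parity L \<delta>) f)"

definition hnn_leading_words ::
    "(bit \<Rightarrow> 'l set) \<Rightarrow> ('l hnn_letter \<Rightarrow> 'l hnn_letter \<Rightarrow> bool) \<Rightarrow> 'l set \<Rightarrow> 'l set \<Rightarrow>
      'l hnn_letter list set"
  where "hnn_leading_words L lt X B =
    {[Base x, Base y] | x y. x \<in> X \<and> y \<in> X \<and> lt (Base y) (Base x)} \<union>
    {[Base x, Base x] | x. x \<in> X \<inter> L 1} \<union>
    {[Stable, Base a] | a. a \<in> B}"

end

theory Submission
  imports Defs
begin

text \<open>
  Modulo the two-sided ideal of the free associative algebra generated by the relations, the words
  avoiding the leading words of the relations are linearly independent: all leading words have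
  length 2, and the overlaps \<open>xyz\<close> are resolved by the Jacobi identity and the derivation
  property of \<open>d\<close>. The leading word of a super-Lyndon-Shirshov monomial is its underlying word,
  and the monomial is determined by it. Hence the monomials avoiding the leading words are linearly
  independent modulo the associative ideal, a fortiori modulo the Lie ideal.

  For spanning it suffices that the bracket of two such monomials is a combination of such monomials
  modulo the Lie ideal. Shirshov's expansion of brackets, with control of the leading words, shows
  this: a forbidden subword can appear only where the two factors meet, and there the relations
  rewrite the bracket to monomials with a smaller leading word.
\<close>

section \<open>The free associative superalgebra\<close>

text \<open>Spanning cannot be read off from the associative normal forms: they only show that an
  element lies in the associative ideal, and that this ideal meets the free Lie superalgebra in
  nothing beyond the Lie ideal is a statement of Poincare-Birkhoff-Witt type. Hence the separate
  rewriting of brackets, all of whose steps stay modulo the Lie ideal. Its difficulty is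
  termination, because an application of Jacobi may leave the leading word unchanged. Every overlap
  is a triple x >= y >= z, and the Jacobi identity involves the third pair (x,z) as well. For x = t
  that pair is a relation only if z lies in B; this is why B has to be an initial segment of X.
  Properness of A supplies an element of X outside B, and through it t lies above B. An odd letter x
  gives [x,x] = 2xx, so 2 must be invertible. At the overlap xxx all three terms of the Jacobi
  identity coincide, which is where 3 comes from.\<close>

declare add_bit_eq_xor [simp del] mult_bit_eq_and [simp del]

abbreviation mon :: "'g list \<Rightarrow> ('g, 'k::field) free_assoc"
  where "mon w \<equiv> Poly_Mapping.single w 1"

lemma lookup_fa_scale [simp]: "Poly_Mapping.lookup (fa_scale c p) w = c * Poly_Mapping.lookup p w"
  by (simp add: fa_scale_def Poly_Mapping.map.rep_eq when_def)

interpretation fa: vector_space fa_scale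
  by unfold_locales
    (auto intro!: poly_mapping_eqI simp: lookup_add algebra_simps)

lemma single_mult_single:
  "Poly_Mapping.single u a * Poly_Mapping.single v b = Poly_Mapping.single (u @ v) (a * b)"
  by (simp add: mult_single plus_list_def)

lemma fa_scale_single [simp]: "fa_scale c (Poly_Mapping.single w a) = Poly_Mapping.single w (c * a)"
  by (auto intro!: poly_mapping_eqI simp: lookup_single when_def)

lemma fa_expand: "p = (\<Sum>w\<in>Poly_Mapping.keys p. fa_scale (Poly_Mapping.lookup p w) (mon w))"
  by (rule poly_mapping_eqI)
    (simp add: lookup_sum lookup_single when_def in_keys_iff sum.delta if_distrib cong: if_cong)

lemma mult_expand:
  fixes p q :: "('g, 'k::field) free_assoc"
  shows "p * q = (\<Sum>u\<in>Poly_Mapping.keys p. \<Sum>v\<in>Poly_Mapping.keys q.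
     Poly_Mapping.single (u @ v) (Poly_Mapping.lookup p u * Poly_Mapping.lookup q v))"
proof -
  have "p * q = (\<Sum>w\<in>Poly_Mapping.keys p. fa_scale (Poly_Mapping.lookup p w) (mon w)) *
      (\<Sum>w\<in>Poly_Mapping.keys q. fa_scale (Poly_Mapping.lookup q w) (mon w))"
    using fa_expand[of p] fa_expand[of q] by simp
  then show ?thesis
    by (simp add: sum_product single_mult_single)
qed

lemma mon_mult: "mon u * mon v = mon (u @ v)"
  by (simp add: single_mult_single)

lemma mon_mult_assoc: "mon u * (mon v * p) = mon (u @ v) * p"
  by (simp add: mon_mult flip: mult.assoc)

lemma mon_Nil: "mon [] = 1"
  by (simp flip: zero_list_def)

text \<open>All words of \<open>p\<close> have the length of \<open>u\<close>, so
  \<open>u @ v\<close> can be split in only one way and the convolution has a single term.\<close>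

lemma lookup_mult_append:
  fixes p q :: "('g, 'k::field) free_assoc"
  assumes "\<And>w. w \<in> Poly_Mapping.keys p \<Longrightarrow> length w = length u"
  shows "Poly_Mapping.lookup (p * q) (u @ v) = Poly_Mapping.lookup p u * Poly_Mapping.lookup q v"
proof -
  have "Poly_Mapping.lookup (p * q) (u @ v) = (\<Sum>u'\<in>Poly_Mapping.keys p. \<Sum>v'\<in>Poly_Mapping.keys q.
      (if v' = v then if u' = u then Poly_Mapping.lookup p u * Poly_Mapping.lookup q v else 0 else
          0))"
    unfolding mult_expand[of p q] lookup_sum
    by (intro sum.cong refl) (auto simp: lookup_single when_def dest: assms)
  also have "\<dots> = Poly_Mapping.lookup p u * Poly_Mapping.lookup q v"
    by (cases "v \<in> Poly_Mapping.keys q"; cases "u \<in> Poly_Mapping.keys p")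
      (simp_all add: sum.delta in_keys_iff)
  finally show ?thesis .
qed

lemma keys_mult_append:
  "w \<in> Poly_Mapping.keys (p * q) \<Longrightarrow>
    \<exists>u v. w = u @ v \<and> u \<in> Poly_Mapping.keys p \<and> v \<in> Poly_Mapping.keys q"
  using keys_mult[of p q] by (auto simp: plus_list_def)

lemma fa_scale_mult_left: "fa_scale c p * q = fa_scale c (p * q)"
  unfolding mult_expand[of "p * q"] mult_expand[of p q]
  by (simp add: fa_scale_def mult_map_scale_conv_mult mult.assoc mult_expand[symmetric, of p q])

lemma fa_scale_mult_right: "p * fa_scale c q = fa_scale c (p * q)"
proof -
  have "p * Poly_Mapping.single [] c = Poly_Mapping.single [] c * p" for p :: "('a, 'b) free_assoc"
    by (subst (1 2) fa_expand[of p]) (simp add: sum_distrib_left sum_distrib_right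
        single_mult_single mult.commute)
  then show ?thesis
    unfolding fa_scale_def mult_map_scale_conv_mult zero_list_def by (metis mult.assoc)
qed

lemma linear_mult_left: "Vector_Spaces.linear fa_scale fa_scale ((*) p)"
  by unfold_locales (simp_all add: algebra_simps fa_scale_mult_right)

lemma linear_mult_right: "Vector_Spaces.linear fa_scale fa_scale (\<lambda>q. q * p)"
  by unfold_locales (simp_all add: algebra_simps fa_scale_mult_left)

text \<open>The working principle behind most later membership claims. The source scalar
  multiplication \<open>s\<close> is left open so that it serves both the free algebra and
  \<open>L\<close> itself.\<close>

lemma linear_span_mem:
  assumes f: "Vector_Spaces.linear s fa_scale f" and V: "fa.subspace V"
    and S: "\<And>x. x \<in> S \<Longrightarrow> f x \<in> V" and p: "p \<in> module.span s S"
  shows "f p \<in> V"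
proof -
  interpret f: Vector_Spaces.linear s fa_scale f by (rule f)
  show ?thesis
    using p
  proof (induction rule: f.vs1.span_induct_alt)
    case base
    then show ?case using V by (simp add: f.zero fa.subspace_0)
  next
    case (step c x y)
    then show ?case
      using V S by (simp add: f.add f.scale fa.subspace_add fa.subspace_scale)
  qed
qed

lemma lookup_fa_part:
  "Poly_Mapping.lookup (fa_part par i p) w = (if word_parity par w = i then Poly_Mapping.lookup p
      w else 0)"
  by (auto simp: fa_part_def lookup_mapp when_def in_keys_iff)

lemma linear_fa_part: "Vector_Spaces.linear fa_scale fa_scale (fa_part par i)"
  by unfold_locales (auto intro!: poly_mapping_eqI simp: lookup_add lookup_fa_part)

lemma fa_part_add: "fa_part par i (p + q) = fa_part par i p + fa_part par i q"
  and fa_part_scale: "fa_part par i (fa_scale c p) = fa_scale c (fa_part par i p)"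
  by (auto intro!: poly_mapping_eqI simp: lookup_add lookup_fa_part)

lemma bit_cases: fixes i :: bit shows "i = 0 \<or> i = 1"
  by (cases i) auto

lemma word_parity_append [simp]: "word_parity par (u @ v) = word_parity par u + word_parity par v"
  by (simp add: word_parity_def)

lemma word_parity_Nil [simp]: "word_parity par [] = 0"
  and word_parity_Cons [simp]: "word_parity par (x # w) = par x + word_parity par w"
  by (simp_all add: word_parity_def)

definition fa_hom :: "('g \<Rightarrow> bit) \<Rightarrow> bit \<Rightarrow> ('g, 'k::field) free_assoc \<Rightarrow> bool"
  where "fa_hom par i p \<longleftrightarrow> (\<forall>w\<in>Poly_Mapping.keys p. word_parity par w = i)"

lemma fa_hom_part: "fa_hom par i p \<Longrightarrow> fa_part par j p = (if i = j then p else 0)"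
  by (auto intro!: poly_mapping_eqI simp: lookup_fa_part fa_hom_def in_keys_iff)

lemma fa_hom_diff: "fa_hom par i p \<Longrightarrow> fa_hom par i q \<Longrightarrow> fa_hom par i (p - q)"
  unfolding fa_hom_def using keys_diff[of p q] by blast

lemma fa_hom_scale: "fa_hom par i p \<Longrightarrow> fa_hom par i (fa_scale c p)"
  unfolding fa_hom_def by (auto simp: in_keys_iff)

lemma fa_hom_mono: "fa_hom par (word_parity par w) (mon w)"
  by (simp add: fa_hom_def)

lemma fa_hom_letter: "fa_hom par (par x) (fa_letter x)"
  by (simp add: fa_hom_def fa_letter_def)

lemma fa_hom_mult: "fa_hom par i p \<Longrightarrow> fa_hom par j q \<Longrightarrow> fa_hom par (i + j) (p * q)"
  unfolding fa_hom_def by (auto dest!: keys_mult_append)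

lemma ksign_mult_eq: "ksign i j * p = fa_scale (ksign i j) p"
  by (auto simp: ksign_def)

lemma superbracket_hom:
  assumes "fa_hom par i p" "fa_hom par j q"
  shows "superbracket par p q = p * q - fa_scale (ksign i j) (q * p)"
  using bit_cases[of i] bit_cases[of j] fa_hom_part[OF assms(1)] fa_hom_part[OF assms(2)]
  by (auto simp: superbracket_def ksign_mult_eq)

lemma fa_hom_superbracket:
  "fa_hom par i p \<Longrightarrow> fa_hom par j q \<Longrightarrow> fa_hom par (i + j) (superbracket par p q)"
  using fa_hom_mult[of par j q i p]
  by (auto simp: superbracket_hom fa_hom_diff fa_hom_scale fa_hom_mult add.commute)

lemma linear_superbracket_right: "Vector_Spaces.linear fa_scale fa_scale (superbracket par p)"
  by unfold_locales
    (simp_all add: superbracket_def ksign_mult_eq fa_part_add fa_part_scale fa_scale_mult_left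
      fa_scale_mult_right algebra_simps fa.scale_right_distrib fa.scale_right_diff_distrib
          mult.commute)

lemma linear_superbracket_left: "Vector_Spaces.linear fa_scale fa_scale (\<lambda>p. superbracket par p q)"
  by unfold_locales
    (simp_all add: superbracket_def ksign_mult_eq fa_part_add fa_part_scale fa_scale_mult_left
      fa_scale_mult_right algebra_simps fa.scale_right_distrib fa.scale_right_diff_distrib
          mult.commute)

lemma superbracket_add_left:
    "superbracket par (p + p') q = superbracket par p q + superbracket par p' q"
  and superbracket_scale_left:
      "superbracket par (fa_scale c p) q = fa_scale c (superbracket par p q)"
  and superbracket_add_right:
      "superbracket par q (p + p') = superbracket par q p + superbracket par q p'"
  and superbracket_scale_right:
      "superbracket par q (fa_scale c p) = fa_scale c (superbracket par q p)"
  using linear_superbracket_left[of par q] linear_superbracket_right[of par q]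
  by (simp_all add: Vector_Spaces.linear_iff)

lemma superbracket_skew:
  "fa_hom par i p \<Longrightarrow> fa_hom par j q \<Longrightarrow>
    superbracket par p q = - fa_scale (ksign i j) (superbracket par q p)"
  using bit_cases[of i] bit_cases[of j]
  by (auto simp: superbracket_hom ksign_def fa.scale_right_diff_distrib)

lemma superbracket_jacobi:
  assumes "fa_hom par i p" "fa_hom par j q" "fa_hom par k r"
  shows "superbracket par p (superbracket par q r) =
    superbracket par (superbracket par p q) r
      + fa_scale (ksign i j) (superbracket par q (superbracket par p r))"
proof -
  note h = assms fa_hom_superbracket[OF assms(2,3)] fa_hom_superbracket[OF assms(1,2)]
    fa_hom_superbracket[OF assms(1,3)]
  show ?thesis
    unfolding superbracket_hom[OF h(1) h(4)] superbracket_hom[OF h(5) h(3)]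
      superbracket_hom[OF h(2) h(6)]
    unfolding superbracket_hom[OF h(1,2)] superbracket_hom[OF h(2,3)] superbracket_hom[OF h(1,3)]
    using bit_cases[of i] bit_cases[of j] bit_cases[of k]
    by (auto simp: ksign_def algebra_simps)
qed

section \<open>Lyndon-Shirshov words and monomials\<close>

lemma two_neq_0:
  assumes "CHAR('k::field) \<noteq> 2"
  shows "(2::'k) \<noteq> 0"
proof
  assume "(2::'k) = 0"
  then have dvd: "CHAR('k) dvd 2"
    using of_nat_eq_0_iff_char_dvd[of 2, where ?'a = 'k] by simp
  moreover have "CHAR('k) \<le> 2" using dvd by (rule dvd_imp_le) simp
  moreover have "CHAR('k) \<noteq> 0" "CHAR('k) \<noteq> 1"
    using dvd by (metis dvd_0_left_iff zero_neq_numeral) simp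
  ultimately show False using assms by linarith
qed

lemma three_neq_0:
  assumes "CHAR('k::field) \<noteq> 3"
  shows "(3::'k) \<noteq> 0"
proof
  assume "(3::'k) = 0"
  then have dvd: "CHAR('k) dvd 3"
    using of_nat_eq_0_iff_char_dvd[of 3, where ?'a = 'k] by simp
  moreover have "CHAR('k) \<le> 3" using dvd by (rule dvd_imp_le) simp
  moreover have "CHAR('k) \<noteq> 0" "CHAR('k) \<noteq> 1" "CHAR('k) \<noteq> 2"
    using dvd by (metis dvd_0_left_iff zero_neq_numeral) (simp, metis dvd odd_numeral)
  ultimately show False using assms by linarith
qed

locale letter_order =
  fixes lt :: "'g \<Rightarrow> 'g \<Rightarrow> bool"
  assumes irrefl: "\<not> lt x x"
    and trans: "lt x y \<Longrightarrow> lt y z \<Longrightarrow> lt x z"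
    and total: "x \<noteq> y \<Longrightarrow> lt x y \<or> lt y x"
begin

abbreviation word_lt (infix "\<prec>" 50) where "u \<prec> v \<equiv> word_less lt u v"

definition word_le (infix "\<preceq>" 50) where "u \<preceq> v \<longleftrightarrow> u \<prec> v \<or> u = v"

lemma word_irrefl: "\<not> u \<prec> u"
  by (induction u) (auto simp: irrefl)

lemma word_trans: "u \<prec> v \<Longrightarrow> v \<prec> w \<Longrightarrow> u \<prec> w"
proof (induction u arbitrary: v w)
  case Nil
  then show ?case by (cases v; cases w) auto
next
  case (Cons a u)
  then show ?case by (cases v; cases w) (auto intro: trans)
qed

lemma word_total: "u \<noteq> v \<Longrightarrow> u \<prec> v \<or> v \<prec> u"
proof (induction u arbitrary: v)
  case Nil
  then show ?case by (cases v) auto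
next
  case (Cons a u)
  then show ?case using total by (cases v) auto
qed

sublocale word: linorder word_le word_lt
proof
  show "u \<prec> v \<longleftrightarrow> u \<preceq> v \<and> \<not> v \<preceq> u" for u v
    using word_irrefl word_trans by (auto simp: word_le_def)
  show "u \<preceq> v \<or> v \<preceq> u" for u v
    using word_total[of u v] by (auto simp: word_le_def)
qed (use word_irrefl word_trans in \<open>auto simp: word_le_def\<close>)

lemma append_less_append [simp]: "z @ u \<prec> z @ v \<longleftrightarrow> u \<prec> v"
  by (induction z) (auto simp: irrefl)

lemma append_le_append [simp]: "z @ u \<preceq> z @ v \<longleftrightarrow> u \<preceq> v"
  by (auto simp: word_le_def)

lemma append_less_self: "v \<noteq> [] \<Longrightarrow> u @ v \<prec> u"
  using append_less_append[of u v "[]"] by (simp del: append_less_append)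

lemma word_less_appendI:
  "u \<prec> v \<Longrightarrow> \<not> prefix v u \<Longrightarrow> u @ x \<prec> v @ y"
proof (induction u arbitrary: v)
  case Nil
  then show ?case by (cases v) auto
next
  case (Cons a u)
  then show ?case by (cases v) auto
qed

lemma word_less_append_same_length:
  "u \<prec> v \<Longrightarrow> length u = length v \<Longrightarrow> u @ x \<prec> v @ y"
proof (rule word_less_appendI)
  assume "u \<prec> v" "length u = length v"
  then show "\<not> prefix v u"
    by (metis append_eq_append_conv append_Nil2 prefix_def word_irrefl)
qed

lemma word_le_append_mono:
  "u \<preceq> v \<Longrightarrow> length u = length v \<Longrightarrow> x \<preceq> y \<Longrightarrow> u @ x \<preceq> v @ y"
  using word_less_append_same_length[of u v x y] by (auto simp: word_le_def)

text \<open>Suffixes are smaller rather than larger because the empty word is the largest: these are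
  the usual Lyndon words for the reversed order of the letters.\<close>

definition lyndon :: "'g list \<Rightarrow> bool"
  where "lyndon w \<longleftrightarrow> w \<noteq> [] \<and> (\<forall>u v. w = u @ v \<longrightarrow> u \<noteq> [] \<longrightarrow> v \<noteq> [] \<longrightarrow> v \<prec> w)"

lemma lyndonD: "lyndon (u @ v) \<Longrightarrow> u \<noteq> [] \<Longrightarrow> v \<noteq> [] \<Longrightarrow> v \<prec> u @ v"
  by (simp add: lyndon_def)

lemma lyndon_nonempty: "lyndon w \<Longrightarrow> w \<noteq> []"
  by (simp add: lyndon_def)

lemma lyndon_single [simp]: "lyndon [x]"
  by (auto simp: lyndon_def Cons_eq_append_conv)

text \<open>If \<open>u\<close> is a prefix of \<open>v\<close>, cancelling it compares a proper
  suffix of \<open>v\<close>, which is smaller than \<open>v\<close>, with \<open>z\<close>.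
  Otherwise the comparison of \<open>v\<close> with \<open>u\<close> is decided before
  \<open>u\<close> ends.\<close>

lemma lyndon_less_append:
  assumes v: "lyndon v" and u: "u \<noteq> []" and vu: "v \<prec> u" and z: "v \<preceq> z"
  shows "v \<prec> u @ z"
proof (cases "prefix u v")
  case True
  then obtain v' where v': "v = u @ v'" by (auto simp: prefix_def)
  with vu have "v' \<noteq> []" by auto
  with v v' u have "v' \<prec> v" by (simp add: lyndon_def)
  with z have "v' \<prec> z" by (auto simp: word_le_def intro: word_trans)
  then show ?thesis using v' by simp
next
  case False
  then show ?thesis using word_less_appendI[OF vu, of "[]" z] by simp
qed

lemma lyndon_append:
  assumes u: "lyndon u" and v: "lyndon v" and vu: "v \<prec> u"
  shows "lyndon (u @ v)"
proof -
  have main: "v \<prec> u @ v"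
    using lyndon_less_append[OF v lyndon_nonempty[OF u] vu] by (simp add: word_le_def)
  have "s \<prec> u @ v" if eq: "u @ v = p @ s" and p: "p \<noteq> []" and s: "s \<noteq> []" for p s
  proof -
    consider us where "p = u @ us" "v = us @ s" | us where "us \<noteq> []" "u = p @ us" "s = us @ v"
      using eq unfolding append_eq_append_conv2 by (metis append_Nil append_Nil2)
    then show ?thesis
    proof cases
      case 1
      show ?thesis
      proof (cases "us = []")
        case True
        then show ?thesis using 1 main by simp
      next
        case False
        then have "s \<prec> v" using v 1 s by (simp add: lyndon_def)
        then show ?thesis using main by (rule word_trans)
      qed
    next
      case 2
      then have "us \<prec> u" using u p by (auto simp: lyndon_def)
      moreover have "\<not> prefix u us"
        using 2 p by (auto dest: prefix_length_le)
      ultimately show ?thesis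
        using 2 word_less_appendI by blast
    qed
  qed
  then show ?thesis
    using lyndon_nonempty[OF u] by (simp add: lyndon_def)
qed

lemma lyndon_rotate:
  assumes "lyndon (u @ v)" "u \<noteq> []" "v \<noteq> []"
  shows "v @ x \<prec> u @ v @ y"
proof -
  have "v \<prec> u @ v" using assms by (rule lyndonD)
  moreover have "\<not> prefix (u @ v) v" using assms by (auto dest: prefix_length_le)
  ultimately show ?thesis using word_less_appendI by fastforce
qed

lemma lyndon_swap:
  "lyndon (u @ v) \<Longrightarrow> u \<noteq> [] \<Longrightarrow> v \<noteq> [] \<Longrightarrow> v @ u \<prec> u @ v"
  using lyndon_rotate[of u v u "[]"] by simp

text \<open>The last letter is a proper suffix, hence smaller than the word; equality with the first
  letter would make the empty word smaller than another word. Together with the shape of the rules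
  this locates forbidden junctions.\<close>

lemma lyndon_last_le_hd:
  assumes "lyndon u" "length u \<noteq> 1"
  shows "lt (last u) (hd u)"
proof -
  obtain x w y where u: "u = x # w @ [y]"
    using assms by (metis (no_types, lifting) One_nat_def append_butlast_last_id append_Cons
        length_Cons list.exhaust list.size(3) lyndon_nonempty butlast.simps(2) last.simps)
  then have "[y] \<prec> u" using assms(1) lyndonD[of "x # w" "[y]"] by simp
  then show ?thesis using u by (cases w) (auto simp: irrefl)
qed

lemma lyndon_hd_last: "lyndon u \<Longrightarrow> u = [last u] \<or> lt (last u) (hd u)"
  using lyndon_last_le_hd[of u] lyndon_nonempty[of u]
  by (cases "length u = 1") (auto simp: length_Suc_conv)

lemma word_less_hd: "u \<preceq> v \<Longrightarrow> u \<noteq> [] \<Longrightarrow> v \<noteq> [] \<Longrightarrow> lt (hd u) (hd v) \<or> hd u = hd v"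
  by (cases u; cases v) (auto simp: word_le_def)

lemma lyndon_not_square: "lyndon u \<Longrightarrow> \<not> lyndon (u @ u)"
  using lyndonD[of u u] append_less_self[of u u] lyndon_nonempty[of u] by (auto dest: word_trans)

text \<open>Prepending a letter either leaves the largest suffix as it was or makes the whole word
  larger than all its proper suffixes, which is the Lyndon condition.\<close>

lemma maximal_suffix_lyndon:
  "s \<noteq> [] \<Longrightarrow> \<exists>p. lyndon p \<and> suffix p s \<and> (\<forall>t. t \<noteq> [] \<longrightarrow> suffix t s \<longrightarrow> t \<preceq> p)"
proof (induction s)
  case (Cons a s)
  show ?case
  proof (cases "s = []")
    case True
    then show ?thesis by (intro exI[of _ "[a]"]) (auto simp: suffix_Cons word_le_def)
  next
    case False
    with Cons.IH obtain p where p: "lyndon p" "suffix p s" "\<And>t. t \<noteq> [] \<Longrightarrow> suffix t s \<Longrightarrow> t \<preceq> p"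
      by blast
    show ?thesis
    proof (cases "a # s \<preceq> p")
      case True
      then show ?thesis using p by (intro exI[of _ p]) (auto simp: suffix_Cons)
    next
      case False
      then have less: "t \<prec> a # s" if "t \<noteq> []" "suffix t s" for t
        using p(3)[OF that] by (metis word.le_less_trans word.not_le)
      then have "lyndon (a # s)"
        unfolding lyndon_def by (auto simp: Cons_eq_append_conv suffix_def)
      then show ?thesis using less
        by (intro exI[of _ "a # s"]) (auto simp: suffix_Cons word_le_def)
    qed
  qed
qed simp

abbreviation "LS \<equiv> lyndon_shirshov lt"

lemma LS_letters: "LS T f \<Longrightarrow> set (assoc_word f) \<subseteq> T"
  by (induction rule: lyndon_shirshov.induct) auto

lemma LS_lyndon: "LS T f \<Longrightarrow> lyndon (assoc_word f)"
  by (induction rule: lyndon_shirshov.induct) (auto simp: lyndon_append)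

lemma LS_ProdD:
  assumes "LS T (Prod u v)"
  shows "LS T u" "LS T v" "assoc_word v \<prec> assoc_word u"
    "u = Prod v1 v2 \<Longrightarrow> assoc_word v2 \<preceq> assoc_word v"
  using assms by (auto elim: lyndon_shirshov.cases simp: word_le_def)

lemma assoc_word_nonempty [simp]: "assoc_word f \<noteq> []"
  by (induction f) auto

lemma LS_single: "LS T f \<Longrightarrow> assoc_word f = [x] \<Longrightarrow> f = Letter x"
  by (cases f) (auto simp: append_eq_Cons_conv)

text \<open>The factorization is the standard one, with the longest proper Lyndon suffix on the
  right. A longer one has the form \<open>s' @ v\<close>; the largest suffix p of \<open>s'\<close>
  is Lyndon, hence by induction inside \<open>v2\<close>, and this gives the cycle p <= v2 <= v < s
  < s' <= p.\<close>

lemma LS_longest_lyndon_suffix: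
  "LS T (Prod u v) \<Longrightarrow> lyndon s \<Longrightarrow> suffix s (assoc_word (Prod u v)) \<Longrightarrow>
    s \<noteq> assoc_word (Prod u v) \<Longrightarrow> length s \<le> length (assoc_word v)"
proof (induction u arbitrary: v s)
  case (Letter x)
  then show ?case by (auto simp: suffix_Cons dest: suffix_length_le)
next
  case (Prod v1 v2)
  note LS = LS_ProdD[OF Prod.prems(1)]
  show ?case
  proof (rule ccontr)
    assume "\<not> ?thesis"
    with Prod.prems(3) obtain s' where s': "s = s' @ assoc_word v"
        "suffix s' (assoc_word (Prod v1 v2))"
      unfolding assoc_word.simps(2)[of "Prod v1 v2"] suffix_append
      by (auto dest: suffix_length_le)
    with \<open>\<not> length s \<le> _\<close> have "s' \<noteq> []" by auto
    note s' = s'(1) this s'(2)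
    from maximal_suffix_lyndon[OF s'(2)] obtain p where p: "lyndon p" "suffix p s'" "s' \<preceq> p"
      using s'(2) by blast
    have "s' \<noteq> assoc_word (Prod v1 v2)"
      using s' Prod.prems(4) by auto
    with s'(3) have "length s' < length (assoc_word (Prod v1 v2))"
      using suffix_length_less strict_suffix_def by blast
    moreover have "length p \<le> length s'" using p(2) by (rule suffix_length_le)
    ultimately have "p \<noteq> assoc_word (Prod v1 v2)" by auto
    moreover have sp: "suffix p (assoc_word (Prod v1 v2))"
      using p(2) s'(3) by (rule suffix_order.trans)
    ultimately have "length p \<le> length (assoc_word v2)"
      using Prod.IH(1)[OF LS(1) p(1)] by simp
    with sp have "suffix p (assoc_word v2)"
      by (auto simp: suffix_append)
    then have "p \<preceq> assoc_word v2"
      using LS_lyndon[OF LS_ProdD(2)[OF LS(1)]] lyndon_nonempty[OF p(1)]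
      by (auto simp: suffix_def lyndon_def word_le_def)
    also have "assoc_word v2 \<preceq> assoc_word v"
      using LS(4) by simp
    also have "assoc_word v \<prec> s"
      using Prod.prems(2) s' lyndonD by simp
    also have "s \<prec> s'"
      using s' append_less_self by simp
    also note \<open>s' \<preceq> p\<close>
    finally show False by simp
  qed
qed

text \<open>The right factor is the longest proper Lyndon suffix, so the word determines both
  factors.\<close>

lemma LS_inject: "LS T f \<Longrightarrow> LS T g \<Longrightarrow> assoc_word f = assoc_word g \<Longrightarrow> f = g"
proof (induction f arbitrary: g)
  case (Letter x)
  then show ?case
    by (cases g) (auto simp: Cons_eq_append_conv append_eq_Cons_conv)
next
  case (Prod u v)
  show ?case
  proof (cases g)
    case (Letter x)
    then show ?thesis using Prod.prems(3) by (auto simp: append_eq_Cons_conv)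
  next
    case g: (Prod u' v')
    have "length (assoc_word v) \<le> length (assoc_word v')"
      by (rule LS_longest_lyndon_suffix[OF Prod.prems(2)[unfolded g]])
        (use LS_lyndon[OF LS_ProdD(2)[OF Prod.prems(1)]] Prod.prems(3) g in
            \<open>auto intro: suffixI[OF sym]\<close>)
    moreover have "length (assoc_word v') \<le> length (assoc_word v)"
      by (rule LS_longest_lyndon_suffix[OF Prod.prems(1)])
        (use LS_lyndon[OF LS_ProdD(2)[OF Prod.prems(2)[unfolded g]]] Prod.prems(3) g in
            \<open>auto intro: suffixI[OF sym]\<close>)
    ultimately have "assoc_word u = assoc_word u'" "assoc_word v = assoc_word v'"
      using Prod.prems(3) g by auto
    then show ?thesis
      using Prod.IH(1)[OF LS_ProdD(1)[OF Prod.prems(1)] LS_ProdD(1)[OF Prod.prems(2)[unfolded g]]]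
        Prod.IH(2)[OF LS_ProdD(2)[OF Prod.prems(1)] LS_ProdD(2)[OF Prod.prems(2)[unfolded g]]] g
      by simp
  qed
qed

text \<open>The word of a square is never Lyndon, so plain monomials and squares cannot collide; two
  squares are told apart by the halves of their words.\<close>

lemma super_inject:
  assumes f: "super_lyndon_shirshov par lt T f" and g: "super_lyndon_shirshov par lt T g"
    and eq: "assoc_word f = assoc_word g"
  shows "f = g"
proof -
  have square: False if "LS T h" "LS T k" "assoc_word h = assoc_word (Prod k k)" for h k
    using LS_lyndon[OF that(1)] LS_lyndon[OF that(2)] lyndon_not_square that(3) by auto
  have word_eq: "assoc_word h = assoc_word k"
    if "assoc_word (Prod h h) = assoc_word (Prod k k)" for h k :: "'g naword"
  proof -
    have "length (assoc_word h) = length (assoc_word k)"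
      using arg_cong[OF that, of length] by simp
    then show ?thesis using that by simp
  qed
  consider "LS T f" "LS T g" | u where "LS T f" "g = Prod u u" "LS T u"
    | u where "LS T g" "f = Prod u u" "LS T u"
    | u v where "f = Prod u u" "g = Prod v v" "LS T u" "LS T v"
    using f g unfolding super_lyndon_shirshov_def by blast
  then show ?thesis
  proof cases
    case 1
    then show ?thesis using LS_inject eq by blast
  next
    case 2
    then show ?thesis using square[of f u] eq by simp
  next
    case 3
    then show ?thesis using square[of g u] eq by simp
  next
    case 4
    then show ?thesis using word_eq[of u v] LS_inject[of T u v] eq by simp
  qed
qed

end

section \<open>Leading words of evaluated monomials\<close>

lemma fa_hom_evaluate: "fa_hom par (word_parity par (assoc_word f)) (evaluate par f)"
proof (induction f)
  case (Letter x)
  then show ?case using fa_hom_letter[of par x] by simp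
next
  case (Prod u v)
  then show ?case using fa_hom_superbracket by simp blast
qed

lemma evaluate_Prod:
  "evaluate par (Prod u v) = evaluate par u * evaluate par v
    - fa_scale (ksign (word_parity par (assoc_word u)) (word_parity par (assoc_word v)))
        (evaluate par v * evaluate par u)"
  using superbracket_hom[OF fa_hom_evaluate fa_hom_evaluate] by simp

lemma keys_evaluate_Prod:
  fixes par :: "'g \<Rightarrow> bit"
  defines "ev \<equiv> evaluate par :: _ \<Rightarrow> ('g, 'k::field) free_assoc"
  assumes "w \<in> Poly_Mapping.keys (ev (Prod u v))"
  shows "\<exists>x\<in>Poly_Mapping.keys (ev u). \<exists>y\<in>Poly_Mapping.keys (ev v). w = x @ y \<or> w = y @ x"
proof -
  have "w \<in> Poly_Mapping.keys (ev u * ev v) \<or> w \<in> Poly_Mapping.keys (ev v * ev u)"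
    using assms unfolding evaluate_Prod ev_def in_keys_iff lookup_minus lookup_fa_scale by auto
  then show ?thesis by (blast dest: keys_mult_append)
qed

lemma length_keys_evaluate:
  "w \<in> Poly_Mapping.keys (evaluate par f :: ('g, 'k::field) free_assoc) \<Longrightarrow>
    length w = length (assoc_word f)"
proof (induction f arbitrary: w)
  case (Letter x)
  then show ?case by (simp add: fa_letter_def)
next
  case (Prod u v)
  from keys_evaluate_Prod[OF Prod.prems] show ?case by (auto dest!: Prod.IH)
qed

context letter_order
begin

text \<open>A Lyndon word exceeds its rotations, so the product in reversed order contributes only
  words below \<open>u @ v\<close>, and the leading coefficient is a product of ones.\<close>

lemma LS_leading:
  "LS T f \<Longrightarrow>
    (\<forall>w\<in>Poly_Mapping.keys (evaluate par f :: ('g, 'k::field) free_assoc). w \<preceq> assoc_word f) \<and>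
    Poly_Mapping.lookup (evaluate par f :: ('g, 'k) free_assoc) (assoc_word f) = 1"
proof (induction rule: lyndon_shirshov.induct)
  case (letter x)
  then show ?case by (simp add: fa_letter_def)
next
  case (product u v)
  let ?u = "assoc_word u" and ?v = "assoc_word v"
  let ?p = "evaluate par u :: ('g, 'k) free_assoc" and ?q = "evaluate par v :: ('g, 'k) free_assoc"
  have lyn: "lyndon (?u @ ?v)"
    by (rule lyndon_append[OF LS_lyndon[OF product.hyps(1)] LS_lyndon[OF product.hyps(2)]
        product.hyps(3)])
  have u: "\<forall>w\<in>Poly_Mapping.keys ?p. w \<preceq> ?u" "Poly_Mapping.lookup ?p ?u = 1"
    and v: "\<forall>w\<in>Poly_Mapping.keys ?q. w \<preceq> ?v" "Poly_Mapping.lookup ?q ?v = 1"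
    using product.IH by blast+
  have vu: "?v @ ?u \<prec> ?u @ ?v"
    using lyndon_rotate[OF lyn, of ?u "[]"] by simp
  have le: "x @ y \<preceq> ?u @ ?v" "y @ x \<prec> ?u @ ?v"
    if "x \<in> Poly_Mapping.keys ?p" "y \<in> Poly_Mapping.keys ?q" for x y
  proof -
    have "x \<preceq> ?u" "y \<preceq> ?v" "length x = length ?u" "length y = length ?v"
      using that u v by (auto intro: length_keys_evaluate)
    then show "x @ y \<preceq> ?u @ ?v" "y @ x \<prec> ?u @ ?v"
      using word_le_append_mono[of x ?u y ?v] word_le_append_mono[of y ?v x ?u]
        word.le_less_trans[OF _ vu] by auto
  qed
  have "w \<preceq> ?u @ ?v" if "w \<in> Poly_Mapping.keys (evaluate par (Prod u v) :: ('g, 'k) free_assoc)"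
      for w
    using keys_evaluate_Prod[OF that] le by (auto simp: word_le_def)
  moreover have "?u @ ?v \<notin> Poly_Mapping.keys (?q * ?p)"
  proof
    assume "?u @ ?v \<in> Poly_Mapping.keys (?q * ?p)"
    from keys_mult_append[OF this] obtain x y
      where "?u @ ?v = y @ x" "x \<in> Poly_Mapping.keys ?p" "y \<in> Poly_Mapping.keys ?q" by blast
    with le(2)[of x y] show False by (simp add: word_irrefl)
  qed
  moreover have "Poly_Mapping.lookup (?p * ?q) (?u @ ?v) = 1"
    using u v by (subst lookup_mult_append) (auto intro: length_keys_evaluate)
  ultimately show ?case
    by (simp add: evaluate_Prod lookup_minus in_keys_iff del: evaluate.simps)
qed

lemma super_leading:
  assumes f: "super_lyndon_shirshov par lt T f" and char: "CHAR('k::field) \<noteq> 2"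
  shows "\<And>w. w \<in> Poly_Mapping.keys (evaluate par f :: ('g, 'k) free_assoc) \<Longrightarrow> w \<preceq> assoc_word f"
    "Poly_Mapping.lookup (evaluate par f :: ('g, 'k) free_assoc) (assoc_word f) \<noteq> 0"
proof -
  let ?e = "\<lambda>f. evaluate par f :: ('g, 'k) free_assoc"
  have two: "(2::'k) \<noteq> 0" using char by (rule two_neq_0)
  have "(\<forall>w\<in>Poly_Mapping.keys (?e f). w \<preceq> assoc_word f) \<and> Poly_Mapping.lookup (?e f) (assoc_word
      f) \<noteq> 0"
    using f unfolding super_lyndon_shirshov_def
  proof (elim disjE exE conjE)
    assume "LS T f"
    then show ?thesis using LS_leading[of T f par, where ?'k = 'k] by auto
  next
    fix u assume f: "f = Prod u u" and u: "LS T u" and odd: "word_parity par (assoc_word u) = 1"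
    have "w \<preceq> assoc_word f" if "w \<in> Poly_Mapping.keys (?e f)" for w
      using keys_evaluate_Prod[OF that[unfolded f]] LS_leading[OF u, of par,
          where ?'k = 'k] length_keys_evaluate[of _ par u, where ?'k = 'k] f
      by (auto intro!: word_le_append_mono)
    \<comment> \<open>For odd \<open>u\<close> the sign in the bracket becomes a plus, so the
      leading coefficient is 2.\<close>
    moreover have "?e f = ?e u * ?e u + ?e u * ?e u"
      unfolding f evaluate_Prod odd by (simp add: ksign_def)
    then have "Poly_Mapping.lookup (?e f) (assoc_word f) = 1 + 1"
      using LS_leading[OF u, of par, where ?'k = 'k, THEN conjunct2]
      by (simp only: f assoc_word.simps lookup_add) (simp add: lookup_mult_append
          length_keys_evaluate)
    ultimately show ?thesis using two by simp
  qed
  then show "\<And>w. w \<in> Poly_Mapping.keys (?e f) \<Longrightarrow> w \<preceq> assoc_word f"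
    "Poly_Mapping.lookup (?e f) (assoc_word f) \<noteq> 0" by auto
qed

end

text \<open>Replacing the order on the letters that occur by a total order on the whole type spares all
  membership side conditions.\<close>

lemma order_extension:
  fixes lt :: "'a \<Rightarrow> 'a \<Rightarrow> bool"
  assumes irr: "irreflp_on T lt" and tr: "transp_on T lt" and tot: "totalp_on T lt"
  shows "\<exists>lt'. letter_order lt' \<and> (\<forall>x\<in>T. \<forall>y\<in>T. lt' x y \<longleftrightarrow> lt x y)"
proof -
  obtain r :: "('a \<times> 'a) set" where r: "well_order_on UNIV r"
    using well_order_on by blast
  then have lin: "linear_order_on UNIV r" by (simp add: well_order_on_def)
  then have rt: "trans r" "antisym r" "total r"
    by (auto simp: linear_order_on_def partial_order_on_def preorder_on_def)
  \<comment> \<open>Letters outside \<open>T\<close> go below \<open>T\<close> and are compared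
    among themselves by an arbitrary well-order.\<close>
  define lt' where "lt' x y \<longleftrightarrow> (if x \<in> T then y \<in> T \<and> lt x y else y \<in> T \<or> ((x, y) \<in> r \<and> x \<noteq> y))"
      for x y
  have "letter_order lt'"
  proof
    show "\<not> lt' x x" for x
      using irr by (auto simp: lt'_def irreflp_on_def)
    show "lt' x z" if "lt' x y" "lt' y z" for x y z
    proof (cases "x \<in> T \<or> y \<in> T \<or> z \<in> T")
      case True
      then show ?thesis
        using that transp_onD[OF tr, of x y z] by (simp add: lt'_def split: if_splits)
    next
      case False
      then show ?thesis
        using that transD[OF rt(1), of x y z] antisymD[OF rt(2), of x y] by (auto simp: lt'_def)
    qed
    show "lt' x y \<or> lt' y x" if "x \<noteq> y" for x y
      using that totalp_onD[OF tot, of x y] rt(3)[unfolded total_on_def, rule_format, of x y]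
      by (simp add: lt'_def)
  qed
  then show ?thesis by (intro exI[of _ lt']) (auto simp: lt'_def)
qed

section \<open>The diamond lemma for quadratic rewriting systems\<close>

definition lin_ext ::
    "('g list \<Rightarrow> ('g, 'k::field) free_assoc) \<Rightarrow> ('g, 'k) free_assoc \<Rightarrow> ('g, 'k) free_assoc"
  where "lin_ext h p = (\<Sum>w\<in>Poly_Mapping.keys p. fa_scale (Poly_Mapping.lookup p w) (h w))"

lemma lin_ext_superset:
  "finite A \<Longrightarrow> Poly_Mapping.keys p \<subseteq> A \<Longrightarrow>
    lin_ext h p = (\<Sum>w\<in>A. fa_scale (Poly_Mapping.lookup p w) (h w))"
  unfolding lin_ext_def by (rule sum.mono_neutral_left) (auto simp: in_keys_iff)

lemma linear_lin_ext: "Vector_Spaces.linear fa_scale fa_scale (lin_ext h)"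
proof -
  have "lin_ext h (p + q) = lin_ext h p + lin_ext h q" for p q
    using keys_add[of p q]
    by (simp add: lin_ext_superset[of "Poly_Mapping.keys p \<union> Poly_Mapping.keys q"] lookup_add
        fa.scale_left_distrib sum.distrib)
  moreover have "lin_ext h (fa_scale c p) = fa_scale c (lin_ext h p)" for c p
    by (subst lin_ext_superset[of "Poly_Mapping.keys p"])
      (auto simp: in_keys_iff lin_ext_def fa.scale_sum_right)
  ultimately show ?thesis
    by (simp add: Vector_Spaces.linear_iff fa.vector_space_axioms)
qed

lemma lin_ext_mono [simp]: "lin_ext h (mon w) = h w"
  by (simp add: lin_ext_def)

lemma fa_span_mult_mono:
  assumes "\<And>w. w \<in> Poly_Mapping.keys q \<Longrightarrow> p * mon w * r \<in> fa.span S"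
  shows "p * q * r \<in> fa.span S"
proof -
  have "p * q * r = (\<Sum>w\<in>Poly_Mapping.keys q. fa_scale (Poly_Mapping.lookup q w) (p * mon w * r))"
    by (subst fa_expand[of q])
      (simp add: sum_distrib_left sum_distrib_right fa_scale_mult_left fa_scale_mult_right
        del: fa_scale_single)
  then show ?thesis
    using assms by (simp add: fa.span_sum fa.span_scale)
qed

context letter_order
begin

text \<open>The alphabet need not be well ordered. Rewriting a word either shortens it or permutes its
  letters, and the condition on \<open>set\<close> makes this relation well founded for every total order.\<close>

definition word_rel :: "('g list \<times> 'g list) set"
  where "word_rel = {(v, w). length v < length w \<or> length v = length w \<and> set v \<subseteq> set w \<and> v \<prec> w}"

lemma trans_word_rel: "trans word_rel"
  by (rule transI) (auto simp: word_rel_def dest: word_trans)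

lemma wf_word_rel: "wf word_rel"
proof (rule wf_subset)
  \<comment> \<open>The rank of a word among the finitely many words of its length over its own
    letters.\<close>
  let ?r = "\<lambda>w. card {v. set v \<subseteq> set w \<and> length v = length w \<and> v \<prec> w}"
  show "wf (measures [length, ?r])" by simp
  show "word_rel \<subseteq> measures [length, ?r]"
  proof clarify
    fix v w assume vw: "(v, w) \<in> word_rel"
    have "?r v < ?r w" if "length v = length w"
    proof (rule psubset_card_mono)
      have "finite {v. set v \<subseteq> set w \<and> length v = length w}"
        by (rule finite_lists_length_eq) simp
      then show "finite {v. set v \<subseteq> set w \<and> length v = length w \<and> v \<prec> w}"
        by (rule rev_finite_subset) auto
      show "{u. set u \<subseteq> set v \<and> length u = length v \<and> u \<prec> v} \<subset>
          {v. set v \<subseteq> set w \<and> length v = length w \<and> v \<prec> w}"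
        using vw that word_irrefl by (auto simp: word_rel_def dest: word_trans)
    qed
    then show "(v, w) \<in> measures [length, ?r]"
      using vw by (auto simp: word_rel_def)
  qed
qed

lemma word_rel_context: "(v, w) \<in> word_rel \<Longrightarrow> (x @ v @ y, x @ w @ y) \<in> word_rel"
  by (auto simp: word_rel_def intro: word_less_append_same_length)

end

locale quadratic_rewriting = letter_order lt for lt :: "'g \<Rightarrow> 'g \<Rightarrow> bool" +
  fixes lhs :: "'g list set" and rhs :: "'g list \<Rightarrow> ('g, 'k::field) free_assoc"
  assumes length_lhs: "l \<in> lhs \<Longrightarrow> length l = 2"
    and rhs_less: "l \<in> lhs \<Longrightarrow> v \<in> Poly_Mapping.keys (rhs l) \<Longrightarrow> (v, l) \<in> word_rel"
begin

definition gen :: "'g list \<Rightarrow> ('g, 'k) free_assoc"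
  where "gen l = mon l - rhs l"

text \<open>What counts as trivial at \<open>w\<close> in the sense of Groebner-Shirshov bases:
  relations may be used only at places whose leading word is strictly below
  \<open>w\<close>.\<close>

definition below :: "'g list \<Rightarrow> ('g, 'k) free_assoc set"
  where "below w = {mon u * gen l * mon v | u l v. l \<in> lhs \<and> (u @ l @ v, w) \<in> word_rel}"

definition reducible :: "'g list \<Rightarrow> bool"
  where "reducible w \<longleftrightarrow> (\<exists>u l v. w = u @ l @ v \<and> l \<in> lhs)"

lemma below_memI:
  "l \<in> lhs \<Longrightarrow> (u @ l @ v, w) \<in> word_rel \<Longrightarrow> mon u * gen l * mon v \<in> fa.span (below w)"
  by (intro fa.span_base) (auto simp: below_def)

lemma below_context:
  assumes "p \<in> fa.span (below w)"
  shows "mon u * p * mon v \<in> fa.span (below (u @ w @ v))"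
proof (rule linear_span_mem[OF _ _ _ assms])
  show "Vector_Spaces.linear fa_scale fa_scale (\<lambda>p. mon u * p * mon v)"
    by unfold_locales (simp_all add: algebra_simps fa_scale_mult_left fa_scale_mult_right)
  fix p assume "p \<in> below w"
  then obtain a l b where p: "p = mon a * gen l * mon b" "l \<in> lhs" "(a @ l @ b, w) \<in> word_rel"
    by (auto simp: below_def)
  have "mon u * p * mon v = mon (u @ a) * gen l * mon (b @ v)"
    by (simp add: p(1) mult.assoc mon_mult mon_mult_assoc)
  then show "mon u * p * mon v \<in> fa.span (below (u @ w @ v))"
    using below_memI[OF p(2), of "u @ a"] word_rel_context[OF p(3), of u v] by simp
qed (rule fa.subspace_span)

text \<open>Writing \<open>l'\<close> as \<open>gen l' + rhs l'\<close> on one side and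
  \<open>l\<close> as \<open>gen l + rhs l\<close> on the other, the products of both generators
  cancel; in what stays, one redex is already rewritten to something smaller.\<close>

lemma disjoint_redexes:
  assumes "l \<in> lhs" "l' \<in> lhs"
  shows "mon u * gen l * mon (m @ l' @ v) - mon (u @ l @ m) * gen l' * mon v
    \<in> fa.span (below (u @ l @ m @ l' @ v))"
proof -
  have 1: "mon u * gen l * mon m * rhs l' * mon v \<in> fa.span (below (u @ l @ m @ l' @ v))"
  proof (rule fa_span_mult_mono)
    fix w assume "w \<in> Poly_Mapping.keys (rhs l')"
    then have "(u @ l @ m @ w @ v, u @ l @ m @ l' @ v) \<in> word_rel"
      using word_rel_context[OF rhs_less[OF assms(2)], of w "u @ l @ m" v] by simp
    moreover have "mon u * gen l * mon m * mon w * mon v = mon u * gen l * mon (m @ w @ v)"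
      by (simp add: mult.assoc mon_mult mon_mult_assoc)
    ultimately show "mon u * gen l * mon m * mon w * mon v \<in> fa.span (below (u @ l @ m @ l' @ v))"
      using below_memI[OF assms(1), of u] by simp
  qed
  have 2: "mon u * rhs l * (mon m * gen l' * mon v) \<in> fa.span (below (u @ l @ m @ l' @ v))"
  proof (rule fa_span_mult_mono)
    fix w assume "w \<in> Poly_Mapping.keys (rhs l)"
    then have "(u @ w @ m @ l' @ v, u @ l @ m @ l' @ v) \<in> word_rel"
      using word_rel_context[OF rhs_less[OF assms(1)], of w u "m @ l' @ v"] by simp
    moreover have "mon u * mon w * (mon m * gen l' * mon v) = mon (u @ w @ m) * gen l' * mon v"
      by (simp add: mult.assoc mon_mult mon_mult_assoc)
    ultimately show "mon u * mon w * (mon m * gen l' * mon v) \<in> fa.span (below (u @ l @ m @ l' @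
        v))"
      using below_memI[OF assms(2), of "u @ w @ m"] by simp
  qed
  have "mon u * gen l * mon (m @ l' @ v) - mon (u @ l @ m) * gen l' * mon v
    = mon u * gen l * mon m * (gen l' + rhs l') * mon v
      - mon u * (gen l + rhs l) * mon m * gen l' * mon v"
    by (simp add: gen_def mon_mult mon_mult_assoc mult.assoc)
  also have "\<dots> = mon u * gen l * mon m * rhs l' * mon v - mon u * rhs l * (mon m * gen l' * mon v)"
    by (simp add: algebra_simps)
  finally show ?thesis using fa.span_diff[OF 1 2] by simp
qed

end

locale confluent_quadratic_rewriting = quadratic_rewriting +
  assumes overlap: "[x, y] \<in> lhs \<Longrightarrow> [y, z] \<in> lhs \<Longrightarrow>
    gen [x, y] * mon [z] - mon [x] * gen [y, z] \<in> fa.span (below [x, y, z])"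
begin

text \<open>The offset \<open>m\<close> between the redexes decides: none means the same redex, one
  letter is the assumed overlap, two or more letters make them disjoint.\<close>

lemma redexes_le:
  assumes l: "l \<in> lhs" and l': "l' \<in> lhs" and eq: "u @ l @ v = u' @ l' @ v'"
    and le: "length u \<le> length u'"
  shows "mon u * gen l * mon v - mon u' * gen l' * mon v' \<in> fa.span (below (u @ l @ v))"
proof -
  obtain x y where xy: "l = [x, y]" using length_lhs[OF l]
    by (auto simp: length_Suc_conv numeral_2_eq_2)
  obtain x' y' where xy': "l' = [x', y']" using length_lhs[OF l']
    by (auto simp: length_Suc_conv numeral_2_eq_2)
  obtain m where m: "u' = u @ m" "[x, y] @ v = m @ [x', y'] @ v'"
    using eq le xy xy' by (auto simp: append_eq_append_conv2) 
  consider "m = []" | "m = [x]" | m' where "m = x # y # m'"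
    using m(2) by (cases m; cases "tl m") auto
  then show ?thesis
  proof cases
    case 1
    then show ?thesis using m xy xy' by (simp add: fa.span_zero)
  next
    case 2
    then have v: "v = y' # v'" "x' = y" using m by auto
    have "mon u * (gen [x, y] * mon [y'] - mon [x] * gen [y, y']) * mon v'
        \<in> fa.span (below (u @ [x, y, y'] @ v'))"
      using overlap[of x y y'] l l' xy xy' v by (intro below_context) auto
    also have "mon u * (gen [x, y] * mon [y'] - mon [x] * gen [y, y']) * mon v'
        = mon u * gen l * mon v - mon u' * gen l' * mon v'"
      by (simp add: 2 m v xy xy' algebra_simps mon_mult mon_mult_assoc)
    finally show ?thesis using v xy by simp
  next
    case 3
    then have "v = m' @ l' @ v'" using m xy' by auto
    then show ?thesis using disjoint_redexes[OF l l', of u m' v'] 3 m xy by simp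
  qed
qed

lemma redexes:
  assumes "l \<in> lhs" "l' \<in> lhs" "u @ l @ v = u' @ l' @ v'"
  shows "mon u * gen l * mon v - mon u' * gen l' * mon v' \<in> fa.span (below (u @ l @ v))"
proof (cases "length u \<le> length u'")
  case True
  then show ?thesis using redexes_le assms by blast
next
  case False
  then have "mon u' * gen l' * mon v' - mon u * gen l * mon v \<in> fa.span (below (u @ l @ v))"
    using redexes_le[of l' l u' v' u v] assms by simp
  from fa.span_neg[OF this] show ?thesis by simp
qed

text \<open>The choice is arbitrary; \<open>nf_gen\<close> shows that every other redex would lead
  to the same normal form.\<close>

definition redex :: "'a list \<Rightarrow> 'a list \<times> 'a list \<times> 'a list"
  where "redex w = (SOME (u, l, v). w = u @ l @ v \<and> l \<in> lhs)"

definition reduct :: "'a list \<Rightarrow> ('a, 'b) free_assoc"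
  where "reduct w = (case redex w of (u, l, v) \<Rightarrow> mon u * rhs l * mon v)"

definition nf :: "'a list \<Rightarrow> ('a, 'b) free_assoc"
  where "nf = wfrec word_rel (\<lambda>f w. if reducible w then lin_ext f (reduct w) else mon w)"

lemma redexE:
  assumes "reducible w"
  obtains u l v where "redex w = (u, l, v)" "w = u @ l @ v" "l \<in> lhs"
proof -
  have "case redex w of (u, l, v) \<Rightarrow> w = u @ l @ v \<and> l \<in> lhs"
    unfolding redex_def by (rule someI_ex) (use assms in \<open>auto simp: reducible_def\<close>)
  then show ?thesis using that by (auto split: prod.splits)
qed

lemma reduct_less:
  assumes "reducible w" "x \<in> Poly_Mapping.keys (reduct w)"
  shows "(x, w) \<in> word_rel"
proof -
  obtain u l v where r: "redex w = (u, l, v)" "w = u @ l @ v" "l \<in> lhs"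
    using assms(1) by (rule redexE)
  have "x \<in> Poly_Mapping.keys (mon u * rhs l * mon v)"
    using assms(2) r by (simp add: reduct_def)
  then obtain y where "x = u @ y @ v" "y \<in> Poly_Mapping.keys (rhs l)"
    by (auto dest!: keys_mult_append)
  then show ?thesis using rhs_less[OF r(3)] r(2) by (simp add: word_rel_context)
qed

lemma nf_simp: "nf w = (if reducible w then lin_ext nf (reduct w) else mon w)"
proof -
  have "lin_ext (cut nf word_rel w) (reduct w) = lin_ext nf (reduct w)" if "reducible w"
    unfolding lin_ext_def by (intro sum.cong refl) (simp add: cut_apply reduct_less[OF that])
  then show ?thesis
    by (subst nf_def, subst wfrec[OF wf_word_rel], fold nf_def) simp
qed

lemma keys_nf: "x \<in> Poly_Mapping.keys (nf w) \<Longrightarrow> x = w \<or> (x, w) \<in> word_rel"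
proof (induction w arbitrary: x rule: wf_induct_rule[OF wf_word_rel])
  case (1 w)
  show ?case
  proof (cases "reducible w")
    case True
    then have "x \<in> Poly_Mapping.keys (lin_ext nf (reduct w))"
      using 1(2) nf_simp[of w] by simp
    then obtain y where y: "y \<in> Poly_Mapping.keys (reduct w)" "x \<in> Poly_Mapping.keys (nf y)"
      unfolding lin_ext_def
      using keys_sum[of "\<lambda>w'. fa_scale (Poly_Mapping.lookup (reduct w) w') (nf w')"
          "Poly_Mapping.keys (reduct w)"]
      by (force simp: in_keys_iff)
    then show ?thesis
      using 1(1)[of y x] reduct_less[OF True] trans_word_rel by (metis transD)
  next
    case False
    then show ?thesis using 1(2) nf_simp[of w] by simp
  qed
qed

text \<open>At the chosen redex the claim is the recursion for \<open>nf\<close>. Any other redex of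
  the same word differs from it by an element trivial at \<open>w\<close>, which the induction
  hypothesis sends to 0.\<close>

lemma nf_gen: "w = u @ l @ v \<Longrightarrow> l \<in> lhs \<Longrightarrow> lin_ext nf (mon u * gen l * mon v) = 0"
proof (induction w arbitrary: u l v rule: wf_induct_rule[OF wf_word_rel])
  case (1 w)
  interpret nf: Vector_Spaces.linear fa_scale fa_scale "lin_ext nf"
    by (rule linear_lin_ext)
  have below: "lin_ext nf p = 0" if "p \<in> fa.span (below w)" for p
  proof -
    have "lin_ext nf p \<in> {0}"
    proof (rule linear_span_mem[OF linear_lin_ext _ _ that])
      fix q assume "q \<in> below w"
      then show "lin_ext nf q \<in> {0}" using 1(1) by (auto simp: below_def)
    qed simp
    then show ?thesis by simp
  qed
  have red: "reducible w" using 1(2,3) by (auto simp: reducible_def)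
  then obtain u' l' v' where r: "redex w = (u', l', v')" "w = u' @ l' @ v'" "l' \<in> lhs"
    by (rule redexE)
  have "mon u' * mon l' * mon v' = (mon w :: ('a, 'b) free_assoc)"
    by (simp add: r(2) single_mult_single)
  then have "mon u' * gen l' * mon v' = mon w - reduct w"
    by (simp add: gen_def reduct_def r(1) algebra_simps)
  then have "lin_ext nf (mon u' * gen l' * mon v') = 0"
    using nf_simp[of w] red by (simp add: nf.diff)
  moreover have "lin_ext nf (mon u * gen l * mon v - mon u' * gen l' * mon v') = 0"
    using redexes[of l l' u v u' v'] 1(2,3) r by (intro below) simp
  ultimately show ?case by (simp add: nf.diff)
qed

text \<open>The linear extension of \<open>nf\<close> kills the ideal. An irreducible
  \<open>w\<close> is its own normal form, and by maximality no other word of \<open>p\<close> has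
  \<open>w\<close> in its normal form, so the coefficient of \<open>w\<close> would survive.\<close>

theorem diamond:
  assumes p: "p \<in> fa.span {mon u * gen l * mon v | u l v. l \<in> lhs}"
    and w: "w \<in> Poly_Mapping.keys p"
    and max: "\<And>w'. w' \<in> Poly_Mapping.keys p \<Longrightarrow> (w, w') \<notin> word_rel"
  shows "reducible w"
proof (rule ccontr)
  assume nr: "\<not> reducible w"
  have "lin_ext nf p \<in> {0}"
    by (rule linear_span_mem[OF linear_lin_ext _ _ p]) (auto simp: nf_gen)
  then have "0 = Poly_Mapping.lookup (lin_ext nf p) w" by simp
  also have "\<dots> = (\<Sum>x\<in>Poly_Mapping.keys p. if x = w then Poly_Mapping.lookup p w else 0)"
    unfolding lin_ext_def lookup_sum
  proof (intro sum.cong refl)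
    fix x assume x: "x \<in> Poly_Mapping.keys p"
    show "Poly_Mapping.lookup (fa_scale (Poly_Mapping.lookup p x) (nf x)) w
        = (if x = w then Poly_Mapping.lookup p w else 0)"
      using keys_nf[of w x] max[OF x] nr nf_simp[of w] by (auto simp: in_keys_iff)
  qed
  also have "\<dots> = Poly_Mapping.lookup p w"
    using w by simp
  finally show False using w by (simp add: in_keys_iff)
qed

end

section \<open>Spanning by monomials in normal words\<close>

lemma evaluate_skew:
  "evaluate par (Prod f g) =
    - fa_scale (ksign (word_parity par (assoc_word f)) (word_parity par (assoc_word g)))
        (evaluate par (Prod g f))"
  using superbracket_skew[OF fa_hom_evaluate fa_hom_evaluate] by simp

lemma evaluate_jacobi:
  "evaluate par (Prod f (Prod g h)) = evaluate par (Prod (Prod f g) h)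
    + fa_scale (ksign (word_parity par (assoc_word f)) (word_parity par (assoc_word g)))
        (evaluate par (Prod g (Prod f h)))"
  using superbracket_jacobi[OF fa_hom_evaluate fa_hom_evaluate fa_hom_evaluate] by simp

lemma evaluate_skew_mem:
  "fa.subspace V \<Longrightarrow> evaluate par (Prod f g) \<in> V \<Longrightarrow> evaluate par (Prod g f) \<in> V"
  by (subst evaluate_skew) (intro fa.subspace_neg fa.subspace_scale)

lemma evaluate_skew_mem_inner:
  fixes V :: "('g, 'k::field) free_assoc set"
  assumes V: "fa.subspace V" and mem: "evaluate par (Prod f (Prod g h)) \<in> V"
  shows "evaluate par (Prod f (Prod h g)) \<in> V"
proof -
  have "(evaluate par (Prod f (Prod h g)) :: ('g, 'k) free_assoc) =
      fa_scale (- ksign (word_parity par (assoc_word h)) (word_parity par (assoc_word g)))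
        (evaluate par (Prod f (Prod g h)))"
    unfolding evaluate.simps(2)[of par f] evaluate_skew[of par h g]
    by (simp only: superbracket_scale_right flip: fa.scale_minus_left)
  then show ?thesis using V mem by (simp only: fa.subspace_scale)
qed

lemma evaluate_jacobi_mem:
  assumes V: "fa.subspace V" and 1: "evaluate par (Prod g (Prod f h)) \<in> V"
    and 2: "evaluate par (Prod h (Prod f g)) \<in> V"
  shows "evaluate par (Prod f (Prod g h)) \<in> V"
  by (subst evaluate_jacobi)
    (intro fa.subspace_add[OF V] fa.subspace_scale[OF V] evaluate_skew_mem[OF V 2] 1)

text \<open>For odd \<open>f\<close> the Jacobi identity reads 2[f,[f,h]] = [[f,f],h], so the nested
  bracket is recovered by halving.\<close>

lemma evaluate_square_mem:
  fixes V :: "('g, 'k::field) free_assoc set"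
  assumes V: "fa.subspace V" and two: "(2::'k) \<noteq> 0" and odd: "word_parity par (assoc_word f) = 1"
    and mem: "evaluate par (Prod (Prod f f) h) \<in> V"
  shows "evaluate par (Prod f (Prod f h)) \<in> V"
proof -
  let ?e = "evaluate par :: _ \<Rightarrow> ('g, 'k) free_assoc"
  have eq: "?e (Prod f (Prod f h)) = ?e (Prod (Prod f f) h) + fa_scale (ksign 1 1) (?e (Prod f
      (Prod f h)))"
    by (subst evaluate_jacobi) (simp only: odd)
  define p where "p = ?e (Prod f (Prod f h))"
  from eq have "p + p = ?e (Prod (Prod f f) h)"
    unfolding p_def[symmetric] by (simp add: ksign_def eq_diff_eq)
  moreover have "p + p = fa_scale 2 p"
    using fa.scale_left_distrib[of 1 1 p] by simp
  ultimately have "p = fa_scale (1 / 2) (?e (Prod (Prod f f) h))"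
    using two fa.scale_scale[of "1 / 2" 2 p] by simp
  then show ?thesis
    unfolding p_def using fa.subspace_scale[OF V mem] by (simp only:)
qed

lemma evaluate_square_mem':
  fixes V :: "('g, 'k::field) free_assoc set"
  assumes V: "fa.subspace V" and odd: "word_parity par (assoc_word f) = 1"
    and mem: "evaluate par (Prod f (Prod f h)) \<in> V"
  shows "evaluate par (Prod (Prod f f) h) \<in> V"
proof -
  have "(evaluate par (Prod (Prod f f) h) :: ('g, 'k) free_assoc) = evaluate par (Prod f (Prod f h))
      - fa_scale (ksign 1 1) (evaluate par (Prod f (Prod f h)))"
    unfolding eq_diff_eq by (rule evaluate_jacobi[of par f f h, unfolded odd, symmetric])
  then show ?thesis
    using fa.subspace_diff[OF V mem fa.subspace_scale[OF V mem]] by (simp only:)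
qed

lemma evaluate_self_even:
  assumes "word_parity par (assoc_word f) = 0"
  shows "evaluate par (Prod f f) = 0"
  unfolding evaluate_Prod assms by (simp add: ksign_def)

text \<open>Associatively, [f,f] = 2ff is even and commutes with \<open>f\<close>. The Jacobi
  identity alone would only make three times this bracket vanish.\<close>

lemma evaluate_cube_zero:
  assumes "word_parity par (assoc_word f) = 1"
  shows "evaluate par (Prod f (Prod f f)) = 0"
  unfolding evaluate_Prod by (simp add: assms ksign_def algebra_simps)

section \<open>Bounds for the leading word of a bracket\<close>

context letter_order
begin

text \<open>An upper bound for the words in the bracket of two length-homogeneous elements with
  leading words \<open>u\<close> and \<open>v\<close>. Taking the larger product makes it
  symmetric.\<close>

definition lead :: "'g list \<Rightarrow> 'g list \<Rightarrow> 'g list"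
  where "lead u v = (if u @ v \<preceq> v @ u then v @ u else u @ v)"

lemma lead_commute: "lead u v = lead v u"
  by (auto simp: lead_def word_le_def dest: word_trans simp: word_irrefl)

lemma lead_ge: "u @ v \<preceq> lead u v" "v @ u \<preceq> lead u v"
  using word.linear[of "u @ v" "v @ u"] by (auto simp: lead_def word_le_def)

lemma lead_less: "u @ v \<prec> m \<Longrightarrow> v @ u \<prec> m \<Longrightarrow> lead u v \<prec> m"
  by (simp add: lead_def)

lemma lead_le: "u @ v \<preceq> m \<Longrightarrow> v @ u \<preceq> m \<Longrightarrow> lead u v \<preceq> m"
  by (simp add: lead_def)

lemma length_lead [simp]: "length (lead u v) = length u + length v"
  by (simp add: lead_def)

lemma lead_lyndon:
  assumes "lyndon u" "lyndon v" "v \<prec> u"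
  shows "lead u v = u @ v"
proof -
  have "v @ u \<prec> u @ v"
    using lyndon_rotate[OF lyndon_append[OF assms] lyndon_nonempty lyndon_nonempty, OF assms(1,2),
        of u "[]"]
    by simp
  then show ?thesis by (auto simp: lead_def word_le_def word_irrefl dest: word_trans)
qed

text \<open>Serves [a,[p,q]] after the inner bracket has been expanded into monomials with word
  \<open>b\<close>: the four words are the arrangements in which \<open>a\<close> stays
  outside.\<close>

lemma lead_outer_less:
  assumes "b \<preceq> lead p q" "length b = length p + length q"
    and "a @ p @ q \<prec> m" "a @ q @ p \<prec> m" "p @ q @ a \<prec> m" "q @ p @ a \<prec> m"
  shows "lead a b \<prec> m"
proof (rule lead_less)
  have "a @ lead p q \<prec> m" "lead p q @ a \<prec> m"
    using assms by (auto simp: lead_def)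
  moreover have "a @ b \<preceq> a @ lead p q" "b @ a \<preceq> lead p q @ a"
    using assms(1,2) word_le_append_mono[of b "lead p q" a a] by (auto simp: word_le_def[of a a])
  ultimately show "a @ b \<prec> m" "b @ a \<prec> m"
    using word.le_less_trans by blast+
qed

text \<open>Compares [y,[y,z]] with [[y,y],z]: the word \<open>y @ z @ y\<close> always lies between
  \<open>y @ y @ z\<close> and \<open>z @ y @ y\<close>.\<close>

lemma lead_self_append:
  assumes len: "length b = length y + length z"
  shows "b \<preceq> lead y z \<Longrightarrow> lead y b \<preceq> lead (y @ y) z"
    and "b \<prec> lead y z \<Longrightarrow> lead y b \<prec> lead (y @ y) z"
proof -
  have le: "y @ lead y z \<preceq> lead (y @ y) z" "lead y z @ y \<preceq> lead (y @ y) z"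
  proof -
    consider "y @ z \<preceq> z @ y" "lead y z = z @ y" | "z @ y \<preceq> y @ z" "lead y z = y @ z"
      using word.linear[of "y @ z" "z @ y"] unfolding lead_def by metis
    then have "y @ lead y z \<preceq> lead (y @ y) z \<and> lead y z @ y \<preceq> lead (y @ y) z"
    proof cases
      case 1
      then have "y @ z @ y \<preceq> z @ y @ y"
        using word_le_append_mono[OF 1(1), of y y] by simp
      then show ?thesis
        using 1 lead_ge(2)[where u = "y @ y"
            and v = z] word.order.trans[of "y @ z @ y" "z @ y @ y" "lead (y @ y) z"] by simp
    next
      case 2
      then have "y @ z @ y \<preceq> y @ y @ z" by simp
      then show ?thesis
        using 2 lead_ge(1)[where u = "y @ y" and v = z]
          word.order.trans[of "y @ z @ y" "y @ y @ z" "lead (y @ y) z"] by simp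
    qed
    then show "y @ lead y z \<preceq> lead (y @ y) z" "lead y z @ y \<preceq> lead (y @ y) z" by auto
  qed
  show "lead y b \<preceq> lead (y @ y) z" if "b \<preceq> lead y z"
  proof (rule lead_le)
    show "y @ b \<preceq> lead (y @ y) z"
      using that by (intro word.order.trans[OF _ le(1)]) simp
    show "b @ y \<preceq> lead (y @ y) z"
      using that len by (intro word.order.trans[OF word_le_append_mono le(2)]) simp_all
  qed
  show "lead y b \<prec> lead (y @ y) z" if "b \<prec> lead y z"
  proof (rule lead_less)
    show "y @ b \<prec> lead (y @ y) z"
      using that by (intro word.less_le_trans[OF _ le(1)]) simp
    show "b @ y \<prec> lead (y @ y) z"
      using that len by (intro word.less_le_trans[OF word_less_append_same_length le(2)]) simp_all
  qed
qed

end

text \<open>Abstracts what spanning needs from the HNN relations: \<open>I\<close> is stable under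
  brackets with the free Lie superalgebra, and a forbidden pair of letters has a bracket that is
  linear modulo \<open>I\<close>.\<close>

locale lie_reduction = letter_order lt for lt :: "'g \<Rightarrow> 'g \<Rightarrow> bool" +
  fixes par :: "'g \<Rightarrow> bit" and T :: "'g set" and lhs :: "'g list set"
    and I :: "('g, 'k::field) free_assoc set"
  assumes two: "(2::'k) \<noteq> 0"
    and lhs_form: "l \<in> lhs \<Longrightarrow> \<exists>x y. l = [x, y] \<and> x \<in> T \<and> y \<in> T \<and> (lt y x \<or> x = y \<and> par x = 1)"
    and subspace_I: "fa.subspace I"
    and I_left: "p \<in> free_lie par T \<Longrightarrow> q \<in> I \<Longrightarrow> superbracket par p q \<in> I"
    and I_right: "p \<in> I \<Longrightarrow> q \<in> free_lie par T \<Longrightarrow> superbracket par p q \<in> I"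
    and bracket_letters: "[x, y] \<in> lhs \<Longrightarrow>
      superbracket par (fa_letter x) (fa_letter y) \<in> fa.span (fa_letter ` T \<union> I)"
begin

abbreviation ev :: "'g naword \<Rightarrow> ('g, 'k) free_assoc"
  where "ev \<equiv> evaluate par"

definition normal :: "'g list \<Rightarrow> bool"
  where "normal w \<longleftrightarrow> (\<forall>l\<in>lhs. \<not> sublist l w)"

definition nmons :: "'g naword set"
  where "nmons = {f. super_lyndon_shirshov par lt T f \<and> normal (assoc_word f)}"

definition nspan :: "'g naword set \<Rightarrow> ('g, 'k) free_assoc set"
  where "nspan F = fa.span (ev ` F \<union> I)"

text \<open>The monomials allowed in the expansion of a bracket. The condition on letters matches
  the termination measure, which ranks words over a finite set of letters.\<close>

definition bounded :: "'g list \<Rightarrow> 'g list \<Rightarrow> 'g naword set"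
  where "bounded u v = {f \<in> nmons. length (assoc_word f) < length u + length v \<or>
    length (assoc_word f) = length u + length v \<and> set (assoc_word f) \<subseteq> set u \<union> set v \<and>
    assoc_word f \<preceq> lead u v}"

lemma subspace_nspan: "fa.subspace (nspan F)"
  by (simp add: nspan_def)

lemma nspan_base: "f \<in> F \<Longrightarrow> ev f \<in> nspan F"
  by (simp add: nspan_def fa.span_base)

lemma nspan_I: "p \<in> I \<Longrightarrow> p \<in> nspan F"
  by (simp add: nspan_def fa.span_base)

lemma nspan_mono: "F \<subseteq> G \<Longrightarrow> nspan F \<subseteq> nspan G"
  unfolding nspan_def by (intro fa.span_mono) auto

lemma super_letters: "super_lyndon_shirshov par lt T f \<Longrightarrow> set (assoc_word f) \<subseteq> T"
  unfolding super_lyndon_shirshov_def by (auto dest: LS_letters[THEN subsetD])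

lemma evaluate_free_lie: "set (assoc_word f) \<subseteq> T \<Longrightarrow> ev f \<in> free_lie par T"
  by (induction f) (auto intro: free_lie.intros)

lemma nmons_free_lie: "f \<in> nmons \<Longrightarrow> ev f \<in> free_lie par T"
  using super_letters evaluate_free_lie by (auto simp: nmons_def)

lemma bracket_nspan:
  assumes f: "ev f \<in> free_lie par T" and p: "p \<in> nspan F"
    and FG: "\<And>g. g \<in> F \<Longrightarrow> ev (Prod f g) \<in> nspan G"
  shows "superbracket par (ev f) p \<in> nspan G"
  by (rule linear_span_mem[OF linear_superbracket_right subspace_nspan _ p[unfolded nspan_def]])
    (use FG I_left[OF f] nspan_I in auto)

text \<open>Forbidden words have two letters, so one that appears only after concatenation straddles
  the junction.\<close>

lemma normal_append:
  assumes "normal u" "normal v" "\<not> normal (u @ v)"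
  shows "[last u, hd v] \<in> lhs"
proof -
  obtain l where l: "l \<in> lhs" "sublist l (u @ v)"
    using assms by (auto simp: normal_def)
  obtain x y where xy: "l = [x, y]" using lhs_form[OF l(1)] by blast
  have "\<not> sublist l u" "\<not> sublist l v"
    using l(1) assms(1,2) by (auto simp: normal_def)
  then obtain a b where ab: "l = a @ b" "suffix a u" "prefix b v"
    using l(2) unfolding sublist_append by blast
  have "a \<noteq> []" "b \<noteq> []"
    using ab \<open>\<not> sublist l u\<close> \<open>\<not> sublist l v\<close> by auto
  with ab have "a = [x]" "b = [y]"
    using xy by (auto simp: Cons_eq_append_conv)
  then have "last u = x" "hd v = y"
    using ab(2,3) by (auto simp: suffix_def prefix_def)
  then show ?thesis using l(1) xy by simp
qed

lemma normal_appendD: "normal (u @ v) \<Longrightarrow> normal u \<and> normal v"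
  unfolding normal_def by (meson sublist_appendI sublist_append_leftI sublist_append_rightI
      sublist_order.order_trans)

lemma normal_single: "normal [x]"
  unfolding normal_def using lhs_form by (force dest: sublist_length_le)

lemma letter_nmons: "x \<in> T \<Longrightarrow> Letter x \<in> nmons"
  by (simp add: nmons_def super_lyndon_shirshov_def lyndon_shirshov.letter normal_single)

lemma span_letters_nspan:
  assumes "p \<in> fa.span (fa_letter ` T \<union> I)" "\<And>x. x \<in> T \<Longrightarrow> Letter x \<in> F"
  shows "p \<in> nspan F"
proof -
  have "fa_letter ` T \<subseteq> ev ` F"
    using assms(2) by (metis evaluate.simps(1) image_eqI image_subsetI)
  then show ?thesis
    using assms(1) fa.span_mono[of "fa_letter ` T \<union> I" "ev ` F \<union> I"]
    unfolding nspan_def by blast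
qed

lemma nmons_ProdD:
  assumes "Prod f g \<in> nmons"
  shows "LS T f" "LS T g" "f \<in> nmons" "g \<in> nmons"
  using assms LS_ProdD(1,2)[of T f g] normal_appendD[of "assoc_word f" "assoc_word g"]
  by (auto simp: nmons_def super_lyndon_shirshov_def)

definition square :: "'g naword \<Rightarrow> nat"
  where "square f = (if \<exists>g. f = Prod g g then 1 else 0)"

text \<open>Termination measure for expanding brackets: total length; rank of the leading word among the
  words on the same letters; number of squares \<open>Prod g g\<close>; length of the larger factor.
  The last component decreases when \<open>[[f1, f2], g]\<close> is expanded to \<open>[f1, [f2, g]]\<close>
  without changing the leading word.\<close>

definition pair_rel :: "(('g naword \<times> 'g naword) \<times> 'g naword \<times> 'g naword) set"
  where "pair_rel = inv_image (measures [fst, fst \<circ> snd, fst \<circ> snd \<circ> snd, snd \<circ> snd \<circ> snd])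
    (\<lambda>(f, g). let u = assoc_word f; v = assoc_word g in
      (length u + length v,
       card {w. set w \<subseteq> set u \<union> set v \<and> length w = length u + length v \<and> w \<prec> lead u v},
       square f + square g,
       if u \<prec> v then length v else length u))"

lemma wf_pair_rel: "wf pair_rel"
  unfolding pair_rel_def by (intro wf_inv_image wf_measures)

lemma square_LS: "LS T f \<Longrightarrow> square f = 0"
  by (auto simp: square_def word_irrefl dest: LS_ProdD(3))

lemma square_lyndon: "f \<in> nmons \<Longrightarrow> lyndon (assoc_word f) \<Longrightarrow> square f = 0"
  using lyndon_not_square LS_lyndon
  by (auto simp: square_def nmons_def super_lyndon_shirshov_def square_LS dest: LS_ProdD(3))

lemma pair_rel_length:
  "length (assoc_word a) + length (assoc_word b) < length (assoc_word f) + length (assoc_word g) \<Longrightarrow>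
    ((a, b), (f, g)) \<in> pair_rel"
  by (simp add: pair_rel_def Let_def)

lemma pair_rel_intros:
  assumes len: "length (assoc_word a) + length (assoc_word b) = length (assoc_word f) + length
      (assoc_word g)"
    and set: "set (assoc_word a) \<union> set (assoc_word b) \<subseteq> set (assoc_word f) \<union> set (assoc_word g)"
  shows "lead (assoc_word a) (assoc_word b) \<prec> lead (assoc_word f) (assoc_word g) \<Longrightarrow> ((a, b), (f,
      g)) \<in> pair_rel"
    and "lead (assoc_word a) (assoc_word b) \<preceq> lead (assoc_word f) (assoc_word g) \<Longrightarrow>
      square a + square b < square f + square g \<or>
      square a + square b = square f + square g \<and>
      (if assoc_word a \<prec> assoc_word b then length (assoc_word b) else length (assoc_word a))
        < (if assoc_word f \<prec> assoc_word g then length (assoc_word g) else length (assoc_word f)) \<Longrightarrow>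
      ((a, b), (f, g)) \<in> pair_rel"
proof -
  let ?S = "\<lambda>f g. {w. set w \<subseteq> set (assoc_word f) \<union> set (assoc_word g) \<and>
    length w = length (assoc_word f) + length (assoc_word g) \<and> w \<prec> lead (assoc_word f) (assoc_word
        g)}"
  have fin: "finite (?S f g)"
    by (rule finite_subset[OF _ finite_lists_length_eq[of
        "set (assoc_word f) \<union> set (assoc_word g)"]]) auto
  have le: "card (?S a b) \<le> card (?S f g)"
    if "lead (assoc_word a) (assoc_word b) \<preceq> lead (assoc_word f) (assoc_word g)"
    using that len set by (intro card_mono fin) (auto intro: word.less_le_trans)
  have less: "card (?S a b) < card (?S f g)"
    if "lead (assoc_word a) (assoc_word b) \<prec> lead (assoc_word f) (assoc_word g)"
  proof (rule psubset_card_mono[OF fin])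
    have "lead (assoc_word a) (assoc_word b) \<in> ?S f g"
      using that len set by (auto simp: lead_def)
    moreover have "lead (assoc_word a) (assoc_word b) \<notin> ?S a b"
      by (simp add: word_irrefl)
    moreover have "?S a b \<subseteq> ?S f g"
      using that len set by (auto intro: word_trans)
    ultimately show "?S a b \<subset> ?S f g" by blast
  qed
  show "lead (assoc_word a) (assoc_word b) \<prec> lead (assoc_word f) (assoc_word g) \<Longrightarrow> ((a, b), (f, g))
      \<in> pair_rel"
    using less len by (simp add: pair_rel_def Let_def)
  show "lead (assoc_word a) (assoc_word b) \<preceq> lead (assoc_word f) (assoc_word g) \<Longrightarrow>
      square a + square b < square f + square g \<or>
      square a + square b = square f + square g \<and>
      (if assoc_word a \<prec> assoc_word b then length (assoc_word b) else length (assoc_word a))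
        < (if assoc_word f \<prec> assoc_word g then length (assoc_word g) else length (assoc_word f)) \<Longrightarrow>
      ((a, b), (f, g)) \<in> pair_rel"
    using le len by (auto simp: pair_rel_def Let_def)
qed

definition good :: "'g naword \<Rightarrow> 'g naword \<Rightarrow> bool"
  where "good f g \<longleftrightarrow> ev (Prod f g) \<in> nspan (bounded (assoc_word f) (assoc_word g))"

lemma bounded_mono:
  assumes "length u + length v < length u' + length v' \<or>
    length u + length v = length u' + length v' \<and> set u \<union> set v \<subseteq> set u' \<union> set v' \<and> lead u v \<preceq>
        lead u' v'"
  shows "bounded u v \<subseteq> bounded u' v'"
  using assms by (auto simp: bounded_def intro: word.order.trans)

lemma bounded_commute: "bounded u v = bounded v u"
  by (simp add: bounded_def lead_commute[of u v] add.commute Un_commute)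

lemma good_commute: "good f g \<Longrightarrow> good g f"
  unfolding good_def by (metis evaluate_skew_mem subspace_nspan bounded_commute)

end

text \<open>One step of the well-founded induction on pairs, kept as a locale so that it can be
  instantiated for both (f, g) and (g, f).\<close>

locale lie_reduction_step = lie_reduction +
  fixes f g
  assumes f: "f \<in> nmons" and g: "g \<in> nmons"
    and IH: "\<And>a b. a \<in> nmons \<Longrightarrow> b \<in> nmons \<Longrightarrow> ((a, b), (f, g)) \<in> pair_rel \<Longrightarrow> good a b"
begin

abbreviation "target \<equiv> nspan (bounded (assoc_word f) (assoc_word g))"

lemma shorter:
  assumes "a \<in> nmons" "b \<in> nmons"
    "length (assoc_word a) + length (assoc_word b) < length (assoc_word f) + length (assoc_word g)"
  shows "ev (Prod a b) \<in> target"
  using IH[OF assms(1,2) pair_rel_length[OF assms(3)]] nspan_mono[OF bounded_mono] assms(3)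
  unfolding good_def by blast

lemma smaller:
  assumes "a \<in> nmons" "b \<in> nmons" "((a, b), (f, g)) \<in> pair_rel"
    "length (assoc_word a) + length (assoc_word b) = length (assoc_word f) + length (assoc_word g)"
    "set (assoc_word a) \<union> set (assoc_word b) \<subseteq> set (assoc_word f) \<union> set (assoc_word g)"
    "lead (assoc_word a) (assoc_word b) \<preceq> lead (assoc_word f) (assoc_word g)"
  shows "ev (Prod a b) \<in> target"
  using IH[OF assms(1-3)] nspan_mono[OF bounded_mono] assms(4-6)
  unfolding good_def by blast

text \<open>The inner bracket has smaller total length, so induction expands it. Its shorter terms
  are covered by \<open>shorter\<close>; only the terms \<open>b\<close> of full length remain to be
  bracketed with \<open>a\<close>.\<close>

lemma outer:
  assumes a: "a \<in> nmons" and p: "p \<in> nmons" and q: "q \<in> nmons"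
    and len: "length (assoc_word a) + length (assoc_word p) + length (assoc_word q)
      = length (assoc_word f) + length (assoc_word g)"
    and b: "\<And>b. b \<in> nmons \<Longrightarrow> length (assoc_word b) = length (assoc_word p) + length (assoc_word q) \<Longrightarrow>
      set (assoc_word b) \<subseteq> set (assoc_word p) \<union> set (assoc_word q) \<Longrightarrow>
      assoc_word b \<preceq> lead (assoc_word p) (assoc_word q) \<Longrightarrow> ev (Prod a b) \<in> target"
  shows "ev (Prod a (Prod p q)) \<in> target"
proof -
  have "length (assoc_word a) > 0" by simp
  then have "((p, q), (f, g)) \<in> pair_rel"
    using len by (intro pair_rel_length) linarith
  then have "ev (Prod p q) \<in> nspan (bounded (assoc_word p) (assoc_word q))"
    using IH[OF p q] by (simp add: good_def)
  then show ?thesis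
    unfolding evaluate.simps(2)[of _ a "Prod p q"]
  proof (rule bracket_nspan[OF nmons_free_lie[OF a]])
    fix b assume "b \<in> bounded (assoc_word p) (assoc_word q)"
    then show "ev (Prod a b) \<in> target"
      using b shorter[OF a, of b] len unfolding bounded_def by auto
  qed
qed

lemma outer_less:
  assumes a: "a \<in> nmons" and p: "p \<in> nmons" and q: "q \<in> nmons"
    and len: "length (assoc_word a) + length (assoc_word p) + length (assoc_word q)
      = length (assoc_word f) + length (assoc_word g)"
    and set: "set (assoc_word a) \<union> set (assoc_word p) \<union> set (assoc_word q)
      \<subseteq> set (assoc_word f) \<union> set (assoc_word g)"
    and less: "assoc_word a @ assoc_word p @ assoc_word q \<prec> lead (assoc_word f) (assoc_word g)"
      "assoc_word a @ assoc_word q @ assoc_word p \<prec> lead (assoc_word f) (assoc_word g)"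
      "assoc_word p @ assoc_word q @ assoc_word a \<prec> lead (assoc_word f) (assoc_word g)"
      "assoc_word q @ assoc_word p @ assoc_word a \<prec> lead (assoc_word f) (assoc_word g)"
  shows "ev (Prod a (Prod p q)) \<in> target"
proof (rule outer[OF a p q len])
  fix b assume b: "b \<in> nmons"
      "length (assoc_word b) = length (assoc_word p) + length (assoc_word q)"
      "set (assoc_word b) \<subseteq> set (assoc_word p) \<union> set (assoc_word q)"
      "assoc_word b \<preceq> lead (assoc_word p) (assoc_word q)"
  have "lead (assoc_word a) (assoc_word b) \<prec> lead (assoc_word f) (assoc_word g)"
    using lead_outer_less[OF b(4,2) less] .
  then show "ev (Prod a b) \<in> target"
    using b len set by (intro smaller pair_rel_intros(1) a) (auto simp: word_le_def)
qed

text \<open>Modulo the ideal the pair of letters is replaced by single letters, so the length drops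
  and induction applies.\<close>

lemma letters_target:
  assumes "x \<in> T" "y \<in> T" "[x, y] \<in> lhs" "c \<in> nmons"
    "length (assoc_word c) + 1 < length (assoc_word f) + length (assoc_word g)"
  shows "ev (Prod c (Prod (Letter x) (Letter y))) \<in> target"
proof -
  have "ev (Prod (Letter x) (Letter y)) \<in> nspan (Letter ` T)"
    using span_letters_nspan[OF bracket_letters[OF assms(3)]] by simp
  then show ?thesis
    unfolding evaluate.simps(2)[of _ c "Prod (Letter x) (Letter y)"]
    by (rule bracket_nspan[OF nmons_free_lie[OF assms(4)]])
      (use assms(4,5) in \<open>auto intro!: shorter letter_nmons simp del: evaluate.simps\<close>)
qed

end

context lie_reduction
begin

lemma nmons_square:
  assumes "LS T f" "normal (assoc_word f)" "word_parity par (assoc_word f) = 1"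
    "normal (assoc_word f @ assoc_word f)"
  shows "Prod f f \<in> nmons"
  using assms by (auto simp: nmons_def super_lyndon_shirshov_def)

lemma good_self:
  assumes f: "f \<in> nmons"
  shows "good f f"
proof -
  have even: "good f f" if "word_parity par (assoc_word f) = 0"
    unfolding good_def evaluate_self_even[OF that] by (rule fa.subspace_0[OF subspace_nspan])
  have odd: "good f f" if LS: "LS T f" and par: "word_parity par (assoc_word f) = 1"
  proof (cases "normal (assoc_word f @ assoc_word f)")
    case True
    then have "Prod f f \<in> nmons"
      using f LS par by (intro nmons_square) (simp_all add: nmons_def)
    then have "Prod f f \<in> bounded (assoc_word f) (assoc_word f)"
      by (simp add: bounded_def lead_ge)
    then show ?thesis unfolding good_def by (rule nspan_base)
  next
    case False
    then have l: "[last (assoc_word f), hd (assoc_word f)] \<in> lhs"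
      using f normal_append by (simp add: nmons_def)
    \<comment> \<open>In a forbidden pair the first letter is at least the second, whereas a Lyndon
      word of length above 1 has its last letter below its first. So only a single letter can clash
      with itself.\<close>
    then have "\<not> lt (last (assoc_word f)) (hd (assoc_word f))"
      using lhs_form trans irrefl by fastforce
    then obtain x where x: "assoc_word f = [x]"
      using lyndon_hd_last[OF LS_lyndon[OF LS]] by metis
    then have "f = Letter x" using LS LS_single by blast
    moreover have "ev (Prod (Letter x) (Letter x)) \<in> nspan (bounded [x] [x])"
      unfolding evaluate.simps
    proof (rule span_letters_nspan)
      show "superbracket par (fa_letter x) (fa_letter x) \<in> fa.span (fa_letter ` T \<union> I)"
        using bracket_letters l x by simp
    qed (simp add: bounded_def letter_nmons)
    ultimately show ?thesis unfolding good_def by simp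
  qed
  \<comment> \<open>A square has an even word and falls under the even case.\<close>
  show ?thesis
    using f even odd bit_cases[of "word_parity par (assoc_word f)"]
    by (auto simp: nmons_def super_lyndon_shirshov_def)
qed

end

context lie_reduction_step
begin

text \<open>[[y,y],g] is twice [y,[y,g]]. Expanding the latter from inside does not raise the
  leading bound, and when the bound stays the same, the square \<open>f\<close> has disappeared,
  which lowers the measure.\<close>

lemma good_square:
  assumes sq: "f = Prod y y" and ne: "assoc_word g \<noteq> assoc_word f"
  shows "good f g"
proof -
  have y: "LS T y" "word_parity par (assoc_word y) = 1" and yn: "y \<in> nmons"
    using f sq nmons_ProdD[of y y]
      by (auto simp: nmons_def super_lyndon_shirshov_def word_irrefl dest: LS_ProdD(3))
  let ?y = "assoc_word y" and ?z = "assoc_word g"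
  let ?m = "lead (?y @ ?y) ?z"
  have ly: "lyndon ?y" using y(1) by (rule LS_lyndon)
  have "ev (Prod y (Prod y g)) \<in> target"
  proof (cases "?z = ?y")
    case True
    then have "g = y"
      using super_inject[of par T g y] g yn by (simp add: nmons_def)
    then show ?thesis
      by (simp only: evaluate_cube_zero[OF y(2)] fa.subspace_0[OF subspace_nspan])
  next
    case False
    show ?thesis
    proof (rule outer[OF yn yn g])
      show "length ?y + length ?y + length ?z = length (assoc_word f) + length ?z"
        by (simp add: sq)
    next
      fix b assume b: "b \<in> nmons" "length (assoc_word b) = length ?y + length ?z"
        "set (assoc_word b) \<subseteq> set ?y \<union> set ?z" "assoc_word b \<preceq> lead ?y ?z"
      let ?b = "assoc_word b"
      have le: "lead ?y ?b \<preceq> ?m"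
        using lead_self_append(1)[OF b(2,4)] .
      have squares: "square b + square y < square f + square g" if "lead ?y ?b = ?m"
      proof -
        have "square y = 0" using y(1) by (rule square_LS)
        moreover have "square f = 1" by (simp add: sq square_def)
        moreover have "square b \<le> 1" by (simp add: square_def)
        \<comment> \<open>The expansion must not create a new square in exchange: if the bound is
          attained, the word of \<open>b\<close> is the larger product of the words of
          \<open>y\<close> and \<open>g\<close>, which is Lyndon.\<close>
        moreover have "square b = 0" if "square g = 0"
        proof -
          have "LS T g"
            using g that by (auto simp: nmons_def super_lyndon_shirshov_def square_def split:
                if_splits)
          then have lz: "lyndon ?z" by (rule LS_lyndon)
          have "?b = lead ?y ?z"
            using lead_self_append(2)[OF b(2)] \<open>lead ?y ?b = ?m\<close> b(4) word_irrefl
            by (auto simp: word_le_def)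
          moreover have "lyndon (lead ?y ?z)"
          proof (cases "?z \<prec> ?y")
            case True
            then show ?thesis using lead_lyndon[OF ly lz] lyndon_append[OF ly lz] by simp
          next
            case False': False
            then have "?y \<prec> ?z" using word_total False by blast
            then show ?thesis
              using lead_lyndon[OF lz ly] lyndon_append[OF lz ly] by (simp add: lead_commute[of ?y])
          qed
          ultimately show ?thesis using square_lyndon b(1) by simp
        qed
        ultimately show ?thesis by (cases "square g = 0") auto
      qed
      have m: "lead (assoc_word f) ?z = ?m" by (simp add: sq)
      show "ev (Prod y b) \<in> target"
      proof (rule smaller[OF yn b(1)])
        show "((y, b), f, g) \<in> pair_rel"
        proof (cases "lead ?y ?b = ?m")
          case True
          then show ?thesis
            using squares[OF True] b le by (intro pair_rel_intros(2)) (auto simp: sq)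
        next
          case False
          then have "lead ?y ?b \<prec> ?m" using le by (simp add: word_le_def)
          then show ?thesis
            using b by (intro pair_rel_intros(1)) (auto simp: sq)
        qed
      qed (use b le in \<open>auto simp: sq\<close>)
    qed
  qed
  then show ?thesis
    unfolding good_def sq by (rule evaluate_square_mem'[OF subspace_nspan y(2)])
qed

text \<open>If \<open>Prod f g\<close> is a Lyndon-Shirshov monomial whose word is not normal, then the forbidden
  subword sits at the junction of the two factors. This leaves two shapes: \<open>f\<close> is a letter, or
  the second factor of \<open>f\<close> and \<open>g\<close> are the same odd letter \<open>x\<close>, where
  \<open>[[f1, x], x]\<close> is half of \<open>[f1, [x, x]]\<close>.\<close>

lemma good_lyndon:
  assumes LS: "LS T f" "LS T g" and less: "assoc_word g \<prec> assoc_word f"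
  shows "good f g"
proof -
  let ?f = "assoc_word f" and ?g = "assoc_word g"
  have lf: "lyndon ?f" and lg: "lyndon ?g" using LS by (auto intro: LS_lyndon)
  have lead: "lead ?f ?g = ?f @ ?g" using lead_lyndon[OF lf lg less] .
  have lfg: "lyndon (?f @ ?g)" using lyndon_append[OF lf lg less] .
  have nf: "normal ?f" and ng: "normal ?g" using f g by (auto simp: nmons_def)
  have "ev (Prod f g) \<in> target"
  proof (cases "\<exists>f1 f2. f = Prod f1 f2 \<and> ?g \<prec> assoc_word f2")
    \<comment> \<open>Here the last condition on Lyndon-Shirshov monomials fails. Jacobi expands
      [[f1,f2],g] into [f1,[f2,g]] and [f2,[f1,g]].\<close>
    case True
    then obtain f1 f2 where f12: "f = Prod f1 f2" and g2: "?g \<prec> assoc_word f2" by blast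
    let ?u = "assoc_word f1" and ?v = "assoc_word f2"
    have n1: "f1 \<in> nmons" and n2: "f2 \<in> nmons" using nmons_ProdD(3,4)[OF f[unfolded f12]] .
    note L = LS_ProdD[OF LS(1)[unfolded f12]]
    have lu: "lyndon ?u" and lv: "lyndon ?v" using L by (auto intro: LS_lyndon)
    have lvg: "lyndon (?v @ ?g)" and leadvg: "lead ?v ?g = ?v @ ?g"
      using lyndon_append[OF lv lg g2] lead_lyndon[OF lv lg g2] by auto
    have vgv: "?g @ ?v \<prec> ?v @ ?g"
      using lyndon_swap[OF lvg] by simp
    have vu: "?v @ ?u \<prec> ?u @ ?v"
      using lyndon_swap[OF lf[unfolded f12 assoc_word.simps]] by simp
    have rot: "?v @ ?g @ ?u \<prec> ?u @ ?v @ ?g" "?g @ ?u @ ?v \<prec> ?u @ ?v @ ?g"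
      using lyndon_swap[of ?u "?v @ ?g"] lyndon_swap[of "?u @ ?v" ?g] lfg
      by (simp_all add: f12)
    have 1: "ev (Prod f1 (Prod f2 g)) \<in> target"
    proof (rule outer[OF n1 n2 g])
      fix b assume b: "b \<in> nmons" "length (assoc_word b) = length ?v + length ?g"
        "set (assoc_word b) \<subseteq> set ?v \<union> set ?g" "assoc_word b \<preceq> lead ?v ?g"
      let ?b = "assoc_word b"
      have ub: "?u @ ?b \<preceq> ?u @ ?v @ ?g" "?b @ ?u \<prec> ?u @ ?v @ ?g"
        using b(4) word_le_append_mono[of ?b "?v @ ?g" ?u ?u] b(2) word.le_less_trans[OF _ rot(1)]
        by (auto simp: leadvg)
      then have le: "lead ?u ?b \<preceq> lead ?f ?g"
        by (auto simp: f12 lead[unfolded f12, simplified] intro: lead_le)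
      show "ev (Prod f1 b) \<in> target"
      proof (rule smaller[OF n1 b(1)])
        show "((f1, b), f, g) \<in> pair_rel"
        proof (cases "?b = ?v @ ?g")
          case False
          then have "?u @ ?b \<prec> ?u @ ?v @ ?g" using b(4) leadvg by (simp add: word_le_def)
          then have "lead ?u ?b \<prec> lead ?f ?g"
            using ub(2) lead by (auto simp: f12 intro: lead_less)
          then show ?thesis using b by (intro pair_rel_intros(1)) (auto simp: f12)
        next
          \<comment> \<open>The leading bound is unchanged. Since \<open>?v @ ?g\<close> lies below
            \<open>?u\<close>, the larger factor is now \<open>f1\<close>, which is shorter than
            \<open>f\<close>, so the last component of the measure drops.\<close>
          case True
          have "square f1 = 0" "square f = 0" "square b = 0"
            using L LS square_LS square_lyndon[OF b(1)] lvg True by auto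
          moreover have "?v @ ?g \<prec> ?u"
          proof -
            have "?v @ ?g \<prec> ?v" using append_less_self lyndon_nonempty[OF lg] by blast
            then show ?thesis using L(3) word_trans by blast
          qed
          moreover have "\<not> ?f \<prec> ?g" "\<not> ?u \<prec> ?b"
            using less True \<open>?v @ ?g \<prec> ?u\<close> word.order.asym by auto
          ultimately show ?thesis
            using b le True by (intro pair_rel_intros(2)) (auto simp: f12 square_LS[OF LS(2)])
        qed
      qed (use b le in \<open>auto simp: f12\<close>)
    qed (simp add: f12)
    \<comment> \<open>Every arrangement arising here is a proper rotation of
      \<open>?u @ ?v @ ?g\<close> or exchanges two neighbouring factors downwards, so the bound
      drops strictly.\<close>
    have 2: "ev (Prod f2 (Prod f1 g)) \<in> target"
    proof (rule outer_less[OF n2 n1 g])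
      show "?v @ ?u @ ?g \<prec> lead ?f ?g"
        using word_less_append_same_length[OF vu, of ?g ?g] lead by (simp add: f12)
      show "?v @ ?g @ ?u \<prec> lead ?f ?g" "?g @ ?u @ ?v \<prec> lead ?f ?g"
        using rot lead by (simp_all add: f12)
      show "?u @ ?g @ ?v \<prec> lead ?f ?g"
        using vgv lead by (simp add: f12)
    qed (auto simp: f12)
    have "ev (Prod g (Prod f1 f2)) \<in> target"
    proof (rule evaluate_jacobi_mem[OF subspace_nspan])
      show "ev (Prod f1 (Prod g f2)) \<in> target"
        using 1 by (rule evaluate_skew_mem_inner[OF subspace_nspan])
      show "ev (Prod f2 (Prod g f1)) \<in> target"
        using 2 by (rule evaluate_skew_mem_inner[OF subspace_nspan])
    qed
    then show ?thesis
      unfolding f12 by (rule evaluate_skew_mem[OF subspace_nspan])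
  next
    case False
    then have std: "LS T (Prod f g)"
      using LS less by (intro lyndon_shirshov.product) (use word_total in auto)
    show ?thesis
    proof (cases "normal (?f @ ?g)")
      case True
      then have "Prod f g \<in> bounded ?f ?g"
        using std by (simp add: bounded_def nmons_def super_lyndon_shirshov_def lead_ge)
      then show ?thesis by (rule nspan_base)
    next
      case nn: False
      define x y where "x = last ?f" and "y = hd ?g"
      have l: "[x, y] \<in> lhs" using normal_append[OF nf ng nn] by (simp add: x_def y_def)
      have xT: "x \<in> T" and xy: "lt y x \<or> x = y \<and> par x = 1"
        using lhs_form[OF l] by auto
      show ?thesis
      proof (cases f)
        case fx: (Letter x')
        then have f_eq: "f = Letter x" by (simp add: x_def)
        show ?thesis
        proof (cases g)
          case (Letter y')
          then have g_eq: "g = Letter y" by (simp add: y_def)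
          show ?thesis
            unfolding f_eq g_eq evaluate.simps
            by (rule span_letters_nspan[OF bracket_letters[OF l]]) (simp add: bounded_def
                letter_nmons)
        next
          case g12: (Prod g1 g2)
          let ?u = "assoc_word g1" and ?v = "assoc_word g2"
          have n1: "g1 \<in> nmons" and n2: "g2 \<in> nmons" using nmons_ProdD(3,4)[OF g[unfolded g12]] .
          note L = LS_ProdD[OF LS(2)[unfolded g12]]
          have lu: "lyndon ?u" and lv: "lyndon ?v" using L by (auto intro: LS_lyndon)
          have y: "y = hd ?u" by (simp add: y_def g12)
          show ?thesis
          proof (cases "?u = [x]")
            case True
            then have "x = y" using y by simp
            with xy irrefl have odd: "par x = 1" by auto
            have gx: "g1 = Letter x" using L(1) True by (rule LS_single)
            \<comment> \<open>The relation for [x,x] becomes applicable by passing to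
              [[x,x],g2].\<close>
            have "ev (Prod (Letter x) (Prod (Letter x) g2)) \<in> target"
            proof (rule evaluate_square_mem[OF subspace_nspan two])
              show "ev (Prod (Prod (Letter x) (Letter x)) g2) \<in> target"
                using letters_target[OF xT xT _ n2] l
                by (intro evaluate_skew_mem[OF subspace_nspan, of _ g2])
                  (simp add: \<open>x = y\<close> f_eq g12 gx)
            qed (simp add: odd)
            then show ?thesis by (simp only: f_eq g12 gx)
          next
            case False
            have ux: "?u \<prec> [x]"
            proof (cases "lt y x")
              case True
              then show ?thesis using y by (cases ?u) auto
            next
              case False
              then have "?u = x # tl ?u" using xy y by (cases ?u) auto
              moreover have "tl ?u \<noteq> []" using calculation \<open>?u \<noteq> [x]\<close> by auto
              ultimately show ?thesis using append_less_self[of "tl ?u" "[x]"] by simp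
            qed
            have lead_xu: "lead [x] ?u = x # ?u"
              using lead_lyndon[OF _ lu ux] by simp
            have uxu: "?u @ [x] \<prec> x # ?u"
              using lyndon_swap[of "[x]" ?u] lyndon_append[OF _ lu ux] by simp
            have lxuv: "lyndon (x # ?u @ ?v)" using lfg by (simp add: f_eq g12)
            have rot: "?v @ x # ?u \<prec> x # ?u @ ?v" "?u @ ?v @ [x] \<prec> x # ?u @ ?v"
              using lyndon_swap[of "x # ?u" ?v] lyndon_swap[of "[x]" "?u @ ?v"] lxuv
              by simp_all
            have vu: "?v @ ?u \<prec> ?u @ ?v"
              using lyndon_swap[OF lg[unfolded g12 assoc_word.simps]] by simp
            have lead': "lead ?f ?g = x # ?u @ ?v"
              using lead by (simp add: f_eq g12)
            have nx: "Letter x \<in> nmons" using xT by (rule letter_nmons)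
            have 1: "ev (Prod g2 (Prod (Letter x) g1)) \<in> target"
            proof (rule outer[OF n2 nx n1])
              fix b assume b: "b \<in> nmons"
                "length (assoc_word b) = length (assoc_word (Letter x)) + length ?u"
                "set (assoc_word b) \<subseteq> set (assoc_word (Letter x)) \<union> set ?u"
                "assoc_word b \<preceq> lead (assoc_word (Letter x)) ?u"
              let ?b = "assoc_word b"
              \<comment> \<open>The forbidden pair opens \<open>x # ?u\<close>, so no normal
                monomial has this word. All terms of [x,g1] are therefore strictly below it, and the
                outer bracket is smaller than the original one.\<close>
              have "sublist [x, y] (x # ?u)"
                using y by (cases ?u) (auto simp: sublist_Cons_right)
              then have "?b \<noteq> x # ?u"
                using b(1) l by (auto simp: nmons_def normal_def)
              then have bxu: "?b \<prec> x # ?u"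
                using b(4) lead_xu by (simp add: word_le_def)
              have "?b @ ?v \<prec> x # ?u @ ?v" "?v @ ?b \<prec> x # ?u @ ?v"
                using word_less_append_same_length[OF bxu, of ?v ?v] b(2) bxu word_trans[OF _
                    rot(1)] by auto
              then have "lead ?v ?b \<prec> lead ?f ?g"
                unfolding lead' by (intro lead_less)
              then show "ev (Prod g2 b) \<in> target"
                using b by (intro smaller pair_rel_intros(1) n2)
                  (auto simp: f_eq g12 word_le_def)
            qed (simp add: f_eq g12)
            have 2: "ev (Prod g1 (Prod (Letter x) g2)) \<in> target"
            proof (rule outer_less[OF n1 nx n2])
              show "?u @ assoc_word (Letter x) @ ?v \<prec> lead ?f ?g"
                using word_less_append_same_length[OF uxu, of ?v ?v] by (simp add: lead')
              show "?u @ ?v @ assoc_word (Letter x) \<prec> lead ?f ?g"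
                "?v @ assoc_word (Letter x) @ ?u \<prec> lead ?f ?g"
                using rot by (simp_all add: lead')
              show "assoc_word (Letter x) @ ?v @ ?u \<prec> lead ?f ?g"
                using vu by (simp add: lead' irrefl)
            qed (auto simp: f_eq g12)
            have "ev (Prod (Letter x) (Prod g1 g2)) \<in> target"
              using 2 1 by (rule evaluate_jacobi_mem[OF subspace_nspan])
            then show ?thesis by (simp only: f_eq g12)
          qed
        qed
      next
        case f12: (Prod f1 f2)
        let ?v = "assoc_word f2"
        have n1: "f1 \<in> nmons" using nmons_ProdD(3)[OF f[unfolded f12]] .
        note L = LS_ProdD[OF LS(1)[unfolded f12]]
        have lv: "lyndon ?v" using L by (auto intro: LS_lyndon)
        have vg: "?v \<preceq> ?g" using False f12 word_total[of ?v ?g] by (auto simp: word_le_def)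
        have x: "x = last ?v" by (simp add: x_def f12)
        have hd: "lt (hd ?v) y \<or> hd ?v = y" using word_less_hd[OF vg] by (simp add: y_def)
        \<comment> \<open>The chain hd f2 <= y <= x = last f2 contradicts the Lyndon property unless
          \<open>f2\<close> is the single letter \<open>x\<close>, and then
          \<open>x = y\<close>.\<close>
        have "\<not> lt x (hd ?v)" using hd xy by (metis irrefl trans)
        then have v: "?v = [x]" using lyndon_hd_last[OF lv] x by simp
        then have "x = y" using hd xy by (metis irrefl trans list.sel(1))
        with xy irrefl have odd: "par x = 1" by auto
        \<comment> \<open>A longer \<open>g\<close> would properly extend the one-letter word of
          \<open>f2\<close> and so be smaller than it, against the case assumption.\<close>
        have gx: "?g = [x]"
        proof (rule ccontr)
          assume "?g \<noteq> [x]"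
          moreover have g_eq: "?g = x # tl ?g" using \<open>x = y\<close> y_def by (cases ?g) auto
          ultimately have "tl ?g \<noteq> []" by auto
          then have "?g \<prec> [x]" using append_less_self[of "tl ?g" "[x]"] g_eq by simp
          then show False using vg v by (auto simp: word_le_def word_irrefl dest: word_trans)
        qed
        have eqs: "f2 = Letter x" "g = Letter x"
          using LS_single L(2) v LS(2) gx by blast+
        have "ev (Prod (Letter x) (Prod (Letter x) f1)) \<in> target"
        proof (rule evaluate_square_mem[OF subspace_nspan two])
          show "ev (Prod (Prod (Letter x) (Letter x)) f1) \<in> target"
            using letters_target[OF xT xT _ n1] l
            by (intro evaluate_skew_mem[OF subspace_nspan, of _ f1])
              (simp add: \<open>x = y\<close> eqs f12)
        qed (simp add: odd)
        then have "ev (Prod (Letter x) (Prod f1 (Letter x))) \<in> target"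
          by (rule evaluate_skew_mem_inner[OF subspace_nspan])
        then have "ev (Prod (Prod f1 (Letter x)) (Letter x)) \<in> target"
          by (rule evaluate_skew_mem[OF subspace_nspan])
        then show ?thesis by (simp only: f12 eqs)
      qed
    qed
  qed
  then show ?thesis by (simp only: good_def)
qed

end

context lie_reduction
begin

text \<open>All four components of the measure are symmetric in the two factors.\<close>

lemma pair_rel_swap: "(z, (g, f)) \<in> pair_rel \<Longrightarrow> (z, (f, g)) \<in> pair_rel"
proof -
  let ?u = "assoc_word f" and ?v = "assoc_word g"
  have larger: "(if ?v \<prec> ?u then length ?u else length ?v) = (if ?u \<prec> ?v then length ?v else
      length ?u)"
    using word_total[of ?u ?v] word_trans[of ?u ?v ?u] word_irrefl by (cases "?u = ?v") auto
  show "(z, (g, f)) \<in> pair_rel \<Longrightarrow> (z, (f, g)) \<in> pair_rel"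
    unfolding pair_rel_def in_inv_image case_prod_conv Let_def larger
    by (simp only: lead_commute[of ?v ?u] Un_commute[of "set ?v" "set ?u"]
        add.commute[of "length ?v" "length ?u"] add.commute[of "square g" "square f"])
qed

lemma good_all:
  assumes "f \<in> nmons" "g \<in> nmons"
  shows "good f g"
proof -
  have "fst z \<in> nmons \<longrightarrow> snd z \<in> nmons \<longrightarrow> good (fst z) (snd z)" for z
  proof (induction z rule: wf_induct_rule[OF wf_pair_rel])
    case (1 z)
    obtain f g where z: "z = (f, g)" by (cases z)
    show ?case
    proof (intro impI)
      assume "fst z \<in> nmons" "snd z \<in> nmons"
      then have f: "f \<in> nmons" and g: "g \<in> nmons" using z by auto
      have IH: "good a b" if "a \<in> nmons" "b \<in> nmons" "((a, b), (f, g)) \<in> pair_rel" for a b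
        using 1[of "(a, b)"] that z by simp
      interpret fg: lie_reduction_step lt par T lhs I f g
        by unfold_locales (use f g IH in auto)
      interpret gf: lie_reduction_step lt par T lhs I g f
        by unfold_locales (use f g IH pair_rel_swap in \<open>blast+\<close>)
      have super: "LS T h \<or> (\<exists>u. h = Prod u u)" if "h \<in> nmons" for h
        using that by (auto simp: nmons_def super_lyndon_shirshov_def)
      consider "assoc_word f = assoc_word g" | "assoc_word f \<noteq> assoc_word g" "\<exists>u. f = Prod u u"
        | "assoc_word f \<noteq> assoc_word g" "\<exists>u. g = Prod u u"
        | "LS T f" "LS T g" "assoc_word g \<prec> assoc_word f"
        | "LS T f" "LS T g" "assoc_word f \<prec> assoc_word g"
        using super[OF f] super[OF g] word_total by blast
      then have "good f g"
      proof cases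
        case 1
        then have "f = g" using super_inject f g by (simp add: nmons_def) blast
        then show ?thesis using good_self[OF g] by simp
      next
        case 2
        then show ?thesis using fg.good_square by metis
      next
        case 3
        then show ?thesis using gf.good_square good_commute by metis
      next
        case 4
        then show ?thesis by (rule fg.good_lyndon)
      next
        case 5
        then show ?thesis using gf.good_lyndon good_commute by blast
      qed
      then show "good (fst z) (snd z)" using z by simp
    qed
  qed
  from this[of "(f, g)"] show ?thesis using assms by simp
qed

theorem free_lie_nspan:
  assumes "p \<in> free_lie par T"
  shows "p \<in> nspan nmons"
  using assms
proof (induction rule: free_lie.induct)
  case (letter x)
  then show ?case using nspan_base[OF letter_nmons] by simp
next
  case zero
  then show ?case by (rule fa.subspace_0[OF subspace_nspan])
next
  case (add p q)
  then show ?case by (intro fa.subspace_add[OF subspace_nspan])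
next
  case (scale p c)
  then show ?case by (intro fa.subspace_scale[OF subspace_nspan])
next
  case (bracket p q)
  have "ev (Prod f g) \<in> nspan nmons" if "f \<in> nmons" "g \<in> nmons" for f g
    using good_all[OF that] nspan_mono[of "bounded (assoc_word f) (assoc_word g)" nmons]
    by (auto simp: good_def bounded_def)
  then have "superbracket par (ev f) q \<in> nspan nmons" if "f \<in> nmons" for f
    using bracket_nspan[OF nmons_free_lie[OF that] bracket.IH(2)] that by blast
  then show ?case
    using linear_span_mem[OF linear_superbracket_left subspace_nspan _ bracket.IH(1)[unfolded
        nspan_def]]
      I_right[OF _ bracket.hyps(2)] nspan_I by blast
qed

end

section \<open>Bases of quotients\<close>

lemma fa_coset_add:
  fixes I :: "('g, 'k::field) free_assoc set"
  assumes "fa.subspace I"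
  shows "{p' + q' | p' q'. p' \<in> fa_coset I p \<and> q' \<in> fa_coset I q} = fa_coset I (p + q)"
proof (intro equalityI subsetI)
  fix r assume "r \<in> {p' + q' | p' q'. p' \<in> fa_coset I p \<and> q' \<in> fa_coset I q}"
  then obtain a b where "r = (p + a) + (q + b)" "a \<in> I" "b \<in> I" by (auto simp: fa_coset_def)
  then have "r = (p + q) + (a + b)" "a + b \<in> I" using fa.subspace_add[OF assms] by auto
  then show "r \<in> fa_coset I (p + q)" unfolding fa_coset_def by blast
next
  fix r assume "r \<in> fa_coset I (p + q)"
  then obtain a where "r = (p + 0) + (q + a)" "a \<in> I" by (auto simp: fa_coset_def add.assoc)
  then show "r \<in> {p' + q' | p' q'. p' \<in> fa_coset I p \<and> q' \<in> fa_coset I q}"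
    using fa.subspace_0[OF assms] unfolding fa_coset_def by blast
qed

lemma fa_coset_scale:
  fixes I :: "('g, 'k::field) free_assoc set"
  assumes "fa.subspace I"
  shows "{fa_scale c p' + r | p' r. p' \<in> fa_coset I p \<and> r \<in> I} = fa_coset I (fa_scale c p)"
proof (intro equalityI subsetI)
  fix r assume "r \<in> {fa_scale c p' + r | p' r. p' \<in> fa_coset I p \<and> r \<in> I}"
  then obtain a b where "r = fa_scale c (p + a) + b" "a \<in> I" "b \<in> I" by (auto simp: fa_coset_def)
  then have "r = fa_scale c p + (fa_scale c a + b)" "fa_scale c a + b \<in> I"
    using fa.subspace_add[OF assms] fa.subspace_scale[OF assms]
    by (auto simp: fa.scale_right_distrib)
  then show "r \<in> fa_coset I (fa_scale c p)" unfolding fa_coset_def by blast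
next
  fix r assume "r \<in> fa_coset I (fa_scale c p)"
  then obtain a where "r = fa_scale c (p + 0) + a" "a \<in> I" by (auto simp: fa_coset_def)
  then show "r \<in> {fa_scale c p' + r | p' r. p' \<in> fa_coset I p \<and> r \<in> I}"
    using fa.subspace_0[OF assms] unfolding fa_coset_def by blast
qed

lemma fa_coset_zero: "fa.subspace I \<Longrightarrow> fa_coset I 0 = I"
  by (auto simp: fa_coset_def)

lemma fa_coset_eq: "fa.subspace I \<Longrightarrow> q \<in> I \<Longrightarrow> fa_coset I (p + q) = fa_coset I p"
  unfolding fa_coset_def
  by (auto simp: add.assoc fa.subspace_add) (metis add.left_commute add_diff_cancel_left'
      diff_add_cancel fa.subspace_diff)

lemma lie_quotient_basis:
  fixes e :: "'i \<Rightarrow> ('g, 'k::field) free_assoc"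
  assumes I: "fa.subspace I" and F: "fa.subspace F" and e: "e ` N \<subseteq> F"
    and span: "F \<subseteq> fa.span (e ` N \<union> I)"
    and indep: "\<And>S c. finite S \<Longrightarrow> S \<subseteq> N \<Longrightarrow> (\<Sum>i\<in>S. fa_scale (c i) (e i)) \<in> I \<Longrightarrow> \<forall>i\<in>S. c i = 0"
  shows "basis_family (lie_quotient par F I) (\<lambda>i. fa_coset I (e i)) N"
proof -
  let ?M = "lie_quotient par F I"
  have M: "carrier ?M = fa_coset I ` F" "\<zero>\<^bsub>?M\<^esub> = fa_coset I 0"
    by (simp_all add: lie_quotient_def fa_coset_zero[OF I])
  have add: "fa_coset I p \<oplus>\<^bsub>?M\<^esub> fa_coset I q = fa_coset I (p + q)" for p q
    by (simp add: lie_quotient_def fa_coset_add[OF I])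
  have smult: "c \<odot>\<^bsub>?M\<^esub> fa_coset I p = fa_coset I (fa_scale c p)" for c p
    by (simp add: lie_quotient_def fa_coset_scale[OF I])
  \<comment> \<open>Finite sums live in an additive commutative monoid, so the laws of coset
    addition are enough to evaluate them.\<close>
  interpret M: abelian_monoid ?M
    by (rule abelian_monoidI)
      (auto simp: M add fa.subspace_add[OF F] fa.subspace_0[OF F] ac_simps)
  have finsum: "(\<Oplus>\<^bsub>?M\<^esub>i\<in>S. c i \<odot>\<^bsub>?M\<^esub> fa_coset I (e i)) = fa_coset I (\<Sum>i\<in>S. fa_scale (c i) (e i))"
    if "finite S" "S \<subseteq> N" for S c
    using that
  proof (induction S)
    case empty
    then show ?case by (simp add: M)
  next
    case (insert i S)
    have "c j \<odot>\<^bsub>?M\<^esub> fa_coset I (e j) \<in> carrier ?M" if "j \<in> insert i S" for j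
      using that insert.prems e fa.subspace_scale[OF F] unfolding smult M by blast
    then show ?case
      using insert by (subst M.finsum_insert) (auto simp: smult add)
  qed
  have "\<exists>S c. finite S \<and> S \<subseteq> N \<and> P = (\<Oplus>\<^bsub>?M\<^esub>i\<in>S. c i \<odot>\<^bsub>?M\<^esub> fa_coset I (e i))"
    if P: "P \<in> carrier ?M" for P
  proof -
    obtain p where p: "P = fa_coset I p" "p \<in> F" using P unfolding M(1) by blast
    have "fa.span I = I"
      using I by (simp only: fa.span_eq_iff)
    obtain a b where ab: "p = a + b" "a \<in> fa.span (e ` N)" "b \<in> I"
      using subsetD[OF span p(2), unfolded fa.span_Un \<open>fa.span I = I\<close>] by blast
    then obtain t r where t: "finite t" "t \<subseteq> e ` N" "a = (\<Sum>v\<in>t. fa_scale (r v) v)"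
      by (auto simp: fa.span_explicit)
    \<comment> \<open>The span yields a finite set of values; choosing one index per value makes
      \<open>e\<close> injective on \<open>S\<close>, so the sum can be reindexed.\<close>
    from t(2) obtain S where S: "S \<subseteq> N" "inj_on e S" "t = e ` S"
      unfolding subset_image_inj by blast
    then have fin: "finite S" using t(1) by (simp add: finite_image_iff)
    have "a = (\<Sum>i\<in>S. fa_scale (r (e i)) (e i))"
      using t(3) S by (simp add: sum.reindex)
    then have "P = (\<Oplus>\<^bsub>?M\<^esub>i\<in>S. r (e i) \<odot>\<^bsub>?M\<^esub> fa_coset I (e i))"
      using finsum[OF fin S(1), of "\<lambda>i. r (e i)"] fa_coset_eq[OF I ab(3), of a] p(1) ab(1) by simp
    with fin S(1) show ?thesis
      by (intro exI[of _ S] exI[of _ "\<lambda>i. r (e i)"] conjI)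
  qed
  moreover have "\<forall>i\<in>S. c i = 0"
    if "finite S" "S \<subseteq> N" "(\<Oplus>\<^bsub>?M\<^esub>i\<in>S. c i \<odot>\<^bsub>?M\<^esub> fa_coset I (e i)) = \<zero>\<^bsub>?M\<^esub>" for S c
  proof -
    have "fa_coset I (\<Sum>i\<in>S. fa_scale (c i) (e i)) = I"
      using that finsum M fa_coset_zero[OF I] by simp
    moreover have "p \<in> fa_coset I p" for p
      unfolding fa_coset_def using fa.subspace_0[OF I] by force
    ultimately show ?thesis using indep[OF that(1,2)] by blast
  qed
  moreover have "(\<lambda>i. fa_coset I (e i)) ` N \<subseteq> carrier ?M"
    using e M by auto
  ultimately show ?thesis
    unfolding basis_family_def by (intro conjI allI ballI impI) (blast | simp)+
qed

section \<open>The rewriting system of an HNN extension\<close>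

text \<open>Meant for the last letter of a rule, which is always a \<open>Base\<close>.\<close>

primrec unbase :: "'a hnn_letter \<Rightarrow> 'a"
  where "unbase (Base x) = x" | "unbase Stable = undefined"

locale hnn = lie_superalgebra scale L bracket + letter_order lt
  for scale :: "'k::field \<Rightarrow> 'l::ab_group_add \<Rightarrow> 'l"
    and L :: "bit \<Rightarrow> 'l set"
    and bracket :: "'l \<Rightarrow> 'l \<Rightarrow> 'l"
    and lt :: "'l hnn_letter \<Rightarrow> 'l hnn_letter \<Rightarrow> bool" +
  fixes A :: "'l set" and \<delta> :: bit and d :: "'l \<Rightarrow> 'l" and X B :: "'l set"
  assumes char: "CHAR('k) \<noteq> 2" "CHAR('k) \<noteq> 3"
    and A: "lie_subalgebra scale L bracket A" "A \<noteq> UNIV"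
    and d: "superderivation scale L bracket A \<delta> d"
    and X: "linear_basis scale UNIV X" "X \<subseteq> L 0 \<union> L 1"
    and B: "linear_basis scale A B" "B \<subseteq> X"
    and order_BXt: "\<And>a x. a \<in> B \<Longrightarrow> x \<in> X - B \<Longrightarrow> lt (Base a) (Base x) \<and> lt (Base x) Stable"
begin

lemma two: "(2::'k) \<noteq> 0" and three: "(3::'k) \<noteq> 0"
  using char two_neq_0 three_neq_0 by blast+

abbreviation "par \<equiv> hnn_parity L \<delta>"
abbreviation "T \<equiv> hnn_letters X"
abbreviation "lin \<equiv> hnn_linear scale X :: 'l \<Rightarrow> ('l hnn_letter, 'k) free_assoc"
abbreviation "lhs \<equiv> hnn_leading_words L lt X B"

lemma indep_X: "independent X" and span_X: "span X = UNIV"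
  using X(1) by (simp_all add: linear_basis_def)

lemma span_B: "span B = A"
  using B(1) by (simp add: linear_basis_def)

lemma lookup_lin:
  "Poly_Mapping.lookup (lin z) w = (case w of [Base v] \<Rightarrow> representation X z v | _ \<Rightarrow> 0)"
proof -
  have "Poly_Mapping.lookup (lin z) w =
      (\<Sum>v | representation X z v \<noteq> 0. if [Base v] = w then representation X z v else 0)"
    by (simp add: hnn_linear_def lookup_sum fa_letter_def lookup_single when_def)
  also have "\<dots> = (case w of [Base v] \<Rightarrow> representation X z v | _ \<Rightarrow> 0)"
  proof (cases "\<exists>u. w = [Base u]")
    case True
    then show ?thesis by (auto simp: finite_representation)
  next
    case False
    then show ?thesis by (auto split: list.splits hnn_letter.splits intro!: sum.neutral)
  qed
  finally show ?thesis .
qed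

lemma linear_lin: "Vector_Spaces.linear scale fa_scale lin"
  by unfold_locales
    (auto intro!: poly_mapping_eqI simp: lookup_lin lookup_add representation_add[OF indep_X]
      representation_scale[OF indep_X] span_X split: list.splits hnn_letter.splits)

lemma lin_add: "lin (x + y) = lin x + lin y"
  and lin_scale: "lin (scale c x) = fa_scale c (lin x)"
  using linear_lin by (simp_all add: Vector_Spaces.linear_iff)

lemma lin_zero: "lin 0 = 0"
  using lin_scale[of 0 0] by simp

lemma lin_minus: "lin (- x) = - lin x"
  using lin_add[of x "- x"] by (simp add: lin_zero eq_neg_iff_add_eq_0 add.commute)

lemma lin_basis: "x \<in> X \<Longrightarrow> lin x = fa_letter (Base x)"
  by (rule poly_mapping_eqI)
    (auto simp: lookup_lin representation_basis[OF indep_X] fa_letter_def lookup_single when_def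
      split: list.splits hnn_letter.splits)

lemma keys_lin: "w \<in> Poly_Mapping.keys (lin z) \<Longrightarrow> \<exists>v\<in>X. w = [Base v] \<and> representation X z v \<noteq> 0"
  by (auto simp: in_keys_iff lookup_lin split: list.splits hnn_letter.splits dest:
      representation_ne_zero)

lemma lin_letters: "lin z \<in> fa.span (fa_letter ` T)"
  unfolding hnn_linear_def
  by (intro fa.span_sum fa.span_scale fa.span_base) (auto simp: hnn_letters_def dest:
      representation_ne_zero)

lemma components_Int: "x \<in> L i \<Longrightarrow> x \<in> L j \<Longrightarrow> i \<noteq> j \<Longrightarrow> x = 0"
  using components_disjoint bit_cases[of i] bit_cases[of j] by blast

lemma zero_notin_X: "0 \<notin> X"
  using indep_X dependent_zero by blast

text \<open>The part of \<open>z\<close> coming from the other component of \<open>L\<close> also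
  lies in \<open>L k\<close>, hence is 0.\<close>

lemma homogeneous_span: "z \<in> L k \<Longrightarrow> z \<in> span (X \<inter> L k)"
proof -
  assume z: "z \<in> L k"
  have un: "X = (X \<inter> L k) \<union> (X \<inter> L (k + 1))"
    using X(2) bit_cases[of k] by auto
  have "z \<in> span ((X \<inter> L k) \<union> (X \<inter> L (k + 1)))"
    using span_X un by auto
  then obtain a b where ab: "z = a + b" "a \<in> span (X \<inter> L k)" "b \<in> span (X \<inter> L (k + 1))"
    unfolding span_Un by blast
  have "a \<in> L k" "b \<in> L (k + 1)"
    using ab span_minimal[OF _ subspace_component] by blast+
  then have "b \<in> L k"
    using ab(1) z subspace_diff[OF subspace_component, of z k a] by simp
  then have "b = 0" using components_Int[OF \<open>b \<in> L (k + 1)\<close>] by simp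
  then show ?thesis using ab by simp
qed

lemma representation_homogeneous: "z \<in> L k \<Longrightarrow> representation X z v \<noteq> 0 \<Longrightarrow> v \<in> X \<inter> L k"
  using representation_extend[OF indep_X homogeneous_span, of z k] representation_ne_zero by auto

lemma parity_Base: "x \<in> X \<inter> L k \<Longrightarrow> par (Base x) = k"
  using components_Int[of x k 1] zero_notin_X bit_cases[of k] by auto

lemma X_component: "x \<in> X \<Longrightarrow> x \<in> L (par (Base x))"
  using X(2) by auto

lemma fa_hom_lin:
  assumes "z \<in> L k"
  shows "fa_hom par k (lin z)"
  unfolding fa_hom_def
proof
  fix w assume "w \<in> Poly_Mapping.keys (lin z)"
  then obtain v where "w = [Base v]" "representation X z v \<noteq> 0" by (auto dest: keys_lin)
  moreover from this(2) have "v \<in> X \<inter> L k" using representation_homogeneous assms by blast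
  ultimately show "word_parity par w = k"
    using parity_Base by (simp del: hnn_parity.simps)
qed

text \<open>Letters act on \<open>L\<close> as superderivations: \<open>Base x\<close> by the
  adjoint map, \<open>Stable\<close> by \<open>d\<close> on \<open>A\<close> only. Overlaps inside
  \<open>L\<close> and those beginning with t thus become one computation.\<close>

fun act :: "'l hnn_letter \<Rightarrow> 'l \<Rightarrow> 'l"
  where "act (Base x) a = bracket x a" | "act Stable a = d a"

fun dom :: "'l hnn_letter \<Rightarrow> 'l set"
  where "dom (Base x) = UNIV" | "dom Stable = A"

text \<open>The relations extended linearly in the second argument, because the Jacobi identity
  produces relations at brackets, which need not be basis elements.\<close>

definition rel :: "'l hnn_letter \<Rightarrow> 'l \<Rightarrow> ('l hnn_letter, 'k) free_assoc"
  where "rel x a = superbracket par (fa_letter x) (lin a) - lin (act x a)"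

definition rel2 :: "'l \<Rightarrow> 'l \<Rightarrow> ('l hnn_letter, 'k) free_assoc"
  where "rel2 a b = superbracket par (lin a) (lin b) - lin (bracket a b)"

lemma rel_Base: "x \<in> X \<Longrightarrow> rel (Base x) a = rel2 x a"
  by (simp add: rel_def rel2_def lin_basis)

lemma relations_eq:
  "hnn_relations scale L bracket \<delta> d X B =
    {rel (Base x) y | x y. x \<in> X \<and> y \<in> X} \<union> {rel Stable a | a. a \<in> B}"
proof -
  have 1: "rel (Base x) y = superbracket par (fa_letter (Base x)) (fa_letter (Base y)) - lin
      (bracket x y)"
    if "y \<in> X" for x y
    using that by (simp add: rel_def lin_basis)
  have 2: "rel Stable a = superbracket par (fa_letter Stable) (fa_letter (Base a)) - lin (d a)"
    if "a \<in> B" for a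
    using that B(2) by (simp add: rel_def lin_basis subsetD)
  show ?thesis
    unfolding hnn_relations_def
    by (intro arg_cong2[where f = "(\<union>)"] Collect_cong) (metis 1, metis 2)
qed

lemma B_subset_A: "B \<subseteq> A"
  using span_B span_superset by blast

lemma subspace_A: "subspace A"
  using A(1) by (simp add: lie_subalgebra_def)

lemma act_derivation:
  assumes x: "x \<in> T" and y: "y \<in> X" "y \<in> dom x" and z: "z \<in> X" "z \<in> dom x"
  shows "act x (bracket y z) = bracket (act x y) z
    + scale (ksign (par x) (par (Base y))) (bracket y (act x z))"
  and "bracket y z \<in> dom x" "act x y \<in> L (par x + par (Base y))"
proof -
  note yz = X_component[OF y(1)] X_component[OF z(1)]
  show "act x (bracket y z) = bracket (act x y) z
    + scale (ksign (par x) (par (Base y))) (bracket y (act x z))"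
  proof (cases x)
    case (Base x')
    then have "x' \<in> L (par x)" using x X_component[of x'] by (auto simp: hnn_letters_def)
    then show ?thesis using bracket_jacobi[OF _ yz] by (simp only: Base act.simps)
  next
    case Stable
    then show ?thesis
      using d y z yz by (simp add: superderivation_def del: hnn_parity.simps(1))
  qed
  show "bracket y z \<in> dom x"
    using y z A(1) by (cases x) (auto simp: lie_subalgebra_def)
  show "act x y \<in> L (par x + par (Base y))"
  proof (cases x)
    case (Base x')
    then have "x' \<in> L (par x)" using x X_component[of x'] by (auto simp: hnn_letters_def)
    then show ?thesis using bracket_graded[OF _ yz(1)] by (simp only: Base act.simps)
  next
    case Stable
    then have "y \<in> A \<inter> L (par (Base y))" using y(2) yz(1) by simp
    moreover have "\<forall>i. \<forall>x\<in>A \<inter> L i. d x \<in> L (i + \<delta>)"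
      using d by (simp add: superderivation_def)
    ultimately have "d y \<in> L (par (Base y) + \<delta>)" by blast
    then show ?thesis by (simp add: Stable add.commute del: hnn_parity.simps(1))
  qed
qed

text \<open>The Jacobi identity in the free associative algebra, compared with the Jacobi identity of
  \<open>L\<close> or the derivation property of \<open>d\<close>. Up to smaller terms the left-hand side is a
  nonzero multiple of the overlap of the two rules at \<open>xyz\<close>; the multiple is 6 when
  \<open>x = y = z\<close> is odd.\<close>

lemma relation_identity:
  assumes x: "x \<in> T" and y: "y \<in> X" "y \<in> dom x" and z: "z \<in> X" "z \<in> dom x"
  shows "superbracket par (fa_letter x) (rel (Base y) z)
      - superbracket par (rel x y) (fa_letter (Base z))
      - fa_scale (ksign (par x) (par (Base y))) (superbracket par (fa_letter (Base y)) (rel x z))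
    = rel2 (act x y) z
      + fa_scale (ksign (par x) (par (Base y))) (rel2 y (act x z))
      - rel x (bracket y z)"
proof -
  let ?k = "ksign (par x) (par (Base y)) :: 'k"
  interpret l: Vector_Spaces.linear fa_scale fa_scale "superbracket par p" for p
    by (rule linear_superbracket_right)
  interpret r: Vector_Spaces.linear fa_scale fa_scale "\<lambda>p. superbracket par p q" for q
    by (rule linear_superbracket_left)
  have jac: "superbracket par (fa_letter x) (superbracket par (lin y) (lin z)) =
      superbracket par (superbracket par (fa_letter x) (lin y)) (lin z)
      + fa_scale ?k (superbracket par (lin y) (superbracket par (fa_letter x) (lin z)))"
    by (rule superbracket_jacobi[OF fa_hom_letter fa_hom_lin fa_hom_lin])
      (use X_component y z in blast)+
  have der: "lin (act x (bracket y z)) = lin (bracket (act x y) z) + fa_scale ?k (lin (bracket y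
      (act x z)))"
    by (simp only: act_derivation(1)[OF assms] lin_add lin_scale)
  show ?thesis
    unfolding rel_def rel2_def lin_basis[OF y(1), symmetric] lin_basis[OF z(1), symmetric]
    unfolding l.diff r.diff jac der act.simps fa.scale_right_diff_distrib
    by (simp add: algebra_simps del: hnn_parity.simps)
qed

text \<open>For odd \<open>x\<close> the relation \<open>rel x x\<close> has leading coefficient 2.\<close>

definition coef :: "'l hnn_letter list \<Rightarrow> 'k"
  where "coef l = (if hd l = last l then 1 / 2 else 1)"

definition rhs :: "'l hnn_letter list \<Rightarrow> ('l hnn_letter, 'k) free_assoc"
  where "rhs l = mon l - fa_scale (coef l) (rel (hd l) (unbase (last l)))"

end

section \<open>Orientation of the rules and resolution of the overlaps\<close>

context hnn
begin

lemma fa_letter_mon: "fa_letter x = mon [x]"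
  by (simp add: fa_letter_def)

text \<open>If \<open>B\<close> is empty, nothing is assumed about the position of \<open>Stable\<close>, and none of the
  rules involves it.\<close>

lemma less_Stable:
  assumes "b \<in> B"
  shows "lt (Base b) Stable"
proof -
  have "\<not> X \<subseteq> B"
    using span_mono[of X B] span_X span_B A(2) by auto
  then obtain x where "x \<in> X - B" by blast
  then show ?thesis using order_BXt[OF assms] trans by blast
qed

lemma lhs_cases:
  assumes "l \<in> lhs"
  obtains x y where "l = [x, Base y]" "x \<in> T" "y \<in> X" "y \<in> dom x"
    "lt (Base y) x \<or> x = Base y \<and> par x = 1"
proof -
  consider x y where "l = [Base x, Base y]" "x \<in> X" "y \<in> X" "lt (Base y) (Base x)"
    | x where "l = [Base x, Base x]" "x \<in> X \<inter> L 1"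
    | a where "l = [Stable, Base a]" "a \<in> B"
    using assms unfolding hnn_leading_words_def by blast
  then show ?thesis
  proof cases
    case 1
    then show ?thesis using that by (auto simp: hnn_letters_def)
  next
    case 2
    then show ?thesis using that[of "Base x" x] by (auto simp: hnn_letters_def)
  next
    case 3
    then show ?thesis
      using that[of Stable a] less_Stable B(2) B_subset_A by (auto simp: hnn_letters_def)
  qed
qed

lemma rel_expand:
  assumes "y \<in> X"
  shows "rel x y = mon [x, Base y] - fa_scale (ksign (par x) (par (Base y))) (mon [Base y, x]) -
      lin (act x y)"
  using superbracket_hom[OF fa_hom_letter fa_hom_letter, of par x "Base y"] assms
  by (simp add: rel_def lin_basis fa_letter_mon mon_mult del: fa_scale_single hnn_parity.simps)

text \<open>For two different letters the right side is a multiple of the swapped pair plus linear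
  terms; for an odd square the factor 1/2 removes the quadratic part altogether.\<close>

lemma keys_rhs:
  assumes "l \<in> lhs" "w \<in> Poly_Mapping.keys (rhs l)"
  shows "(w, l) \<in> word_rel"
proof -
  obtain x y where l: "l = [x, Base y]" "x \<in> T" "y \<in> X"
      and xy: "lt (Base y) x \<or> x = Base y \<and> par x = 1"
    using assms(1) by (rule lhs_cases)
  have lin: "(w, l) \<in> word_rel" if "w \<in> Poly_Mapping.keys (lin z)" for z
    using keys_lin[OF that] l(1) by (auto simp: word_rel_def)
  show ?thesis
  proof (cases "x = Base y")
    case True
    then have "par x = 1" using xy irrefl by auto
    then have "rel x y = fa_scale 2 (mon l) - lin (act x y)"
      using rel_expand[OF l(3), of x] True l(1)
      by (simp add: ksign_def single_diff[symmetric] del: hnn_parity.simps)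
    then have "rhs l = fa_scale (1 / 2) (lin (act x y))"
      using True two l(1) by (simp add: rhs_def coef_def fa.scale_right_diff_distrib)
    then show ?thesis using assms(2) lin[of "act x y"] by (simp add: in_keys_iff)
  next
    case False
    then have "rhs l = fa_scale (ksign (par x) (par (Base y))) (mon [Base y, x]) + lin (act x y)"
      using l rel_expand[OF l(3), of x] by (simp add: rhs_def coef_def del: fa_scale_single)
    then have "w = [Base y, x] \<or> w \<in> Poly_Mapping.keys (lin (act x y))"
      using assms(2) by (auto simp: in_keys_iff lookup_add lookup_single when_def split: if_splits)
    then show ?thesis
      using lin[of "act x y"] l(1) xy False by (auto simp: word_rel_def)
  qed
qed

sublocale quadratic_rewriting lt lhs rhs
  by unfold_locales (use keys_rhs in \<open>auto elim: lhs_cases\<close>)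

lemma gen_eq: "gen [x, Base y] = fa_scale (coef [x, Base y]) (rel x y)"
  by (simp add: gen_def rhs_def)

lemma coef_nonzero: "coef l \<noteq> 0"
  using two by (simp add: coef_def)

lemma rel_eq_gen: "rel x y = fa_scale (1 / coef [x, Base y]) (gen [x, Base y])"
  using coef_nonzero by (simp add: gen_eq)

text \<open>Relations not multiplied by any words. They involve words of length at most 2, so they
  are trivial at every longer word; see \<open>deg2_below\<close>.\<close>

definition deg2 :: "('l hnn_letter, 'k) free_assoc set"
  where "deg2 = fa.span (gen ` lhs)"

lemma subspace_deg2: "fa.subspace deg2"
  by (simp add: deg2_def)

lemma rel_deg2_lhs: "[x, Base y] \<in> lhs \<Longrightarrow> rel x y \<in> deg2"
  unfolding deg2_def rel_eq_gen by (intro fa.span_scale fa.span_base) auto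

lemma rel2_skew:
  assumes "x \<in> L i" "y \<in> L j"
  shows "rel2 x y = - fa_scale (ksign i j) (rel2 y x)"
  using superbracket_skew[OF fa_hom_lin fa_hom_lin, OF assms] bracket_skew[OF assms]
  by (simp add: rel2_def lin_minus lin_scale fa.scale_right_diff_distrib)

lemma rel2_deg2_basis:
  assumes x: "x \<in> X" and y: "y \<in> X"
  shows "rel2 x y \<in> deg2"
proof -
  have greater: "rel2 x y \<in> deg2" if "lt (Base y) (Base x)" "x \<in> X" "y \<in> X" for x y
    using rel_deg2_lhs[of "Base x" y] that rel_Base[of x y] by (auto simp: hnn_leading_words_def)
  consider "lt (Base y) (Base x)" | "lt (Base x) (Base y)" | "x = y" using total by blast
  then show ?thesis
  proof cases
    case 1
    then show ?thesis using greater x y by blast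
  next
    case 2
    then have "rel2 y x \<in> deg2" using greater x y by blast
    then show ?thesis
      unfolding rel2_skew[OF X_component[OF x] X_component[OF y]]
      by (intro fa.subspace_neg[OF subspace_deg2] fa.subspace_scale[OF subspace_deg2])
  next
    case 3
    show ?thesis
    proof (cases "x \<in> L 1")
      case True
      then show ?thesis
        using rel_deg2_lhs[of "Base x" x] 3 x rel_Base[of x x] by (auto simp: hnn_leading_words_def)
    next
      case False
      then have x0: "x \<in> L 0" using x X(2) by auto
      \<comment> \<open>An even \<open>x\<close> gives no rule: its bracket with itself vanishes on
        both sides, in \<open>L\<close> because 2 is invertible.\<close>
      have "bracket x x + bracket x x = 0"
        using bracket_skew[OF x0 x0] by (simp add: ksign_def eq_neg_iff_add_eq_0)
      then have "scale 2 (bracket x x) = 0"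
        using scale_left_distrib[of 1 1 "bracket x x"] by simp
      then have "bracket x x = 0" using two by simp
      moreover have "superbracket par (lin x) (lin x) = 0"
        using superbracket_hom[OF fa_hom_lin[OF x0] fa_hom_lin[OF x0]] by (simp add: ksign_def)
      ultimately have "rel2 x x = 0" by (simp add: rel2_def lin_zero)
      then show ?thesis using 3 fa.subspace_0[OF subspace_deg2] by simp
    qed
  qed
qed

lemma bracket_add_left: "bracket (x + y) z = bracket x z + bracket y z"
  and bracket_scale_left: "bracket (scale c x) z = scale c (bracket x z)"
  and bracket_add_right: "bracket z (x + y) = bracket z x + bracket z y"
  and bracket_scale_right: "bracket z (scale c x) = scale c (bracket z x)"
  using bracket_linear_left[of z] bracket_linear_right[of z]
    by (simp_all add: Vector_Spaces.linear_iff)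

lemma rel2_deg2: "rel2 a b \<in> deg2"
proof -
  have left: "Vector_Spaces.linear scale fa_scale (\<lambda>a. rel2 a b)" for b
    by unfold_locales
      (simp_all add: rel2_def lin_add lin_scale superbracket_add_left superbracket_scale_left
        bracket_add_left bracket_scale_left fa.scale_right_diff_distrib)
  have right: "Vector_Spaces.linear scale fa_scale (rel2 a)" for a
    by unfold_locales
      (simp_all add: rel2_def lin_add lin_scale superbracket_add_right superbracket_scale_right
        bracket_add_right bracket_scale_right fa.scale_right_diff_distrib)
  have "rel2 x b \<in> deg2" if "x \<in> X" for x
    by (rule linear_span_mem[OF right subspace_deg2 rel2_deg2_basis[OF that],
        where S = X]) (auto simp: span_X)
  then show ?thesis
    by (rule linear_span_mem[OF left subspace_deg2, where S = X]) (auto simp: span_X)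
qed

lemma rel_deg2:
  assumes x: "x \<in> T" and a: "a \<in> dom x"
  shows "rel x a \<in> deg2"
proof (cases x)
  case (Base x')
  then show ?thesis using x rel_Base rel2_deg2 by (auto simp: hnn_letters_def)
next
  case Stable
  have "a \<in> span B" using a Stable span_B by simp
  \<comment> \<open>\<open>d\<close> is linear only on \<open>A\<close>, so membership in
    \<open>A\<close> has to be carried through the induction.\<close>
  then have "a \<in> A \<and> rel Stable a \<in> deg2"
  proof (induction rule: span_induct_alt)
    case base
    have "d 0 = 0"
      using d subspace_0[OF subspace_A] unfolding superderivation_def
        by (metis add_cancel_right_left)
    then have "rel Stable 0 = 0"
      using superbracket_scale_right[of par "fa_letter Stable" 0 0] by (simp add: rel_def lin_zero)
    then show ?case using subspace_0[OF subspace_A] fa.subspace_0[OF subspace_deg2] by simp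
  next
    case (step c b y)
    have b: "b \<in> A" using step B_subset_A by blast
    have "d (scale c b + y) = scale c (d b) + d y"
      using d b step subspace_scale[OF subspace_A b, of c] unfolding superderivation_def by simp
    then have "rel Stable (scale c b + y) = fa_scale c (rel Stable b) + rel Stable y"
      by (simp add: rel_def lin_add lin_scale superbracket_add_right superbracket_scale_right
          fa.scale_right_diff_distrib)
    moreover have "rel Stable b \<in> deg2"
      using step by (intro rel_deg2_lhs) (auto simp: hnn_leading_words_def)
    ultimately show ?case
      using step b subspace_add[OF subspace_A] subspace_scale[OF subspace_A]
        fa.subspace_add[OF subspace_deg2] fa.subspace_scale[OF subspace_deg2] by simp
  qed
  then show ?thesis using Stable by simp
qed

lemma deg2_below:
  assumes "p \<in> deg2" "length w > 2"
  shows "p \<in> fa.span (below w)"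
proof -
  have "gen l \<in> fa.span (below w)" if "l \<in> lhs" for l
    using below_memI[OF that, of "[]" "[]" w] length_lhs[OF that] assms(2)
    by (simp add: word_rel_def mon_Nil)
  then have "gen ` lhs \<subseteq> fa.span (below w)" by blast
  then have "deg2 \<subseteq> fa.span (below w)"
    unfolding deg2_def by (rule fa.span_minimal) simp
  then show ?thesis using assms(1) by blast
qed

lemma rel_below:
  assumes "[x, Base y] \<in> lhs" "(u @ [x, Base y] @ v, w) \<in> word_rel"
  shows "mon u * rel x y * mon v \<in> fa.span (below w)"
proof -
  have "mon u * rel x y * mon v = fa_scale (1 / coef [x, Base y]) (mon u * gen [x, Base y] * mon v)"
    unfolding rel_eq_gen by (simp add: fa_scale_mult_left fa_scale_mult_right)
  then show ?thesis using below_memI[OF assms] fa.span_scale by metis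
qed

lemma rel_below_left:
  "[x, Base y] \<in> lhs \<Longrightarrow> ([u, x, Base y], w) \<in> word_rel \<Longrightarrow> mon [u] * rel x y \<in> fa.span (below w)"
  using rel_below[of x y "[u]" "[]" w] by (simp add: mon_Nil)

lemma rel_below_right:
  "[x, Base y] \<in> lhs \<Longrightarrow> ([x, Base y, v], w) \<in> word_rel \<Longrightarrow> rel x y * mon [v] \<in> fa.span (below w)"
  using rel_below[of x y "[]" "[v]" w] by (simp add: mon_Nil)

lemma fa_hom_rel:
  assumes "x \<in> T" "y \<in> X" "y \<in> dom x"
  shows "fa_hom par (par x + par (Base y)) (rel x y)"
  unfolding rel_def
  by (intro fa_hom_diff fa_hom_superbracket fa_hom_letter fa_hom_lin X_component
      act_derivation(3)[OF assms assms(2,3)] assms(2))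

text \<open>The Jacobi identity also involves the outer pair, which must be a rule again. For
  \<open>Stable\<close> this holds since \<open>B\<close> is an initial segment of \<open>X\<close>:
  z <= y with y in \<open>B\<close> forces z into \<open>B\<close>.\<close>

lemma overlap_triple:
  assumes xy: "[x, y] \<in> lhs" and yz: "[y, z] \<in> lhs"
  obtains y' z' where "y = Base y'" "z = Base z'" "x \<in> T" "y' \<in> X" "y' \<in> dom x" "z' \<in> X"
      "z' \<in> dom x"
    "lt (Base y') x \<or> x = Base y' \<and> par x = 1"
        "lt (Base z') (Base y') \<or> y' = z' \<and> par (Base y') = 1"
    "[x, Base z'] \<in> lhs"
proof -
  obtain y' where y: "y = Base y'" "x \<in> T" "y' \<in> X" "y' \<in> dom x"
      "lt (Base y') x \<or> x = Base y' \<and> par x = 1"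
    using xy by (rule lhs_cases) auto
  obtain z' where z: "z = Base z'" "z' \<in> X" "lt (Base z') (Base y') \<or> y' = z' \<and> par (Base y') = 1"
    using yz unfolding y(1) by (rule lhs_cases) auto
  have "z' \<in> dom x \<and> [x, Base z'] \<in> lhs"
  proof (cases x)
    case (Base x')
    show ?thesis
    proof (cases "lt (Base z') (Base x')")
      case True
      then show ?thesis using Base y(2) z(2) by (auto simp: hnn_leading_words_def hnn_letters_def)
    next
      case False
      then have "x = Base y'" "y' = z'"
        using y(5) z(3) Base trans by blast+
      then show ?thesis using xy y(1) Base by simp
    qed
  next
    case Stable
    then have "y' \<in> B" using xy y(1) by (auto simp: hnn_leading_words_def)
    have "z' \<in> B"
    proof (rule ccontr)
      assume "z' \<notin> B"
      then have "lt (Base y') (Base z')" using order_BXt[OF \<open>y' \<in> B\<close>] z(2) by blast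
      then show False using z(3) trans irrefl \<open>y' \<in> B\<close> \<open>z' \<notin> B\<close> by blast
    qed
    then show ?thesis using Stable B_subset_A by (auto simp: hnn_leading_words_def)
  qed
  then show ?thesis using that y z by blast
qed

text \<open>\<open>E\<close> is the Jacobi combination of the three relations. It lies in
  \<open>deg2\<close> by \<open>relation_identity\<close>, hence is trivial at xyz, and solving it
  for the overlap leaves only smaller words. Coinciding letters change the multiple of the overlap
  in \<open>E\<close>.\<close>

lemma overlap_resolvable:
  assumes xy: "[x, y] \<in> lhs" and yz: "[y, z] \<in> lhs"
  shows "gen [x, y] * mon [z] - mon [x] * gen [y, z] \<in> fa.span (below [x, y, z])"
proof -
  obtain y' z' where eqs: "y = Base y'" "z = Base z'" and x: "x \<in> T" and y': "y' \<in> X" "y' \<in> dom x"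
    and z': "z' \<in> X" "z' \<in> dom x" and less_xy: "lt (Base y') x \<or> x = Base y' \<and> par x = 1"
    and less_yz: "lt (Base z') (Base y') \<or> y' = z' \<and> par (Base y') = 1" and xz: "[x, Base z'] \<in> lhs"
    using overlap_triple[OF xy yz] by metis
  define i j k where "i = par x" and "j = par y" and "k = par z"
  define W where "W = fa.span (below [x, y, z])"
  have subspace: "fa.subspace W" by (simp add: W_def)
  have double: "fa_scale 2 u = u + u" for u :: "('l hnn_letter, 'k) free_assoc"
    using fa.scale_left_distrib[of 1 1 u] by simp
  have triple: "fa_scale 3 u = u + u + u" for u :: "('l hnn_letter, 'k) free_assoc"
    using fa.scale_left_distrib[of 2 1 u] by (simp add: double)
  have halve: "u \<in> W" if "fa_scale 2 u \<in> W" for u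
    using fa.subspace_scale[OF subspace that, of "1 / 2"] two by simp
  note W_intros = fa.subspace_add[OF subspace] fa.subspace_diff[OF subspace]
    fa.subspace_scale[OF subspace] fa.subspace_neg[OF subspace]
  define p q r where "p = rel y z'" and "q = rel x y'" and "r = rel x z'"
  have hom: "fa_hom par (i + j) q" "fa_hom par (j + k) p" "fa_hom par (i + k) r"
    unfolding p_def q_def r_def i_def j_def k_def eqs
    by (intro fa_hom_rel x y' z'; use y' in \<open>simp add: hnn_letters_def\<close>)+
  define E where "E = (mon [x] * p - fa_scale (ksign i (j + k)) (p * mon [x]))
    - (q * mon [z] - fa_scale (ksign (i + j) k) (mon [z] * q))
    - fa_scale (ksign i j) (mon [y] * r - fa_scale (ksign j (i + k)) (r * mon [y]))"
  have "E = superbracket par (fa_letter x) (rel (Base y') z')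
      - superbracket par (rel x y') (fa_letter (Base z'))
      - fa_scale (ksign (par x) (par (Base y'))) (superbracket par (fa_letter (Base y')) (rel x
          z'))"
    using superbracket_hom[OF fa_hom_letter[of par x, folded i_def] hom(2)]
      superbracket_hom[OF hom(1) fa_hom_letter[of par z, folded k_def]]
      superbracket_hom[OF fa_hom_letter[of par y, folded j_def] hom(3)]
    by (simp add: E_def p_def q_def r_def i_def j_def fa_letter_mon eqs del: hnn_parity.simps)
  also have "\<dots> = rel2 (act x y') z' + fa_scale (ksign (par x) (par (Base y'))) (rel2 y' (act x z'))
      - rel x (bracket y' z')"
    by (rule relation_identity[OF x y' z'])
  also have "\<dots> \<in> deg2"
    by (intro fa.subspace_add[OF subspace_deg2] fa.subspace_diff[OF subspace_deg2]
        fa.subspace_scale[OF subspace_deg2] rel2_deg2 rel_deg2[OF x] act_derivation(2)[OF x y' z'])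
  finally have E: "E \<in> W" unfolding W_def by (rule deg2_below) simp
  have lhs: "[x, Base y'] \<in> lhs" "[y, Base z'] \<in> lhs" "[x, Base z'] \<in> lhs"
    using xy yz xz by (simp_all add: eqs)
  have gen: "gen [x, y] = fa_scale (if x = y then 1 / 2 else 1) q"
    "gen [y, z] = fa_scale (if y = z then 1 / 2 else 1) p"
    by (simp_all add: gen_eq coef_def p_def q_def eqs)
  have less: "lt y x \<or> x = y \<and> i = 1" "lt z y \<or> y = z \<and> j = 1"
    using less_xy less_yz by (auto simp: eqs i_def j_def)
  consider "lt y x" "lt z y" | "x = y" "lt z y" "i = 1" "j = 1" | "lt y x" "y = z" "j = 1" "k = 1"
    | "x = y" "y = z" "i = 1" "j = 1" "k = 1"
    using less by (metis i_def j_def k_def)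
  then have "gen [x, y] * mon [z] - mon [x] * gen [y, z] \<in> W" (is "?G \<in> W")
  proof cases
    case 1
    have "p * mon [x] \<in> W" "mon [z] * q \<in> W" "mon [y] * r \<in> W" "r * mon [y] \<in> W"
      unfolding W_def p_def q_def r_def
      by (intro rel_below_left rel_below_right lhs; use 1 trans in \<open>auto simp: word_rel_def eqs\<close>)+
    note mems = this E
    have ne: "x \<noteq> y" "y \<noteq> z" using 1 irrefl by auto
    have "gen [x, y] * mon [z] - mon [x] * gen [y, z] =
      fa_scale (ksign (i + j) k) (mon [z] * q) - E - fa_scale (ksign i (j + k)) (p * mon [x])
      - fa_scale (ksign i j) (mon [y] * r - fa_scale (ksign j (i + k)) (r * mon [y]))"
      unfolding gen E_def using ne by (simp add: algebra_simps)
    also have "\<dots> \<in> W" by (intro W_intros mems)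
    finally show ?thesis .
  next
    case 2
    \<comment> \<open>With \<open>x = y\<close> odd, the terms x p and y r add up, and
      \<open>E\<close> is -2 times the overlap up to smaller words.\<close>
    have r: "r = p" using 2(1) by (simp add: p_def r_def)
    have "p * mon [x] \<in> W" "mon [z] * q \<in> W"
      unfolding W_def p_def q_def
      by (intro rel_below_left rel_below_right lhs; use 2 in \<open>auto simp: word_rel_def eqs\<close>)+
    note mems = this E
    have ne: "y \<noteq> z" using 2 irrefl by auto
    have "fa_scale 2 ?G = mon [z] * q - E - fa_scale 2 (fa_scale (ksign 1 (1 + k)) (p * mon [x]))"
      unfolding gen E_def using ne 2 two bit_cases[of k]
      by (auto simp: r ksign_def fa_scale_mult_left fa_scale_mult_right double
          fa.scale_right_diff_distrib)
    also have "\<dots> \<in> W" by (intro W_intros mems)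
    finally show ?thesis by (rule halve)
  next
    case 3
    \<comment> \<open>With \<open>y = z\<close> odd, it is q z and r y that add up, again giving -2
      times the overlap.\<close>
    have r: "r = q" using 3(2) by (simp add: q_def r_def eqs)
    have "p * mon [x] \<in> W" "mon [y] * q \<in> W"
      unfolding W_def p_def q_def
      by (intro rel_below_left rel_below_right lhs; use 3 in \<open>auto simp: word_rel_def eqs\<close>)+
    note mems = this E
    have ne: "x \<noteq> y" using 3 irrefl by auto
    have "fa_scale 2 ?G = - E - p * mon [x] - fa_scale 2 (fa_scale (ksign i 1) (mon [y] * q))"
      unfolding gen E_def using ne 3 two bit_cases[of i]
      by (auto simp: r ksign_def fa_scale_mult_left fa_scale_mult_right double
          fa.scale_right_diff_distrib)
    also have "\<dots> \<in> W" by (intro W_intros mems)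
    finally show ?thesis by (rule halve)
  next
    case 4
    \<comment> \<open>All three relations coincide and \<open>E\<close> is exactly -6 times the
      overlap, so 3 has to be inverted as well.\<close>
    have r: "r = p" "q = p" using 4(1,2) by (simp_all add: p_def q_def r_def eqs)
    have "fa_scale 2 ?G = p * mon [x] - mon [x] * p"
      unfolding gen using 4 two
      by (simp add: r fa_scale_mult_left fa_scale_mult_right fa.scale_right_diff_distrib)
    moreover have "E = fa_scale 3 (mon [x] * p - p * mon [x])"
      unfolding E_def using 4 by (simp add: r ksign_def triple)
    ultimately have "fa_scale 2 ?G = fa_scale (- 1 / 3) E"
      using three by simp
    also have "\<dots> \<in> W" by (intro W_intros E)
    finally show ?thesis by (rule halve)
  qed
  then show ?thesis by (simp add: W_def)
qed

sublocale confluent_quadratic_rewriting lt lhs rhs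
  by unfold_locales (rule overlap_resolvable)

end

section \<open>Dependence on the order only through the letters that occur\<close>

lemma hnn_leading_words_cong:
  assumes "\<And>x y. x \<in> hnn_letters X \<Longrightarrow> y \<in> hnn_letters X \<Longrightarrow> lt' x y \<longleftrightarrow> lt x y"
  shows "hnn_leading_words L lt' X B = hnn_leading_words L lt X B"
  unfolding hnn_leading_words_def using assms by (auto simp: hnn_letters_def)

lemma word_less_cong:
  assumes "\<And>x y. x \<in> T \<Longrightarrow> y \<in> T \<Longrightarrow> lt' x y \<longleftrightarrow> lt x y"
  shows "set u \<subseteq> T \<Longrightarrow> set v \<subseteq> T \<Longrightarrow> word_less lt' u v \<longleftrightarrow> word_less lt u v"
  using assms by (induction lt u v rule: word_less.induct) auto

text \<open>The letters are tracked along the induction because the two orders agree only on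
  \<open>T\<close>.\<close>

lemma lyndon_shirshov_mono:
  assumes lt: "\<And>x y. x \<in> T \<Longrightarrow> y \<in> T \<Longrightarrow> lt' x y \<longleftrightarrow> lt x y"
  shows "lyndon_shirshov lt T f \<Longrightarrow> lyndon_shirshov lt' T f \<and> set (assoc_word f) \<subseteq> T"
proof (induction rule: lyndon_shirshov.induct)
  case (letter x)
  then show ?case by (simp add: lyndon_shirshov.letter)
next
  case (product u1 u2)
  have "word_less lt' (assoc_word v2) (assoc_word u2) \<or> assoc_word v2 = assoc_word u2"
    if "u1 = Prod v1 v2" for v1 v2
    using product.IH product.hyps(4)[OF that] word_less_cong[of T lt' lt, OF lt] that by auto
  then show ?case
    using product.IH product.hyps(3) word_less_cong[of T lt' lt, OF lt]
    by (auto intro: lyndon_shirshov.product)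
qed

lemma super_lyndon_shirshov_cong:
  assumes "\<And>x y. x \<in> T \<Longrightarrow> y \<in> T \<Longrightarrow> lt' x y \<longleftrightarrow> lt x y"
  shows "super_lyndon_shirshov par lt' T f \<longleftrightarrow> super_lyndon_shirshov par lt T f"
proof -
  have "lyndon_shirshov lt' T f \<longleftrightarrow> lyndon_shirshov lt T f" for f
    using lyndon_shirshov_mono[of T lt' lt f] lyndon_shirshov_mono[of T lt lt' f] assms by blast
  then show ?thesis by (simp add: super_lyndon_shirshov_def)
qed

section \<open>The Lie ideal inside the associative ideal, and the basis\<close>

context hnn
begin

abbreviation "I \<equiv> hnn_ideal scale L bracket \<delta> d X B"

definition assoc_ideal :: "('l hnn_letter, 'k) free_assoc set"
  where "assoc_ideal = fa.span {mon u * gen l * mon v | u l v. l \<in> lhs}"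

lemma subspace_assoc_ideal: "fa.subspace assoc_ideal"
  by (simp add: assoc_ideal_def)

lemma assoc_ideal_mult:
  assumes "p \<in> assoc_ideal"
  shows "q * p \<in> assoc_ideal" "p * q \<in> assoc_ideal"
proof -
  have gens: "mon w * (mon u * gen l * mon v) \<in> assoc_ideal"
      "(mon u * gen l * mon v) * mon w \<in> assoc_ideal"
    if "l \<in> lhs" for u v w l
  proof -
    have "mon w * (mon u * gen l * mon v) = mon (w @ u) * gen l * mon v"
      "(mon u * gen l * mon v) * mon w = mon u * gen l * mon (v @ w)"
      by (simp_all add: mult.assoc mon_mult mon_mult_assoc)
    then show "mon w * (mon u * gen l * mon v) \<in> assoc_ideal"
        "(mon u * gen l * mon v) * mon w \<in> assoc_ideal"
      using that unfolding assoc_ideal_def by (auto intro!: fa.span_base)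
  qed
  have "mon w * p \<in> assoc_ideal" for w
    by (rule linear_span_mem[OF linear_mult_left subspace_assoc_ideal _ assms[unfolded
        assoc_ideal_def]])
      (use gens(1) in blast)
  then show "q * p \<in> assoc_ideal"
    using fa_span_mult_mono[of q 1 p] unfolding assoc_ideal_def by simp
  have "p * mon w \<in> assoc_ideal" for w
    by (rule linear_span_mem[OF linear_mult_right subspace_assoc_ideal _ assms[unfolded
        assoc_ideal_def]])
      (use gens(2) in blast)
  then show "p * q \<in> assoc_ideal"
    using fa_span_mult_mono[of q p 1] unfolding assoc_ideal_def by simp
qed

text \<open>The rules are homogeneous, so of the two parity parts of a generator one is the
  generator itself and the other is 0.\<close>

lemma assoc_ideal_part:
  assumes "p \<in> assoc_ideal"
  shows "fa_part par i p \<in> assoc_ideal"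
proof (rule linear_span_mem[OF linear_fa_part subspace_assoc_ideal _ assms[unfolded
    assoc_ideal_def]])
  fix q assume "q \<in> {mon u * gen l * mon v | u l v. l \<in> lhs}"
  then obtain u l v where q: "q = mon u * gen l * mon v" "l \<in> lhs" by blast
  obtain x y where l: "l = [x, Base y]" "x \<in> T" "y \<in> X" "y \<in> dom x"
    using q(2) by (rule lhs_cases)
  have "fa_hom par (par x + par (Base y)) (gen l)"
    unfolding l(1) gen_eq by (intro fa_hom_scale fa_hom_rel l)
  then have "fa_hom par (word_parity par u + (par x + par (Base y)) + word_parity par v) q"
    unfolding q(1) by (intro fa_hom_mult fa_hom_mono)
  moreover have "q \<in> assoc_ideal"
    unfolding assoc_ideal_def using q by (intro fa.span_base) blast
  ultimately show "fa_part par i q \<in> assoc_ideal"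
    by (simp add: fa_hom_part fa.subspace_0[OF subspace_assoc_ideal])
qed

lemma deg2_assoc_ideal: "p \<in> deg2 \<Longrightarrow> p \<in> assoc_ideal"
proof -
  have "gen l \<in> {mon u * gen l * mon v | u l v. l \<in> lhs}" if "l \<in> lhs" for l
    using that by (intro CollectI exI[of _ "[]"] exI[of _ l]) (simp add: mon_Nil)
  then have "gen ` lhs \<subseteq> {mon u * gen l * mon v | u l v. l \<in> lhs}" by blast
  then show "p \<in> deg2 \<Longrightarrow> p \<in> assoc_ideal"
    unfolding deg2_def assoc_ideal_def using fa.span_mono by blast
qed

lemma superbracket_assoc_ideal:
  assumes "p \<in> assoc_ideal \<or> q \<in> assoc_ideal"
  shows "superbracket par p q \<in> assoc_ideal"
  unfolding superbracket_def ksign_mult_eq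
  using assms assoc_ideal_mult assoc_ideal_part
  by (intro fa.subspace_sum[OF subspace_assoc_ideal] fa.subspace_diff[OF subspace_assoc_ideal]
      fa.subspace_scale[OF subspace_assoc_ideal]) blast+

text \<open>The associative ideal contains the relations and is closed under all rules generating
  \<open>I\<close>, since brackets are combinations of products of parity parts.\<close>

lemma ideal_subset_assoc_ideal: "p \<in> I \<Longrightarrow> p \<in> assoc_ideal"
  unfolding hnn_ideal_def
proof (induction rule: free_lie_ideal.induct)
  case (gen r)
  then have "r \<in> deg2"
    using rel_deg2 B_subset_A by (auto simp: relations_eq hnn_letters_def)
  then show ?case by (rule deg2_assoc_ideal)
qed (auto intro: assoc_ideal_part superbracket_assoc_ideal
    fa.subspace_0[OF subspace_assoc_ideal] fa.subspace_add[OF subspace_assoc_ideal]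
    fa.subspace_scale[OF subspace_assoc_ideal])

lemma subspace_I: "fa.subspace I"
  unfolding hnn_ideal_def fa.subspace_def by (auto intro: free_lie_ideal.intros)

lemma subspace_free_lie: "fa.subspace (free_lie par T :: ('l hnn_letter, 'k) free_assoc set)"
  unfolding fa.subspace_def by (auto intro: free_lie.intros)

lemma rel_in_I: "[x, Base y] \<in> lhs \<Longrightarrow> rel x y \<in> I"
  unfolding hnn_ideal_def relations_eq
  by (rule free_lie_ideal.gen) (auto simp: hnn_leading_words_def)

sublocale lie_reduction lt par T lhs I
proof
  show "(2::'k) \<noteq> 0" by (rule two)
  show "\<exists>x y. l = [x, y] \<and> x \<in> T \<and> y \<in> T \<and> (lt y x \<or> x = y \<and> par x = 1)" if l: "l \<in> lhs" for l
    using l by (rule lhs_cases) (auto simp: hnn_letters_def)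
  show "fa.subspace I" by (rule subspace_I)
  show "superbracket par p q \<in> I" if "p \<in> free_lie par T" "q \<in> I" for p q
    using that unfolding hnn_ideal_def by (rule free_lie_ideal.bracket_left)
  show "superbracket par p q \<in> I" if "p \<in> I" "q \<in> free_lie par T" for p q
    using that unfolding hnn_ideal_def by (rule free_lie_ideal.bracket_right)
  show "superbracket par (fa_letter x) (fa_letter y) \<in> fa.span (fa_letter ` T \<union> I)"
    if xy: "[x, y] \<in> lhs" for x y
  proof -
    obtain y' where y: "y = Base y'" "y' \<in> X"
      using xy by (rule lhs_cases) auto
    have "superbracket par (fa_letter x) (fa_letter y) = rel x y' + lin (act x y')"
      using y by (simp add: rel_def lin_basis)
    moreover have "rel x y' \<in> fa.span (fa_letter ` T \<union> I)"
      using rel_in_I xy y(1) by (intro fa.span_base) blast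
    moreover have "lin (act x y') \<in> fa.span (fa_letter ` T \<union> I)"
      using lin_letters fa.span_mono[of "fa_letter ` T" "fa_letter ` T \<union> I"] by blast
    ultimately show ?thesis by (simp add: fa.span_add)
  qed
qed

lemma exists_leading:
  "finite S \<Longrightarrow> S \<noteq> {} \<Longrightarrow>
    \<exists>w\<in>S. \<forall>v\<in>S. length v < length w \<or> length v = length w \<and> v \<preceq> (w :: 'l hnn_letter list)"
proof (induction S rule: finite_ne_induct)
  case (singleton x)
  then show ?case by (simp add: word_le_def)
next
  case (insert x S)
  then obtain w where w: "w \<in> S"
    "\<And>v. v \<in> S \<Longrightarrow> length v < length w \<or> length v = length w \<and> v \<preceq> w" by blast
  show ?case
  proof (cases "length x < length w \<or> length x = length w \<and> x \<preceq> w")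
    case True
    then show ?thesis using w by blast
  next
    case False
    then have "length w < length x \<or> length w = length x \<and> w \<preceq> x"
      using word.linear[of x w] by auto
    then have "length v < length x \<or> length v = length x \<and> v \<preceq> x" if "v \<in> insert x S" for v
      using that w(2)[of v] word.order.trans[of v w x] by auto
    then show ?thesis by blast
  qed
qed

lemma nmons_independent:
  assumes S: "finite S" "S \<subseteq> nmons" and sum: "(\<Sum>f\<in>S. fa_scale (c f) (ev f)) \<in> I"
  shows "\<forall>f\<in>S. c f = 0"
proof (rule ccontr)
  assume nonzero: "\<not> (\<forall>f\<in>S. c f = 0)"
  \<comment> \<open>Monomials with coefficient 0 must not compete for the leading word.\<close>
  define S' where "S' = {f \<in> S. c f \<noteq> 0}"
  define p where "p = (\<Sum>f\<in>S. fa_scale (c f) (ev f))"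
  have "assoc_word ` S' \<noteq> {}" "finite (assoc_word ` S')"
    using nonzero S(1) by (auto simp: S'_def)
  then obtain f where f: "f \<in> S'"
      and max: "\<And>g. g \<in> S' \<Longrightarrow> length (assoc_word g) < length (assoc_word f) \<or>
      length (assoc_word g) = length (assoc_word f) \<and> assoc_word g \<preceq> assoc_word f"
    using exists_leading[of "assoc_word ` S'"] by auto
  have super: "super_lyndon_shirshov par lt T g" if "g \<in> S" for g
    using that S(2) by (auto simp: nmons_def)
  have fS: "f \<in> S" using f by (simp add: S'_def)
  have keys: "length w = length (assoc_word g)" "w \<preceq> assoc_word g"
    if "w \<in> Poly_Mapping.keys (ev g)" "g \<in> S" for g w
    using that length_keys_evaluate super_leading(1)[OF super char(1)] by blast+
  \<comment> \<open>Nothing cancels at this word: another monomial with nonzero coefficient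
    containing it would have it as its own word, against \<open>super_inject\<close>.\<close>
  have "Poly_Mapping.lookup p (assoc_word f)
      = (\<Sum>g\<in>S. if g = f then c f * Poly_Mapping.lookup (ev f) (assoc_word f) else 0)"
    unfolding p_def lookup_sum
  proof (intro sum.cong refl)
    fix g assume g: "g \<in> S"
    have "assoc_word f \<notin> Poly_Mapping.keys (ev g)" if "g \<noteq> f" "c g \<noteq> 0"
    proof
      assume k: "assoc_word f \<in> Poly_Mapping.keys (ev g)"
      then have "assoc_word f \<preceq> assoc_word g" "assoc_word g \<preceq> assoc_word f"
        using keys[OF k g] max[of g] that g by (auto simp: S'_def)
      then have "assoc_word g = assoc_word f" by (rule word.order.antisym[rotated])
      then show False
        using super_inject[OF super[OF g] super[OF fS]] that by blast
    qed
    then show "Poly_Mapping.lookup (fa_scale (c g) (ev g)) (assoc_word f)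
        = (if g = f then c f * Poly_Mapping.lookup (ev f) (assoc_word f) else 0)"
      by (auto simp: in_keys_iff)
  qed
  then have "assoc_word f \<in> Poly_Mapping.keys p"
    using S(1) f super_leading(2)[OF super[OF fS] char(1)] by (simp add: in_keys_iff S'_def)
  \<comment> \<open>\<open>word_rel\<close> is contained in the length-lexicographic order, so a
    largest word there is maximal here.\<close>
  moreover have "(assoc_word f, w) \<notin> word_rel" if "w \<in> Poly_Mapping.keys p" for w
  proof -
    obtain g where g: "g \<in> S" "w \<in> Poly_Mapping.keys (fa_scale (c g) (ev g))"
      using \<open>w \<in> _\<close> keys_sum[of "\<lambda>f. fa_scale (c f) (ev f)" S] unfolding p_def by blast
    then have "g \<in> S'" "w \<in> Poly_Mapping.keys (ev g)" by (auto simp: S'_def in_keys_iff)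
    then have "length w < length (assoc_word f) \<or> length w = length (assoc_word f) \<and> w \<preceq>
        assoc_word f"
      using max[of g] keys[of w g] g(1) word.order.trans[of w "assoc_word g" "assoc_word f"] by auto
    then show ?thesis
      using word.leD[of w "assoc_word f"] by (auto simp: word_rel_def)
  qed
  moreover have "p \<in> fa.span {mon u * gen l * mon v | u l v. l \<in> lhs}"
    using ideal_subset_assoc_ideal[OF sum] by (simp add: p_def assoc_ideal_def)
  ultimately have "reducible (assoc_word f)" by (intro diamond) auto
  then obtain u l v where "assoc_word f = u @ l @ v" "l \<in> lhs" by (auto simp: reducible_def)
  then have "\<not> normal (assoc_word f)" by (auto simp: normal_def)
  then show False using fS S(2) by (auto simp: nmons_def)
qed

theorem basis:
  "basis_family (hnn_extension scale L bracket \<delta> d X B) (hnn_image scale L bracket \<delta> d X B) nmons"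
  unfolding hnn_extension_def hnn_image_def
proof (rule lie_quotient_basis[OF subspace_I subspace_free_lie])
  show "ev ` nmons \<subseteq> free_lie par T"
    using nmons_free_lie by blast
  show "free_lie par T \<subseteq> fa.span (ev ` nmons \<union> I)"
    using free_lie_nspan unfolding nspan_def by blast
qed (rule nmons_independent)

end

theorem theorem4p1:
  fixes scale :: "'k::field \<Rightarrow> 'l::ab_group_add \<Rightarrow> 'l"
    and L :: "bit \<Rightarrow> 'l set"
    and bracket :: "'l \<Rightarrow> 'l \<Rightarrow> 'l"
    and A :: "'l set"
    and \<delta> :: bit
    and d :: "'l \<Rightarrow> 'l"
    and X B :: "'l set"
    and lt :: "'l hnn_letter \<Rightarrow> 'l hnn_letter \<Rightarrow> bool"
  assumes char: "CHAR('k) \<noteq> 2" "CHAR('k) \<noteq> 3"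
    and L: "lie_superalgebra scale L bracket"
    and A: "lie_subalgebra scale L bracket A" "A \<noteq> UNIV"
    and d: "superderivation scale L bracket A \<delta> d"
    and X: "linear_basis scale UNIV X" "X \<subseteq> L 0 \<union> L 1"
    and B: "linear_basis scale A B" "B \<subseteq> X"
    and order: "irreflp_on (hnn_letters X) lt" "transp_on (hnn_letters X) lt"
      "totalp_on (hnn_letters X) lt"
    and order_BXt: "\<And>a x. a \<in> B \<Longrightarrow> x \<in> X - B \<Longrightarrow>
      lt (Base a) (Base x) \<and> lt (Base x) Stable"
  shows "basis_family (hnn_extension scale L bracket \<delta> d X B)
    (hnn_image scale L bracket \<delta> d X B)
    {f. super_lyndon_shirshov (hnn_parity L \<delta>) lt (hnn_letters X) f \<and>
        (\<forall>s\<in>hnn_leading_words L lt X B. \<not> sublist s (assoc_word f))}"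
proof -
  obtain lt' where lt': "letter_order lt'"
    and eq: "\<And>x y. x \<in> hnn_letters X \<Longrightarrow> y \<in> hnn_letters X \<Longrightarrow> lt' x y \<longleftrightarrow> lt x y"
    using order_extension[OF order] by blast
  have "hnn scale L bracket lt' A \<delta> d X B"
  proof (intro hnn.intro hnn_axioms.intro L lt' char A d X B)
    show "lt' (Base a) (Base x) \<and> lt' (Base x) Stable" if "a \<in> B" "x \<in> X - B" for a x
      using order_BXt[OF that] that B(2) by (subst (1 2) eq) (auto simp: hnn_letters_def)
  qed
  then interpret hnn scale L bracket lt' A \<delta> d X B .
  \<comment> \<open>Both orders agree on the occurring letters, so neither the forbidden words nor
    the monomials change.\<close>
  have "lhs = hnn_leading_words L lt X B"
    by (rule hnn_leading_words_cong) (rule eq)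
  moreover have "super_lyndon_shirshov par lt' T f \<longleftrightarrow> super_lyndon_shirshov par lt T f" for f
    by (rule super_lyndon_shirshov_cong) (rule eq)
  ultimately show ?thesis
    using basis unfolding nmons_def normal_def by (simp only:)
qed

end
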